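(* Let $a,A\ge 0$ and $b,B\ge 1$ be integers with $\gcd(a,b)=1$, and assume $B\nmid A$ whenever $b=1$. Let $k\geq 1$ and $h$ be integers with $\gcd(h,k)=1$, and put $k'=\frac{k}{\gcd(k,B)}$. If $\frac{h}{k}\in\mathcal{Q}_{a,b,A,B}$, i.e. if $b\mid k$ and $\gcd(k,B)\mid\left(\frac{ak}{b}+Ah\right)$, then $$\lim_{q\to\zeta_k^h}\left(g_3(\zeta_b^a q^A,q^B)-\frac{(q^B;q^B)_\infty^2\, j(q^{\frac{B}{2}},q^B)^2}{\zeta_b^a q^A\, j(\zeta_b^a q^{A+\frac{B}{2}},q^B)^2\, j(\zeta_b^a q^A,q^B)}\right)$$ $$=-\zeta_b^{-a}\zeta_k^{-hA}+\zeta_b^{-2a}\zeta_k^{-2hA}\sum_{n=1}^{k'}(\zeta_b^{-a}\zeta_k^{h(B-A)};\zeta_k^{hB})_{n-1}\,(\zeta_b^a\zeta_k^{hA};\zeta_k^{hB})_n\,\zeta_k^{hBn}.$$ Here $q^{\frac B2}$ denotes a square root of $q^B$ (with $q^{A+\frac B2}=q^A q^{\frac B2}$), and the choice of the square root does not matter.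
   Context: Notation: $\zeta_k^h:=e^{2\pi i h/k}$. For $n\in\{0,1,2,\dots\}\cup\{\infty\}$, $(a;q)_n:=\prod_{j=0}^{n-1}(1-aq^j)$ and $(a_1,\dots,a_m;q)_n:=\prod_{i=1}^m(a_i;q)_n$ (for finite $n$ this is also used when $q$ is a root of unity). For $0<|q|<1$ and $x\neq0$, $j(x,q):=(x,q/x,q;q)_\infty$. The universal mock theta function $g_3$ is $g_3(x,q):=\sum_{n\ge1}\frac{q^{n(n-1)}}{(x,q/x;q)_n}$ for $0<|q|<1$. Limits are radial from within the unit disc: for a root of unity $\zeta$ and a function $F$ on the unit disc, $\lim_{q\to\zeta}F(q):=\lim_{t\to0^+}F(\zeta e^{-t})$. The set of cusps is $\mathcal{Q}_{a,b,A,B}:=\left\{\frac hk\in\mathbb{Q}: b\mid k\text{ and }\gcd(k,B)\mid\left(\frac{ak}{b}+Ah\right)\right\}$, with $\frac hk$ written in lowest terms.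
   Formalization: For odd k' the square root q^{B/2} must be the one whose k'-th power (a real number) is negative, while for even k' either root is allowed; with the other root the claim fails: for a=0, b=1, A=1, B=2, h/k=0/1, q^{B/2}=q the denominator vanishes. *)

theory Defs
  imports "HOL-Analysis.Analysis"
begin

definition zeta :: "int \<Rightarrow> nat \<Rightarrow> complex" where
  "zeta h k = exp (2 * of_real pi * \<i> * of_int h / of_nat k)"

definition qpoch :: "complex \<Rightarrow> complex \<Rightarrow> nat \<Rightarrow> complex" where
  "qpoch a q n = (\<Prod>j<n. 1 - a * q ^ j)"

definition qpoch_inf :: "complex \<Rightarrow> complex \<Rightarrow> complex" where
  "qpoch_inf a q = (\<Prod>j. 1 - a * q ^ j)"

definition jtheta :: "complex \<Rightarrow> complex \<Rightarrow> complex" where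
  "jtheta x q = qpoch_inf x q * qpoch_inf (q / x) q * qpoch_inf q q"

text \<open>The sum runs over the positive integers; \<open>Suc n\<close> plays the role of the summation index.\<close>

definition g3 :: "complex \<Rightarrow> complex \<Rightarrow> complex" where
  "g3 x q = (\<Sum>n. q ^ (Suc n * (Suc n - 1)) / (qpoch x q (Suc n) * qpoch (q / x) q (Suc n)))"

definition radial :: "complex \<Rightarrow> real \<Rightarrow> complex" where
  "radial \<zeta> t = \<zeta> * of_real (exp (- t))"

definition has_radial_limit :: "(complex \<Rightarrow> complex) \<Rightarrow> complex \<Rightarrow> complex \<Rightarrow> bool" where
  "has_radial_limit F \<zeta> L \<longleftrightarrow> ((\<lambda>t. F (radial \<zeta> t)) \<longlongrightarrow> L) (at_right 0)"

text \<open>The quotient \<open>a * k div b\<close> is exact because \<open>b\<close> divides \<open>k\<close>.\<close>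

definition cusps :: "nat \<Rightarrow> nat \<Rightarrow> nat \<Rightarrow> nat \<Rightarrow> rat set" where
  "cusps a b A B = {of_int h / of_nat k | h k.
     0 < k \<and> coprime h (int k) \<and> b dvd k \<and>
     int (gcd k B) dvd int (a * k div b) + int A * h}"

text \<open>The term subtracted from \<open>g3 x Q\<close>, where \<open>s\<close> is a square root of the nome \<open>Q\<close>.
  It is not invariant under \<open>s \<mapsto> - s\<close>.  If \<open>Q\<close> is a positive multiple of a primitive \<open>m\<close>-th
  root of unity, then \<open>s ^ m\<close> is real and nonzero.  For even \<open>m\<close> it is negative for both square
  roots, and for odd \<open>m\<close> it is negative for exactly one of them.  For odd \<open>m\<close> the
  subtracted term matches the growth of \<open>g3\<close> at the cusp only for that root: for \<open>m = 1\<close> and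
  \<open>x = Q powr \<alpha>\<close> with \<open>0 < \<alpha> < 1\<close>, replacing it by the other root changes the leading
  coefficient by the factor \<open>1 / (cos (pi * \<alpha>))\<^sup>2\<close>, and for \<open>\<alpha> = 1/2\<close> the denominator vanishes
  identically.\<close>

definition theta_part :: "complex \<Rightarrow> complex \<Rightarrow> complex \<Rightarrow> complex" where
  "theta_part x Q s =
     (qpoch_inf Q Q)\<^sup>2 * (jtheta s Q)\<^sup>2 / (x * (jtheta (x * s) Q)\<^sup>2 * jtheta x Q)"

end

theory Submission
  imports Defs
begin

text \<open>
  The bilateral series \<open>F(x, y) = \<Sum> q\<^sup>n / ((x q\<^sup>n; q) (y q\<^sup>n; q))\<close> over all integers \<open>n\<close>, with infinite
  products in the denominator, links the two sides: after multiplication by \<open>(x; q) (q/x; q)\<close>, the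
  terms of \<open>F(x, 1/x)\<close> with \<open>n \<ge> 1\<close> are those of the series whose truncation is the limit, and the
  others form a series that equals \<open>-x (1 + x g\<^sub>3(x, q))\<close>.

  \<open>F(x, y)\<close> is an Appell sum divided by \<open>j(y, q)\<close>, so \<open>F(x, y) - s F(x s, y s)\<close> is a theta quotient.
  For \<open>y = 1/x\<close> and \<open>s\<^sup>2 = q\<close> it is the subtracted theta term, up to the factor
  \<open>(x; q) (q/x; q)\<close>. What remains of the difference is the unilateral series and a multiple of
  \<open>(x; q) (q/x; q) F(x s, s/x)\<close>.

  Near the cusp, where \<open>x\<close> approaches a power of the nome \<open>q\<close>, the products \<open>(x; q)\<^sub>n\<close> decay
  geometrically in \<open>n\<close> until \<open>n\<close> is of the order of \<open>1 / (1 - |q|)\<close>. Hence the unilateral series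
  converges termwise and \<open>(x; q)\<close> is smaller than any power of \<open>1 - |q|\<close>, whereas
  \<open>F(x s, s/x)\<close> is \<open>O(1 / (1 - |q|))\<close>: by the choice of \<open>s\<close>, the \<open>m\<close>-th powers of \<open>x s\<close> and \<open>s/x\<close> are
  negative, \<open>m\<close> being the order of the root of unity, which keeps the denominators away from \<open>0\<close>.
\<close>

subsection \<open>Finite q-products and sums over the integers\<close>

text \<open>Near the cusp \<open>g3\<close> and the theta term can both be large, so separate
  asymptotics would have to be matched. Here the cancellation is algebraic instead:
  \<open>g3_minus_theta_part\<close> is exact inside the disc, and only quantities that converge or
  tend to 0 are estimated. Besides moving the arguments to where products are bounded below, the
  shift by a square root of \<open>q\<close> sends \<open>(x, 1/x)\<close> to a pair with product
  \<open>q\<close>; the two theta values of that pair coincide by reflection, whence the square in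
  the denominator. No modular transformation is used: \<open>m\<close> consecutive factors of a
  q-product are compared with their value \<open>1 - u^m\<close> at the root of unity. The cusp
  condition enters as \<open>x0^m = 1\<close>, which causes both the decay of the products and the
  truncation of the limit series. Of the decay only the second power of \<open>1 - |q|\<close> is
  kept: two products then outweigh the single inverse power in the bound for the bilateral series,
  and the same error, damped by \<open>|q|^n\<close>, is at most \<open>2 / n^2\<close>.\<close>

lemma qpoch_0 [simp]: "qpoch a q 0 = 1"
  by (simp add: qpoch_def)

lemma qpoch_Suc: "qpoch a q (Suc n) = qpoch a q n * (1 - a * q ^ n)"
  by (simp add: qpoch_def)

lemma qpoch_add: "qpoch a q (m + n) = qpoch a q m * qpoch (a * q ^ m) q n"
  by (induction n) (simp_all add: qpoch_Suc power_add mult.assoc)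

lemma qpoch_Suc_shift: "qpoch a q (Suc n) = (1 - a) * qpoch (a * q) q n"
  using qpoch_add[of a q 1 n] by (simp add: qpoch_Suc)

lemma qpoch_eq_0_iff: "qpoch a q n = 0 \<longleftrightarrow> (\<exists>j<n. a * q ^ j = 1)"
  by (auto simp: qpoch_def)

text \<open>The Gaussian weight of the theta series. The product \<open>n * (n - 1)\<close> is even
  for every integer \<open>n\<close>, so the division is exact.\<close>

definition qtri :: "complex \<Rightarrow> int \<Rightarrow> complex" where
  "qtri q n = q powi (n * (n - 1) div 2)"

lemma qtri_0 [simp]: "qtri q 0 = 1"
  and qtri_1 [simp]: "qtri q 1 = 1"
  by (simp_all add: qtri_def)

lemma qtri_add:
  assumes "q \<noteq> 0"
  shows "qtri q (m + n) = qtri q m * qtri q n * q powi (m * n)"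
proof -
  have "(m + n) * (m + n - 1) = m * (m - 1) + n * (n - 1) + 2 * (m * n)"
    by (simp add: algebra_simps)
  moreover have "even (m * (m - 1))" "even (n * (n - 1))" by auto
  ultimately have "(m + n) * (m + n - 1) div 2 = m * (m - 1) div 2 + n * (n - 1) div 2 + m * n"
    by (simp add: div_add)
  then show ?thesis
    using assms by (simp add: qtri_def power_int_add)
qed

lemma qtri_nonzero [simp]: "q \<noteq> 0 \<Longrightarrow> qtri q n \<noteq> 0"
  by (simp add: qtri_def)

lemma qtri_Suc: "q \<noteq> 0 \<Longrightarrow> qtri q (n + 1) = qtri q n * q powi n"
  by (simp add: qtri_add)

lemma qtri_minus: "q \<noteq> 0 \<Longrightarrow> qtri q (- n) = qtri q (n + 1)"
  unfolding qtri_def by (simp add: algebra_simps)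

lemma qtri_square: "q \<noteq> 0 \<Longrightarrow> qtri q n * qtri q n = q powi (n * n - n)"
proof -
  assume "q \<noteq> 0"
  have "even (n * (n - 1))" by auto
  then have "n * (n - 1) div 2 + n * (n - 1) div 2 = n * n - n"
    by (metis div_mult_mod_eq dvd_imp_mod_0 add.right_neutral mult_2_right right_diff_distrib mult.right_neutral)
  then show ?thesis using \<open>q \<noteq> 0\<close>
    by (simp add: qtri_def flip: power_int_add)
qed

text \<open>The ratio appears as a factor and not as a quotient, so vanishing terms need no separate
  treatment.\<close>

lemma summable_ratio_tendsto_0:
  fixes f :: "nat \<Rightarrow> complex"
  assumes "\<And>n. f (Suc n) = r n * f n" "r \<longlonglongrightarrow> l" "norm l < 1"
  shows "summable (\<lambda>n. norm (f n))"
proof -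
  obtain c where c: "norm l < c" "c < 1" using assms(3) dense by blast
  have "(\<lambda>n. norm (r n)) \<longlonglongrightarrow> norm l"
    using assms(2) by (rule tendsto_norm)
  then have "eventually (\<lambda>n. norm (r n) < c) sequentially"
    using c(1) order_tendstoD(2) by blast
  then obtain N where N: "\<And>n. n \<ge> N \<Longrightarrow> norm (r n) < c"
    by (auto simp: eventually_sequentially)
  show ?thesis
  proof (rule summable_ratio_test[OF c(2)])
    fix n assume "n \<ge> N"
    then show "norm (norm (f (Suc n))) \<le> c * norm (norm (f n))"
      using N[of n] by (auto simp: assms(1) norm_mult intro!: mult_right_mono)
  qed
qed

text \<open>Series over the integers are handled as unordered sums, for which reindexing and
  interchange of summation are available; this criterion reduces them to two ratio tests. Writing
  negative indices as \<open>- int n - 1\<close> counts 0 once.\<close>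

lemma has_sum_int_of_sums:
  fixes f :: "int \<Rightarrow> complex"
  assumes s1: "summable (\<lambda>n. norm (f (int n)))" and s2: "summable (\<lambda>n. norm (f (- int n - 1)))"
  shows "(f has_sum ((\<Sum>n. f (int n)) + (\<Sum>n. f (- int n - 1)))) UNIV"
    and "(\<lambda>x. norm (f x)) summable_on UNIV"
proof -
  have b1: "bij_betw int UNIV {0..}"
    by (rule bij_betwI[of _ _ _ nat]) auto
  have b2: "bij_betw (\<lambda>n. - int n - 1) UNIV {..<0}"
    by (rule bij_betwI[of _ _ _ "\<lambda>k. nat (- k - 1)"]) auto
  have U: "(UNIV :: int set) = {0..} \<union> {..<0}" by auto
  have 1: "(f has_sum (\<Sum>n. f (int n))) {0..}"
    using norm_summable_imp_has_sum[OF s1 summable_sums[OF summable_norm_cancel[OF s1]]]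
    by (simp add: has_sum_reindex_bij_betw[OF b1])
  have 2: "(f has_sum (\<Sum>n. f (- int n - 1))) {..<0}"
    using norm_summable_imp_has_sum[OF s2 summable_sums[OF summable_norm_cancel[OF s2]]]
    by (simp add: has_sum_reindex_bij_betw[OF b2])
  show "(f has_sum ((\<Sum>n. f (int n)) + (\<Sum>n. f (- int n - 1)))) UNIV"
    unfolding U by (rule has_sum_Un_disjoint[OF 1 2]) auto
  have 1: "(\<lambda>x. norm (f x)) summable_on {0..}"
    using norm_summable_imp_summable_on[of "\<lambda>n. norm (f (int n))"] s1
      summable_on_reindex_bij_betw[OF b1, of "\<lambda>x. norm (f x)"] by simp
  have 2: "(\<lambda>x. norm (f x)) summable_on {..<0}"
    using norm_summable_imp_summable_on[of "\<lambda>n. norm (f (- int n - 1))"] s2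
      summable_on_reindex_bij_betw[OF b2, of "\<lambda>x. norm (f x)"] by simp
  show "(\<lambda>x. norm (f x)) summable_on UNIV"
    unfolding U by (rule summable_on_Un_disjoint[OF 1 2]) auto
qed

lemma abs_summable_on_times:
  fixes f :: "'a \<Rightarrow> complex" and g :: "'b \<Rightarrow> complex"
  assumes "(\<lambda>x. norm (f x)) summable_on A" "(\<lambda>x. norm (g x)) summable_on B"
  shows "(\<lambda>p. norm (case p of (x, y) \<Rightarrow> f x * g y)) summable_on (A \<times> B)"
  unfolding Infinite_Sum.abs_summable_on_Sigma_iff
  using assms by (auto simp: norm_mult abs_mult infsum_nonneg infsum_cmult_right' intro!: summable_on_cmult_right summable_on_cmult_left)

lemma has_sum_times:
  fixes f :: "'a \<Rightarrow> complex" and g :: "'b \<Rightarrow> complex"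
  assumes "(\<lambda>x. norm (f x)) summable_on A" "(\<lambda>x. norm (g x)) summable_on B" "(f has_sum a) A" "(g has_sum b) B"
  shows "((\<lambda>(x, y). f x * g y) has_sum (a * b)) (A \<times> B)"
proof (rule has_sum_SigmaI)
  show "(\<lambda>(x, y). f x * g y) summable_on A \<times> B"
    using abs_summable_on_times[OF assms(1,2)] by (rule abs_summable_summable)
  show "((\<lambda>x. f x * b) has_sum a * b) A"
    using assms(3) by (rule has_sum_cmult_left)
qed (use assms(4) in \<open>auto intro: has_sum_cmult_right\<close>)

lemma bounded_inverse_of_LIMSEQ:
  fixes f :: "nat \<Rightarrow> complex"
  assumes "f \<longlonglongrightarrow> l" "l \<noteq> 0"
  shows "\<exists>C>0. \<forall>n. norm (1 / f n) \<le> C"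
proof -
  have "(\<lambda>n. 1 / f n) \<longlonglongrightarrow> 1 / l"
    using assms by (intro tendsto_divide tendsto_const)
  then have "Bseq (\<lambda>n. 1 / f n)"
    using convergent_imp_Bseq convergentI by blast
  then show ?thesis unfolding Bseq_def by blast
qed

lemma tannery_sequence:
  fixes a :: "nat \<Rightarrow> nat \<Rightarrow> complex"
  assumes "\<And>k. (\<lambda>n. a k n) \<longlonglongrightarrow> b k" "\<And>k n. norm (a k n) \<le> M k" "summable M"
  shows "(\<lambda>n. \<Sum>k. a k n) \<longlonglongrightarrow> (\<Sum>k. b k)"
  using tannerys_theorem[where a = a and b = b and M = M and F = sequentially] assms
  by (simp add: always_eventually)

text \<open>Supplies the inner sums when a double sum is iterated: unconditional summability is
  inherited from the double family, while the value comes from an ordinary series identity.\<close>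

lemma has_sum_of_summable_sums:
  fixes f :: "nat \<Rightarrow> complex"
  assumes "f summable_on UNIV" "f sums s"
  shows "(f has_sum s) UNIV"
proof -
  have "(f has_sum infsum f UNIV) UNIV" using assms(1) by simp
  moreover from has_sum_imp_sums[OF this] have "infsum f UNIV = s"
    using assms(2) by (rule sums_unique2)
  ultimately show ?thesis by simp
qed

text \<open>Regroups a double sum along \<open>n + k\<close>. The triple product and the collection
  of poles in \<open>bilateral_appell\<close> both rest on this change of variables.\<close>

lemma has_sum_shear:
  fixes f :: "int \<times> nat \<Rightarrow> complex"
  shows "((\<lambda>(n, k). f (n + int k, k)) has_sum s) (UNIV \<times> UNIV) \<longleftrightarrow> (f has_sum s) (UNIV \<times> UNIV)"
proof -
  have "bij_betw (\<lambda>(n, k). (n + int k, k)) (UNIV \<times> UNIV) (UNIV \<times> UNIV)"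
    by (rule bij_betwI[of _ _ _ "\<lambda>(n, k). (n - int k, k)"]) auto
  from has_sum_reindex_bij_betw[OF this, of f s] show ?thesis
    by (simp add: case_prod_unfold)
qed

lemma has_sum_shear_int:
  fixes f :: "int \<times> int \<Rightarrow> complex"
  shows "((\<lambda>(N, n). f (N - n, n)) has_sum s) (UNIV \<times> UNIV) \<longleftrightarrow> (f has_sum s) (UNIV \<times> UNIV)"
proof -
  have "bij_betw (\<lambda>(N, n). (N - n, n)) (UNIV \<times> UNIV) (UNIV \<times> (UNIV :: int set))"
    by (rule bij_betwI[of _ _ _ "\<lambda>(m, n). (m + n, n)"]) auto
  from has_sum_reindex_bij_betw[OF this, of f s] show ?thesis
    by (simp add: case_prod_unfold)
qed

lemma has_sum_int_split:
  fixes f :: "int \<Rightarrow> complex"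
  assumes "(f has_sum S) UNIV"
  shows "summable (\<lambda>n. f (int n))" "summable (\<lambda>n. f (- int n - 1))"
    "S = (\<Sum>n. f (int n)) + (\<Sum>n. f (- int n - 1))"
proof -
  have b1: "bij_betw int UNIV {0..}"
    by (rule bij_betwI[of _ _ _ nat]) auto
  have b2: "bij_betw (\<lambda>n. - int n - 1) UNIV {..<0}"
    by (rule bij_betwI[of _ _ _ "\<lambda>k. nat (- k - 1)"]) auto
  have U: "(UNIV :: int set) = {0..} \<union> {..<0}" by auto
  have "f summable_on UNIV" using assms by (rule has_sum_imp_summable)
  then have s: "f summable_on {0..}" "f summable_on {..<0}"
    by (auto intro: summable_on_subset_banach)
  then obtain s1 s2 where h: "(f has_sum s1) {0..}" "(f has_sum s2) {..<0}"
    by (auto simp: summable_on_def)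
  have "(f has_sum (s1 + s2)) UNIV"
    unfolding U by (rule has_sum_Un_disjoint[OF h]) auto
  with assms have S: "S = s1 + s2" by (rule has_sum_unique)
  have 1: "(\<lambda>n. f (int n)) sums s1"
    using h(1) by (intro has_sum_imp_sums) (simp add: has_sum_reindex_bij_betw[OF b1])
  have 2: "(\<lambda>n. f (- int n - 1)) sums s2"
    using h(2) by (intro has_sum_imp_sums) (simp add: has_sum_reindex_bij_betw[OF b2])
  show "summable (\<lambda>n. f (int n))" "summable (\<lambda>n. f (- int n - 1))"
    "S = (\<Sum>n. f (int n)) + (\<Sum>n. f (- int n - 1))"
    using 1 2 S by (auto simp: sums_iff)
qed

subsection \<open>Infinite q-products and the Durfee square identity\<close>

locale nome =
  fixes q :: complex
  assumes q_nz [simp]: "q \<noteq> 0" and q_lt: "norm q < 1"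
begin

lemma q_tendsto: "(\<lambda>n. z * q ^ n) \<longlonglongrightarrow> 0"
  using q_lt by (auto intro!: tendsto_mult_right_zero LIMSEQ_power_zero)

lemma norm_mult_power_less:
  assumes "norm z < 1"
  shows "norm (z * q ^ n) < 1"
proof -
  have "norm (z * q ^ n) \<le> norm z"
    using q_lt by (simp add: norm_mult norm_power mult_left_le power_le_one)
  with assms show ?thesis by linarith
qed

lemma convergent_qpoch: "convergent_prod (\<lambda>j. 1 - a * q ^ j)"
proof -
  have "summable (\<lambda>j. norm a * norm q ^ j)"
    using q_lt by (intro summable_mult summable_geometric) auto
  then have "abs_convergent_prod (\<lambda>j. 1 - a * q ^ j)"
    by (simp add: abs_convergent_prod_conv_summable norm_mult norm_power)
  then show ?thesis by (rule abs_convergent_prod_imp_convergent_prod)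
qed

lemma qpoch_LIMSEQ: "(\<lambda>n. qpoch a q n) \<longlonglongrightarrow> qpoch_inf a q"
  using convergent_prod_LIMSEQ[OF convergent_qpoch[of a]]
  by (simp add: qpoch_def qpoch_inf_def LIMSEQ_lessThan_iff_atMost)

lemma qpoch_inf_split: "qpoch_inf a q = qpoch a q n * qpoch_inf (a * q ^ n) q"
proof (rule LIMSEQ_unique)
  show "(\<lambda>m. qpoch a q (n + m)) \<longlonglongrightarrow> qpoch_inf a q"
    using LIMSEQ_ignore_initial_segment[OF qpoch_LIMSEQ, of a n] by (simp add: add.commute)
  show "(\<lambda>m. qpoch a q (n + m)) \<longlonglongrightarrow> qpoch a q n * qpoch_inf (a * q ^ n) q"
    unfolding qpoch_add by (intro tendsto_intros qpoch_LIMSEQ)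
qed

lemma qpoch_inf_Suc: "qpoch_inf a q = (1 - a) * qpoch_inf (a * q) q"
  using qpoch_inf_split[of a 1] by (simp add: qpoch_Suc)

lemma qpoch_inf_eq_0_iff: "qpoch_inf a q = 0 \<longleftrightarrow> (\<exists>j. a * q ^ j = 1)"
proof
  assume "qpoch_inf a q = 0"
  then show "\<exists>j. a * q ^ j = 1"
    using prodinf_nonzero[OF convergent_qpoch[of a]] by (auto simp: qpoch_inf_def)
next
  assume "\<exists>j. a * q ^ j = 1"
  then obtain j where "a * q ^ j = 1" by blast
  then show "qpoch_inf a q = 0"
    using qpoch_inf_split[of a j] qpoch_inf_Suc[of "a * q ^ j"] by simp
qed

lemma qq_nonzero [simp]: "qpoch q q n \<noteq> 0"
  and qq_inf_nonzero [simp]: "qpoch_inf q q \<noteq> 0"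
proof -
  have "norm (q * q ^ j) \<noteq> 1" for j
    using q_lt power_Suc_less_one[of "norm q" j] by (auto simp: norm_mult norm_power)
  then have *: "q * q ^ j \<noteq> 1" for j by (metis norm_one)
  show "qpoch q q n \<noteq> 0" "qpoch_inf q q \<noteq> 0"
    using * by (auto simp: qpoch_eq_0_iff qpoch_inf_eq_0_iff)
qed

lemma bounded_inverse_qq: "\<exists>C>0. \<forall>n. norm (1 / qpoch q q n) \<le> C"
  by (rule bounded_inverse_of_LIMSEQ[OF qpoch_LIMSEQ]) simp

text \<open>Iterating the functional equation splits off finite products, and the limit fixes what
  remains. Only the orbit \<open>z q^n\<close> is inspected, so no analyticity of \<open>f\<close>
  is involved.\<close>

lemma qpoch_inf_eqI:
  assumes "\<And>n. f (z * q ^ n) = (1 - z * q ^ n) * f (z * q ^ Suc n)"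
    and "(\<lambda>n. f (z * q ^ n)) \<longlonglongrightarrow> 1"
  shows "f z = qpoch_inf z q"
proof -
  have *: "f z = qpoch z q n * f (z * q ^ n)" for n
    by (induction n) (use assms(1) in \<open>simp_all add: qpoch_Suc\<close>)
  have "(\<lambda>n. qpoch z q n * f (z * q ^ n)) \<longlonglongrightarrow> qpoch_inf z q * 1"
    by (intro tendsto_intros qpoch_LIMSEQ assms(2))
  then have "(\<lambda>n. f z) \<longlonglongrightarrow> qpoch_inf z q"
    unfolding *[symmetric] by simp
  then show ?thesis
    by (simp add: LIMSEQ_const_iff)
qed

text \<open>Stated with a product, so that nothing is presupposed about zeros: for nonzero
  \<open>c\<close> the conclusion itself shows that \<open>qpoch_inf z q\<close> is nonzero.\<close>

lemma inverse_qpoch_inf_eqI: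
  assumes "\<And>n. f (z * q ^ Suc n) = (1 - z * q ^ n) * f (z * q ^ n)"
    and "(\<lambda>n. f (z * q ^ n)) \<longlonglongrightarrow> c"
  shows "f z * qpoch_inf z q = c"
proof -
  have *: "f z * qpoch z q n = f (z * q ^ n)" for n
    by (induction n) (use assms(1) in \<open>simp_all add: qpoch_Suc mult_ac\<close>)
  have "(\<lambda>n. f z * qpoch z q n) \<longlonglongrightarrow> f z * qpoch_inf z q"
    by (intro tendsto_intros qpoch_LIMSEQ)
  with assms(2) show ?thesis
    by (auto simp: * intro: LIMSEQ_unique)
qed

section \<open>Euler's expansions of the q-product and of its reciprocal\<close>

lemma summable_euler1:
  assumes "norm z < 1"
  shows "summable (\<lambda>k. norm (z ^ k / qpoch q q k))"
proof (rule summable_ratio_tendsto_0[where r = "\<lambda>k. z / (1 - q * q ^ k)" and l = "z / (1 - 0)"])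
  show "(\<lambda>k. z / (1 - q * q ^ k)) \<longlonglongrightarrow> z / (1 - 0)"
    by (intro tendsto_intros q_tendsto) auto
qed (use assms in \<open>auto simp: qpoch_Suc field_simps\<close>)

lemma euler1:
  assumes "norm z < 1"
  shows "(\<lambda>k. z ^ k / qpoch q q k) sums (1 / qpoch_inf z q)"
proof -
  define e where "e = (\<lambda>z. \<Sum>k. (1 / qpoch q q k) * z ^ k)"
  have sm: "summable (\<lambda>k. (1 / qpoch q q k) * z ^ k)" if "norm z < 1" for z
    using summable_norm_cancel[OF summable_euler1[OF that]] by simp
  have small: "norm (z * q ^ n) < 1" for n
    by (rule norm_mult_power_less[OF assms])
  have rec: "e (z * q) = (1 - z) * e z" if "norm z < 1" for z
  proof -
    have zq: "norm (z * q) < 1"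
      using norm_mult_power_less[OF that, of 1] by simp
    have "e z - e (z * q) = (\<Sum>k. (1 / qpoch q q k) * z ^ k - (1 / qpoch q q k) * (z * q) ^ k)"
      unfolding e_def by (rule suminf_diff[OF sm[OF that] sm[OF zq]])
    also have "\<dots> = (\<Sum>k. (1 / qpoch q q (Suc k)) * z ^ Suc k - (1 / qpoch q q (Suc k)) * (z * q) ^ Suc k)"
      by (subst suminf_split_head) (use sm[OF that] sm[OF zq] in \<open>auto intro: summable_diff\<close>)
    \<comment> \<open>The difference \<open>z^(k+1) - (z q)^(k+1)\<close> produces the factor
      \<open>1 - q^(k+1)\<close>, which cancels the last factor of
      \<open>qpoch q q (Suc k)\<close>.\<close>
    also have "\<dots> = (\<Sum>k. z * ((1 / qpoch q q k) * z ^ k))"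
    proof (rule suminf_cong)
      fix k
      have "1 - q * q ^ k \<noteq> 0" using qq_nonzero[of "Suc k"] by (auto simp: qpoch_Suc)
      then show "(1 / qpoch q q (Suc k)) * z ^ Suc k - (1 / qpoch q q (Suc k)) * (z * q) ^ Suc k
          = z * ((1 / qpoch q q k) * z ^ k)"
        by (simp add: qpoch_Suc divide_simps power_mult_distrib) (simp add: algebra_simps)
    qed
    also have "\<dots> = z * e z" unfolding e_def by (rule suminf_mult[OF sm[OF that]])
    finally show ?thesis by (simp add: algebra_simps)
  qed
  have "isCont e 0"
    unfolding e_def by (rule isCont_powser[where K = "1/2"]) (use sm[of "1/2"] in auto)
  then have "(\<lambda>n. e (z * q ^ n)) \<longlonglongrightarrow> e 0"
    using q_tendsto isCont_tendsto_compose by blast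
  moreover have "e 0 = 1" unfolding e_def by (subst powser_zero) simp
  ultimately have lim: "(\<lambda>n. e (z * q ^ n)) \<longlonglongrightarrow> 1" by simp
  have "e z * qpoch_inf z q = 1"
    by (rule inverse_qpoch_inf_eqI[of e, OF _ lim]) (use rec[OF small] in \<open>simp add: mult_ac\<close>)
  then have "e z = 1 / qpoch_inf z q"
    by (cases "qpoch_inf z q = 0") (simp_all add: field_simps)
  then show ?thesis
    using summable_sums[OF sm[OF assms]] by (simp add: e_def)
qed

lemma summable_euler2:
  "summable (\<lambda>k. norm ((-1) ^ k * qtri q (int k) * z ^ k / qpoch q q k))"
proof (rule summable_ratio_tendsto_0[where r = "\<lambda>k. - (z * q ^ k) / (1 - q * q ^ k)" and l = "- 0 / (1 - 0)"])
  show "(\<lambda>k. - (z * q ^ k) / (1 - q * q ^ k)) \<longlonglongrightarrow> - 0 / (1 - 0)"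
    by (intro tendsto_intros q_tendsto) auto
  fix k
  have "qtri q (int (Suc k)) = qtri q (int k) * q ^ k"
    using qtri_Suc[OF q_nz, of "int k"] by (simp add: add.commute)
  then show "(-1) ^ Suc k * qtri q (int (Suc k)) * z ^ Suc k / qpoch q q (Suc k) =
      - (z * q ^ k) / (1 - q * q ^ k) * ((-1) ^ k * qtri q (int k) * z ^ k / qpoch q q k)"
    by (simp add: qpoch_Suc mult_ac)
qed auto

lemma qtri_int_Suc: "qtri q (int (Suc k)) = qtri q (int k) * q ^ k"
  using qtri_Suc[OF q_nz, of "int k"] by (simp add: add.commute)

text \<open>Both claims come from one everywhere convergent power series \<open>e\<close>; its
  continuity is what gives continuity of the infinite product in its argument, needed for the limit
  in \<open>appell_one\<close>.\<close>

lemma euler2_aux: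
  shows "(\<lambda>k. (-1) ^ k * qtri q (int k) * z ^ k / qpoch q q k) sums qpoch_inf z q"
    and "isCont (\<lambda>z. qpoch_inf z q) w"
proof -
  define c where "c = (\<lambda>k. (-1) ^ k * qtri q (int k) / qpoch q q k)"
  define e where "e = (\<lambda>z. \<Sum>k. c k * z ^ k)"
  have sm: "summable (\<lambda>k. c k * z ^ k)" for z
    using summable_norm_cancel[OF summable_euler2[of z]] by (simp add: c_def field_simps)
  have cont: "isCont e w" for w
    unfolding e_def by (rule isCont_powser_converges_everywhere) (rule sm)
  have rec: "e z = (1 - z) * e (z * q)" for z
  proof -
    have "e z - e (z * q) = (\<Sum>k. c k * z ^ k - c k * (z * q) ^ k)"
      unfolding e_def by (rule suminf_diff[OF sm sm])
    also have "\<dots> = (\<Sum>k. c (Suc k) * z ^ Suc k - c (Suc k) * (z * q) ^ Suc k)"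
      by (subst suminf_split_head) (use sm in \<open>auto intro: summable_diff\<close>)
    also have "\<dots> = (\<Sum>k. (- z) * (c k * (z * q) ^ k))"
    proof (rule suminf_cong)
      fix k
      have *: "1 - q * q ^ k \<noteq> 0" using qq_nonzero[of "Suc k"] by (auto simp: qpoch_Suc)
      have a: "c (Suc k) * (1 - q * q ^ k) = - (c k * q ^ k)"
        using * unfolding c_def qtri_int_Suc by (simp add: qpoch_Suc)
      have b: "c (Suc k) * z ^ Suc k - c (Suc k) * (z * q) ^ Suc k
          = (c (Suc k) * (1 - q * q ^ k)) * z ^ Suc k"
        by (simp add: power_mult_distrib algebra_simps)
      show "c (Suc k) * z ^ Suc k - c (Suc k) * (z * q) ^ Suc k = (- z) * (c k * (z * q) ^ k)"
        unfolding b a by (simp add: power_mult_distrib)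
    qed
    also have "\<dots> = (- z) * e (z * q)" unfolding e_def by (rule suminf_mult[OF sm])
    finally show ?thesis by (simp add: algebra_simps)
  qed
  have "(\<lambda>n. e (z * q ^ n)) \<longlonglongrightarrow> e 0" for z
    using q_tendsto cont isCont_tendsto_compose by blast
  moreover have "e 0 = 1" unfolding e_def by (subst powser_zero) (simp add: c_def)
  ultimately have lim: "(\<lambda>n. e (z * q ^ n)) \<longlonglongrightarrow> 1" for z by simp
  have eq: "e z = qpoch_inf z q" for z
    by (rule qpoch_inf_eqI[of e, OF _ lim]) (use rec[of "z * q ^ _"] in \<open>simp add: mult_ac\<close>)
  show "(\<lambda>k. (-1) ^ k * qtri q (int k) * z ^ k / qpoch q q k) sums qpoch_inf z q"
    using summable_sums[OF sm[of z]] by (simp add: eq[symmetric] e_def c_def)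
  show "isCont (\<lambda>z. qpoch_inf z q) w"
    using cont[of w] unfolding ext[of e, OF eq] .
qed

lemmas euler2 = euler2_aux(1)
lemmas isCont_qpoch_inf = euler2_aux(2)

section \<open>Series with Gaussian weights and partial fractions\<close>

lemma summable_qtri_int:
  assumes "x \<noteq> 0"
  shows "(\<lambda>n. norm (qtri q n * x powi n)) summable_on UNIV"
proof (rule has_sum_int_of_sums(2))
  show "summable (\<lambda>n. norm (qtri q (int n) * x powi int n))"
  proof (rule summable_ratio_tendsto_0[where r = "\<lambda>n. x * q ^ n" and l = 0])
    show "qtri q (int (Suc n)) * x powi int (Suc n) = x * q ^ n * (qtri q (int n) * x powi int n)" for n
      by (simp only: qtri_int_Suc) (simp add: power_int_add assms)
  qed (use q_tendsto in auto)
  show "summable (\<lambda>n. norm (qtri q (- int n - 1) * x powi (- int n - 1)))"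
  proof (rule summable_ratio_tendsto_0[where r = "\<lambda>n. q ^ 2 / x * q ^ n" and l = 0])
    fix n
    have "qtri q (- (int n + 2)) = qtri q (- (int n + 1)) * q ^ (n + 2)"
      using qtri_int_Suc[of "n + 2"] unfolding qtri_minus[OF q_nz] by (simp add: algebra_simps)
    moreover have "- (int n + 2) = - int (Suc n) - 1" "- (int n + 1) = - int n - 1" by simp_all
    ultimately have "qtri q (- int (Suc n) - 1) = qtri q (- int n - 1) * q ^ (n + 2)" by (simp only:)
    moreover have "x powi (- int (Suc n) - 1) = x powi (- int n - 1) / x"
      using power_int_diff[of x "- int n - 1" 1] assms by (simp add: algebra_simps)
    ultimately show "qtri q (- int (Suc n) - 1) * x powi (- int (Suc n) - 1)
        = q\<^sup>2 / x * q ^ n * (qtri q (- int n - 1) * x powi (- int n - 1))"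
      by (simp add: field_simps power_add power2_eq_square)
  qed (use q_tendsto[of "q\<^sup>2 / x"] in auto)
qed

lemma summable_qtri_weighted:
  assumes "x \<noteq> 0" "\<And>n. norm (c n) \<le> C"
  shows "(\<lambda>n. norm (qtri q n * x powi n * c n)) summable_on UNIV"
proof (rule Infinite_Sum.abs_summable_on_comparison_test')
  show "(\<lambda>n. norm (qtri q n * x powi n) * C) summable_on UNIV"
    by (rule summable_on_cmult_left[OF summable_qtri_int[OF assms(1)]])
  show "norm (qtri q n * x powi n * c n) \<le> norm (qtri q n * x powi n) * C" for n
    unfolding norm_mult[of _ "c n"] by (rule mult_left_mono[OF assms(2)]) simp
qed

lemma bounded_inverse_one_minus:
  assumes "\<And>j. z * q ^ j \<noteq> 1"
  shows "\<exists>C>0. \<forall>j. norm (1 / (1 - z * q ^ j)) \<le> C"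
proof (rule bounded_inverse_of_LIMSEQ)
  show "(\<lambda>j. 1 - z * q ^ j) \<longlonglongrightarrow> 1 - 0"
    by (intro tendsto_intros q_tendsto)
qed auto

lemma partial_fraction_summable:
  assumes "\<And>j. z * q ^ j \<noteq> 1"
  shows "summable (\<lambda>k. norm ((-1) ^ k * qtri q (int k) * q ^ k / qpoch q q k / (1 - z * q ^ k)))"
proof -
  obtain C where C: "\<And>j. norm (1 / (1 - z * q ^ j)) \<le> C"
    using bounded_inverse_one_minus[OF assms] by blast
  show ?thesis
  proof (rule summable_comparison_test')
    show "summable (\<lambda>k. norm ((-1) ^ k * qtri q (int k) * q ^ k / qpoch q q k) * C)"
      by (rule summable_mult2[OF summable_euler2])
    show "norm (norm ((-1) ^ k * qtri q (int k) * q ^ k / qpoch q q k / (1 - z * q ^ k)))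
        \<le> norm ((-1) ^ k * qtri q (int k) * q ^ k / qpoch q q k) * C" for k
      using mult_left_mono[OF C[of k], of "norm ((-1) ^ k * qtri q (int k) * q ^ k / qpoch q q k)"]
      by (simp add: norm_mult norm_divide)
  qed
qed

text \<open>The reciprocal product is expanded over its simple poles. As functions of
  \<open>z\<close> both sides satisfy \<open>p(z q) = (1 - z) p(z)\<close>, and along the orbit the
  series tends to Euler's series at \<open>q\<close>, that is, to
  \<open>qpoch_inf q q\<close>.\<close>

lemma partial_fraction:
  assumes "\<And>j. z * q ^ j \<noteq> 1"
  shows "(\<lambda>k. (-1) ^ k * qtri q (int k) * q ^ k / qpoch q q k / (1 - z * q ^ k))
      sums (qpoch_inf q q / qpoch_inf z q)"
proof -
  define c where "c = (\<lambda>k. (-1) ^ k * qtri q (int k) * q ^ k / qpoch q q k)"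
  define p where "p = (\<lambda>z. \<Sum>k. c k / (1 - z * q ^ k))"
  have nz: "z * q ^ n * q ^ j \<noteq> 1" for n j
    using assms[of "n + j"] by (simp add: power_add mult.assoc)
  have sm: "summable (\<lambda>k. norm (c k / (1 - z * q ^ n * q ^ k)))" for n
    using partial_fraction_summable[OF nz] by (simp add: c_def)
  have rec: "p (z * q ^ Suc n) = (1 - z * q ^ n) * p (z * q ^ n)" for n
  proof -
    define w where "w = z * q ^ n"
    have w: "w * q ^ j \<noteq> 1" for j using nz by (simp add: w_def)
    have sw: "summable (\<lambda>k. c k / (1 - w * q ^ k))"
      using summable_norm_cancel[OF sm[of n]] by (simp add: w_def)
    \<comment> \<open>At argument 1 the product contains the factor 0, so these coefficients sum to
      0. Subtracting \<open>(1 - w) p(w)\<close> from this null series leaves, after an index shift,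
      exactly \<open>- p(w q)\<close>.\<close>
    have e1: "(\<lambda>k. (-1) ^ k * qtri q (int k) * 1 ^ k / qpoch q q k) sums qpoch_inf 1 q"
      by (rule euler2)
    have "qpoch_inf 1 q = 0" using qpoch_inf_Suc[of 1] by simp
    with e1 have e1: "(\<lambda>k. (-1) ^ k * qtri q (int k) / qpoch q q k) sums 0" by simp
    have "(\<lambda>k. (-1) ^ k * qtri q (int k) / qpoch q q k - (1 - w) * (c k / (1 - w * q ^ k)))
        sums (0 - (1 - w) * p w)"
      unfolding p_def by (intro sums_diff e1 sums_mult summable_sums sw)
    moreover have "(-1) ^ k * qtri q (int k) / qpoch q q k - (1 - w) * (c k / (1 - w * q ^ k))
       = (if k = 0 then 0 else - c (k - 1) / (1 - w * q * q ^ (k - 1)))" for k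
    proof (cases k)
      case 0
      then show ?thesis using w[of 0] by (simp add: c_def)
    next
      case (Suc i)
      define T where "T = (-1) ^ i * qtri q (int i) * q ^ i / qpoch q q i"
      have *: "1 - q * q ^ i \<noteq> 0" using qq_nonzero[of "Suc i"] by (auto simp: qpoch_Suc)
      have **: "1 - w * q * q ^ i \<noteq> 0" using w[of "Suc i"] by (simp add: mult.assoc)
      have a1: "(-1) ^ k * qtri q (int k) / qpoch q q k = - T / (1 - q * q ^ i)"
        unfolding Suc qtri_int_Suc T_def by (simp add: qpoch_Suc)
      have a2: "c k = - T * q * q ^ i / (1 - q * q ^ i)"
        unfolding Suc c_def qtri_int_Suc T_def by (simp add: qpoch_Suc)
      have a3: "c i = T" by (simp add: c_def T_def)
      have "- T / (1 - q * q ^ i) - (1 - w) * (- T * q * q ^ i / (1 - q * q ^ i) / (1 - w * q * q ^ i))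
          = - T / (1 - w * q * q ^ i)"
        using * ** by (simp add: divide_simps) (simp add: algebra_simps)
      moreover have "w * q ^ k = w * q * q ^ i" by (simp add: Suc)
      ultimately show ?thesis unfolding a1 a2 using a3 by (simp add: Suc mult.assoc)
    qed
    ultimately have "(\<lambda>k. if k = 0 then 0 else - c (k - 1) / (1 - w * q * q ^ (k - 1))) sums (0 - (1 - w) * p w)"
      by simp
    then have "(\<lambda>k. - c k / (1 - w * q * q ^ k)) sums (0 - (1 - w) * p w)"
      using sums_Suc_iff[of "\<lambda>k. if k = 0 then 0 else - c (k - 1) / (1 - w * q * q ^ (k - 1))" "0 - (1 - w) * p w"]
      by simp
    then have "(\<lambda>k. - (- c k / (1 - w * q * q ^ k))) sums - (0 - (1 - w) * p w)"
      by (rule sums_minus)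
    then show ?thesis using sums_unique[of "\<lambda>k. c k / (1 - w * q * q ^ k)"]
      by (simp add: p_def w_def mult_ac)
  qed
  obtain C where C: "\<And>j. norm (1 / (1 - z * q ^ j)) \<le> C"
    using bounded_inverse_one_minus[OF assms] by blast
  have "(\<lambda>n. \<Sum>k. c k / (1 - z * q ^ n * q ^ k)) \<longlonglongrightarrow> (\<Sum>k. c k)"
  proof (rule tannery_sequence)
    show "(\<lambda>n. c k / (1 - z * q ^ n * q ^ k)) \<longlonglongrightarrow> c k" for k
      using tendsto_divide[OF tendsto_const[of "c k"] tendsto_diff[OF tendsto_const[of 1] tendsto_mult[OF q_tendsto[of z] tendsto_const[of "q ^ k"]]]]
      by simp
    show "norm (c k / (1 - z * q ^ n * q ^ k)) \<le> norm (c k) * C" for k n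
      using mult_left_mono[OF C[of "n + k"], of "norm (c k)"]
      by (simp add: norm_mult norm_divide power_add mult.assoc)
    show "summable (\<lambda>k. norm (c k) * C)"
      unfolding c_def by (rule summable_mult2[OF summable_euler2])
  qed
  moreover have "(\<Sum>k. c k) = qpoch_inf q q"
    unfolding c_def using sums_unique[OF euler2[of q]] by simp
  ultimately have "p z * qpoch_inf z q = qpoch_inf q q"
    by (intro inverse_qpoch_inf_eqI rec) (simp add: p_def)
  moreover have "qpoch_inf z q \<noteq> 0"
    using assms by (auto simp: qpoch_inf_eq_0_iff)
  ultimately have "p z = qpoch_inf q q / qpoch_inf z q"
    by (simp add: field_simps)
  then show ?thesis
    using summable_sums[OF summable_norm_cancel[OF sm[of 0]]] by (simp add: p_def c_def)
qed

lemma bounded_inverse_qpoch: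
  assumes "\<And>j. z * q ^ j \<noteq> 1"
  shows "\<exists>C>0. \<forall>n. norm (1 / qpoch z q n) \<le> C"
  by (rule bounded_inverse_of_LIMSEQ[OF qpoch_LIMSEQ]) (use assms in \<open>auto simp: qpoch_inf_eq_0_iff\<close>)

lemma bounded_qpoch: "\<exists>C>0. \<forall>n. norm (qpoch z q n) \<le> C"
  using convergent_imp_Bseq[OF convergentI[OF qpoch_LIMSEQ[of z]]] unfolding Bseq_def by blast

lemma summable_square_powers: "summable (\<lambda>N. norm (q ^ (N * N) * z ^ N))"
proof (rule summable_ratio_tendsto_0[where r = "\<lambda>N. z * q * (1 * q ^ N) * (1 * q ^ N)" and l = "z * q * 0 * 0"])
  show "(\<lambda>N. z * q * (1 * q ^ N) * (1 * q ^ N)) \<longlonglongrightarrow> z * q * 0 * 0"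
    by (intro tendsto_intros q_tendsto)
qed (auto simp: power_add mult_ac)

text \<open>The functional equation \<open>(1 - z q) c(z) = c(z q)\<close> of the left-hand side holds
  because the difference telescopes; \<open>W\<close> is the certificate found by \<open>q\<close>-Gosper summation.\<close>
lemma durfee:
  assumes "\<And>j. z * q ^ Suc j \<noteq> 1"
  shows "(\<lambda>N. q ^ (N * N) * z ^ N / (qpoch q q N * qpoch (z * q) q N)) sums (1 / qpoch_inf (z * q) q)"
proof -
  define t where "t = (\<lambda>z N. q ^ (N * N) * z ^ N / (qpoch q q N * qpoch (z * q) q N))"
  define f where "f = (\<lambda>z. \<Sum>N. t (z / q) N)"
  have nz: "z * q ^ n * q * q ^ j \<noteq> 1" for n j
    using assms[of "n + j"] by (simp add: power_add mult_ac)
  obtain A where A: "A > 0" "\<And>N. norm (1 / qpoch q q N) \<le> A" using bounded_inverse_qq by blast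
  obtain B where B: "B > 0" "\<And>N. norm (1 / qpoch (z * q) q N) \<le> B"
    using bounded_inverse_qpoch[of "z * q"] nz[of 0] by auto
  obtain D where D: "D > 0" "\<And>N. norm (qpoch (z * q) q N) \<le> D" using bounded_qpoch by blast
  \<comment> \<open>Uniform in \<open>n\<close> and \<open>N\<close>: the reciprocal is the quotient
    of \<open>qpoch (z * q) q n\<close> by \<open>qpoch (z * q) q (n + N)\<close>, and both the
    products and their reciprocals are bounded along convergent sequences with nonzero
    limit.\<close>
  have inv: "norm (1 / qpoch (z * q ^ n * q) q N) \<le> B * D" for n N
  proof -
    have "qpoch (z * q) q n \<noteq> 0" using nz[of 0] by (auto simp: qpoch_eq_0_iff)
    then have "1 / qpoch (z * q ^ n * q) q N = (1 / qpoch (z * q) q (n + N)) * qpoch (z * q) q n"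
      by (simp add: qpoch_add mult_ac)
    then show ?thesis
      by (simp only: norm_mult) (intro mult_mono B D, use B D in auto)
  qed
  have bound: "norm (t (z * q ^ n) N) \<le> norm (q ^ (N * N) * z ^ N) * (A * (B * D))" for n N
  proof -
    have "t (z * q ^ n) N = (q ^ (N * N) * z ^ N * (q ^ n) ^ N) * ((1 / qpoch q q N) * (1 / qpoch (z * q ^ n * q) q N))"
      by (simp add: t_def power_mult_distrib)
    moreover have "norm (q ^ (N * N) * z ^ N * (q ^ n) ^ N) \<le> norm (q ^ (N * N) * z ^ N)"
    proof -
      have "norm ((q ^ n) ^ N) \<le> 1" using q_lt by (simp add: norm_power power_le_one)
      then show ?thesis unfolding norm_mult[of _ "(q ^ n) ^ N"] by (rule mult_left_le) simp
    qed
    ultimately show ?thesis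
      by (simp only: norm_mult[of "q ^ (N * N) * z ^ N * (q ^ n) ^ N"] norm_mult[of "1 / qpoch q q N"])
        (intro mult_mono A inv, use A in auto)
  qed
  have sb: "summable (\<lambda>N. norm (q ^ (N * N) * z ^ N) * (A * (B * D)))"
    by (rule summable_mult2[OF summable_square_powers])
  have sm: "summable (t (z * q ^ n))" for n
    by (rule summable_comparison_test'[OF sb]) (use bound in auto)
  have rec: "f (z * q * q ^ Suc n) = (1 - z * q * q ^ n) * f (z * q * q ^ n)" for n
  proof -
    define w where "w = z * q ^ n"
    have w: "w * q * q ^ j \<noteq> 1" for j using nz[of n j] by (simp add: w_def)
    define W where "W = (\<lambda>N. - ((1 - w * q) * t w N) * (1 - q ^ N))"
    have "t w \<longlonglongrightarrow> 0"
      using summable_LIMSEQ_zero[OF sm[of n]] by (simp add: w_def)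
    then have "(\<lambda>N. - ((1 - w * q) * t w N) * (1 - 1 * q ^ N)) \<longlonglongrightarrow> - ((1 - w * q) * 0) * (1 - 0)"
      by (intro tendsto_intros q_tendsto)
    then have "W \<longlonglongrightarrow> 0" by (simp add: W_def)
    then have "(\<lambda>N. W (Suc N) - W N) sums (0 - W 0)" by (rule telescope_sums)
    moreover have "W (Suc N) - W N = (1 - w * q) * t w N - t (w * q) N" for N
    proof -
      define R where "R = q ^ (N * N) * w ^ N"
      define S where "S = qpoch q q N * qpoch (w * q * q) q N"
      define Q where "Q = q ^ N"
      have n1: "1 - q * Q \<noteq> 0" using qq_nonzero[of "Suc N"] by (auto simp: qpoch_Suc Q_def)
      have "w * q * q * q ^ j \<noteq> 1" for j using w[of "Suc j"] by (simp add: mult_ac)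
      then have n3: "S \<noteq> 0" unfolding S_def by (simp add: qpoch_eq_0_iff[of "w * q * q"])
      have n4: "qpoch (w * q) q N \<noteq> 0" using w by (auto simp: qpoch_eq_0_iff)
      have t1: "t (w * q) N = R * Q / S"
        by (simp add: t_def R_def S_def Q_def power_mult_distrib)
      have "(1 - w * q) * qpoch (w * q * q) q N = qpoch (w * q) q N * (1 - w * q * Q)"
        using qpoch_Suc_shift[of "w * q" q N] qpoch_Suc[of "w * q" q N] by (simp add: Q_def)
      then have "(1 - w * q) / qpoch (w * q) q N = (1 - w * q * Q) / qpoch (w * q * q) q N"
        using n4 n3 by (simp add: S_def field_simps)
      moreover have "(1 - w * q) * t w N = R / qpoch q q N * ((1 - w * q) / qpoch (w * q) q N)"
        by (simp add: t_def R_def field_simps)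
      ultimately have t3: "(1 - w * q) * t w N = R * (1 - w * q * Q) / S"
        by (simp add: S_def)
      have "1 - w * q \<noteq> 0" using w[of 0] by simp
      then have t2: "(1 - w * q) * t w (Suc N) = R * Q * Q * q * w / (S * (1 - q * Q))"
        unfolding t_def qpoch_Suc_shift[of "w * q"] R_def S_def Q_def by (simp add: qpoch_Suc power_add mult_ac)
      show ?thesis
        unfolding W_def t3 t2 t1 using n1 n3 by (simp add: Q_def[symmetric] divide_simps) (simp add: algebra_simps)
    qed
    moreover have "W 0 = 0" by (simp add: W_def)
    ultimately have "(\<lambda>N. (1 - w * q) * t w N - t (w * q) N) sums 0" by simp
    moreover have "(\<lambda>N. (1 - w * q) * t w N - t (w * q) N) sums ((1 - w * q) * suminf (t w) - suminf (t (w * q)))"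
      using sm[of n] sm[of "Suc n"]
      by (intro sums_diff sums_mult summable_sums) (simp_all add: w_def mult_ac)
    ultimately have "(1 - w * q) * suminf (t w) - suminf (t (w * q)) = 0" by (rule sums_unique2[symmetric])
    then show ?thesis by (simp add: f_def w_def mult_ac)
  qed
  \<comment> \<open>As the argument runs to 0 only the term \<open>N = 0\<close> survives, which
    gives the normalisation 1 needed to identify the solution of the functional equation.\<close>
  have "(\<lambda>n. \<Sum>N. t (z * q ^ n) N) \<longlonglongrightarrow> (\<Sum>N. if N = 0 then 1 else 0)"
  proof (rule tannery_sequence[OF _ bound sb])
    fix N
    show "(\<lambda>n. t (z * q ^ n) N) \<longlonglongrightarrow> (if N = 0 then 1 else 0)"
    proof (cases "N = 0")
      case False
      have "(\<lambda>n. norm (q ^ (N * N) * (z * q ^ n) ^ N) * (A * (B * D))) \<longlonglongrightarrow> norm (q ^ (N * N) * 0 ^ N) * (A * (B * D))"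
        by (intro tendsto_intros q_tendsto)
      moreover have "norm (q ^ (N * N) * 0 ^ N) * (A * (B * D)) = 0" using False by simp
      ultimately have lim: "(\<lambda>n. norm (q ^ (N * N) * (z * q ^ n) ^ N) * (A * (B * D))) \<longlonglongrightarrow> 0"
        by (simp only:)
      have "norm (t (z * q ^ n) N) \<le> norm (q ^ (N * N) * (z * q ^ n) ^ N) * (A * (B * D))" for n
      proof -
        have "t (z * q ^ n) N = (q ^ (N * N) * (z * q ^ n) ^ N) * ((1 / qpoch q q N) * (1 / qpoch (z * q ^ n * q) q N))"
          by (simp add: t_def)
        then show ?thesis
          by (simp only: norm_mult[of "q ^ (N * N) * (z * q ^ n) ^ N"] norm_mult[of "1 / qpoch q q N"])
            (intro mult_mono A inv, use A in auto)
      qed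
      then have "(\<lambda>n. t (z * q ^ n) N) \<longlonglongrightarrow> 0"
        by (intro Lim_null_comparison[OF always_eventually lim]) blast
      then show ?thesis using False by simp
    qed (simp add: t_def)
  qed
  moreover have "(\<Sum>N::nat. if N = 0 then 1 else (0::complex)) = 1"
    using suminf_finite[of "{0::nat}" "\<lambda>N. if N = 0 then 1 else (0::complex)"] by simp
  ultimately have "(\<lambda>n. f (z * q * q ^ n)) \<longlonglongrightarrow> 1" by (simp add: f_def mult_ac)
  then have "f (z * q) * qpoch_inf (z * q) q = 1"
    by (intro inverse_qpoch_inf_eqI rec)
  then have "suminf (t z) = 1 / qpoch_inf (z * q) q"
    by (cases "qpoch_inf (z * q) q = 0") (simp_all add: f_def field_simps)
  then show ?thesis using summable_sums[OF sm[of 0]] by (simp add: t_def)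
qed

subsection \<open>The triple product and the bilateral series\<close>

lemma qpoch_inf_nat_neg_shift: "qpoch_inf (x * q powi (n - int k)) q = qpoch (x * q powi (n - int k)) q k * qpoch_inf (x * q powi n) q"
  using qpoch_inf_split[of "x * q powi (n - int k)" k] by (simp add: power_int_diff)

lemma qpoch_inf_int_Suc: "qpoch_inf (x * q powi n) q = (1 - x * q powi n) * qpoch_inf (x * q powi (n + 1)) q"
  using qpoch_inf_Suc[of "x * q powi n"] by (simp add: power_int_add mult_ac)

text \<open>Each factor is turned around by \<open>1 - z q^(-j) = - z q^(-j) (1 - q^j / z)\<close>;
  the powers of \<open>q\<close> collect into \<open>q^(k(k+1)/2)\<close>, which is
  \<open>qtri q (int k + 1)\<close>.\<close>

lemma qpoch_reverse:
  assumes "z \<noteq> 0"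
  shows "qpoch (z * q powi (- int k)) q k * qtri q (int k + 1) = (- z) ^ k * qpoch (q / z) q k"
proof (induction k)
  case (Suc k)
  have "qpoch (z * q powi (- int (Suc k))) q (Suc k)
      = (1 - z * q powi (- int (Suc k))) * qpoch (z * q powi (- int k)) q k"
  proof -
    have "z * q powi (- int (Suc k)) * q = z * q powi (- int k)"
      using power_int_add[of q "- int (Suc k)" 1] by simp
    then show ?thesis by (simp only: qpoch_Suc_shift)
  qed
  moreover have "qtri q (int (Suc k) + 1) = qtri q (int k + 1) * q ^ Suc k"
    using qtri_int_Suc[of "Suc k"] by (simp add: add.commute)
  ultimately have "qpoch (z * q powi (- int (Suc k))) q (Suc k) * qtri q (int (Suc k) + 1)
     = ((1 - z * q powi (- int (Suc k))) * q ^ Suc k) * ((- z) ^ k * qpoch (q / z) q k)"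
    unfolding Suc.IH[symmetric] by (simp only: mult_ac)
  also have "(1 - z * q powi (- int (Suc k))) * q ^ Suc k = - z * (1 - q / z * q ^ k)"
  proof -
    have e: "q powi (- int (Suc k)) * q ^ Suc k = 1"
      by (simp only: power_int_minus power_int_of_nat) (rule left_inverse, simp)
    have "(1 - z * q powi (- int (Suc k))) * q ^ Suc k = q ^ Suc k - z * (q powi (- int (Suc k)) * q ^ Suc k)"
      by (simp only: left_diff_distrib mult_1_left mult.assoc)
    then show ?thesis unfolding e using assms by (simp add: field_simps)
  qed
  finally show ?case by (simp add: qpoch_Suc mult_ac)
qed simp

lemma jtheta_shift:
  assumes "x \<noteq> 0"
  shows "jtheta (x * q) q = - jtheta x q / x"
proof -
  have "jtheta (x * q) q = qpoch_inf (x * q) q * ((1 - 1 / x) * qpoch_inf (q / x) q) * qpoch_inf q q"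
    using qpoch_inf_Suc[of "1 / x"] by (simp add: jtheta_def)
  moreover have "jtheta x q = (1 - x) * qpoch_inf (x * q) q * qpoch_inf (q / x) q * qpoch_inf q q"
    using qpoch_inf_Suc[of x] by (simp add: jtheta_def)
  ultimately show ?thesis using assms by (simp only:) (simp add: field_simps)
qed

lemma jtheta_shift_int:
  assumes "x \<noteq> 0"
  shows "jtheta (x * q powi n) q * (qtri q n * (- x) powi n) = jtheta x q"
proof (induction n rule: int_induct[where k = 0])
  case (step1 n)
  have u: "x * q powi n \<noteq> 0" using assms by simp
  have "jtheta (x * q powi (n + 1)) q = - jtheta (x * q powi n) q / (x * q powi n)"
    using jtheta_shift[OF u] by (simp add: power_int_add mult_ac)
  moreover have "qtri q (n + 1) * (- x) powi (n + 1) = (qtri q n * (- x) powi n) * (- (x * q powi n))"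
    using assms by (simp add: qtri_Suc power_int_add)
  moreover have "(- J / u) * (W * (- u)) = J * W" if "u \<noteq> 0" for J W u :: complex
    using that by simp
  ultimately show ?case using step1(2) u by metis
next
  case (step2 n)
  have u: "x * q powi (n - 1) \<noteq> 0" using assms by simp
  have "jtheta (x * q powi n) q = - jtheta (x * q powi (n - 1)) q / (x * q powi (n - 1))"
    using jtheta_shift[OF u] by (simp add: power_int_diff mult_ac)
  moreover have "qtri q n * (- x) powi n = (qtri q (n - 1) * (- x) powi (n - 1)) * (- (x * q powi (n - 1)))"
    using assms qtri_Suc[OF q_nz, of "n - 1"] by (simp add: power_int_diff)
  moreover have "(- J / u) * (W * (- u)) = J * W" if "u \<noteq> 0" for J W u :: complex
    using that by simp
  ultimately show ?case using step2(2) u by metis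
qed simp

text \<open>Andrews' proof: in the series of \<open>(-1)^k q^(k(k-1)/2) x^k (q^(k+1); q)\<close> over all integers
  \<open>k\<close>, whose terms vanish for \<open>k < 0\<close>, expand the infinite products by Euler's identity and sum over
  \<open>k + i\<close> first.\<close>
lemma triple_product_aux:
  assumes "x \<noteq> 0" "norm (q / x) < 1"
  shows "((\<lambda>n. qtri q n * (- x) powi n) has_sum jtheta x q) UNIV"
proof -
  define \<theta> where "\<theta> = (\<Sum>\<^sub>\<infinity>n. qtri q n * (- x) powi n)"
  define f where "f = (\<lambda>(N::int, i::nat). (qtri q N * (- x) powi N) * ((q / x) ^ i / qpoch q q i))"
  have s1: "(\<lambda>n. norm (qtri q n * (- x) powi n)) summable_on UNIV"
    using assms by (intro summable_qtri_int) auto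
  have t1: "((\<lambda>n. qtri q n * (- x) powi n) has_sum \<theta>) UNIV"
    unfolding \<theta>_def using abs_summable_summable[OF s1] by simp
  have "((\<lambda>i. (q / x) ^ i / qpoch q q i) has_sum (1 / qpoch_inf (q / x) q)) UNIV"
    by (rule norm_summable_imp_has_sum[OF summable_euler1[OF assms(2)] euler1[OF assms(2)]])
  then have "(f has_sum (\<theta> * (1 / qpoch_inf (q / x) q))) (UNIV \<times> UNIV)"
    unfolding f_def
    by (intro has_sum_times t1 s1 norm_summable_imp_summable_on) (use summable_euler1[OF assms(2)] in simp_all)
  then have fs: "((\<lambda>(k, i). f (k + int i, i)) has_sum (\<theta> * (1 / qpoch_inf (q / x) q))) (UNIV \<times> UNIV)"
    by (simp only: has_sum_shear)
  define g where "g = (\<lambda>k. qtri q k * (- x) powi k * qpoch_inf (q powi (k + 1)) q)"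
  have g1: "(g has_sum (\<theta> * (1 / qpoch_inf (q / x) q))) UNIV"
  proof (rule has_sum_SigmaD[OF fs])
    fix k :: int
    have "((\<lambda>i. (-1) ^ i * qtri q (int i) * (q powi (k + 1)) ^ i / qpoch q q i) has_sum qpoch_inf (q powi (k + 1)) q) UNIV"
      by (rule norm_summable_imp_has_sum[OF summable_euler2 euler2])
    then have "((\<lambda>i. (qtri q k * (- x) powi k) * ((-1) ^ i * qtri q (int i) * (q powi (k + 1)) ^ i / qpoch q q i)) has_sum g k) UNIV"
      unfolding g_def by (rule has_sum_cmult_right)
    moreover have "(qtri q k * (- x) powi k) * ((-1) ^ i * qtri q (int i) * (q powi (k + 1)) ^ i / qpoch q q i)
       = f (k + int i, i)" for i
    proof -
      have "(- x) powi (k + int i) * (q / x) ^ i = (- x) powi k * ((-1) ^ i * q ^ i)"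
        using assms by (simp add: power_int_add power_divide power_minus[of x])
      moreover have "(q powi (k + 1)) ^ i = q powi (k * int i) * q ^ i"
        by (simp add: power_int_add power_mult_distrib power_int_mult)
      ultimately show ?thesis
        by (simp add: f_def qtri_add mult_ac)
    qed
    ultimately show "((\<lambda>i. case (k, i) of (k, i) \<Rightarrow> f (k + int i, i)) has_sum g k) UNIV" by simp
  qed
  have b1: "bij_betw int UNIV {0..}"
    by (rule bij_betwI[of _ _ _ nat]) auto
  have "((\<lambda>k. qpoch_inf q q * ((-1) ^ k * qtri q (int k) * x ^ k / qpoch q q k)) has_sum (qpoch_inf q q * qpoch_inf x q)) UNIV"
    by (intro has_sum_cmult_right norm_summable_imp_has_sum[OF summable_euler2 euler2])
  moreover have "qpoch_inf q q * ((-1) ^ k * qtri q (int k) * x ^ k / qpoch q q k) = g (int k)" for k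
  proof -
    have "qpoch_inf q q / qpoch q q k = qpoch_inf (q powi (int k + 1)) q"
      using qpoch_inf_split[of q k] by (simp add: power_int_add mult_ac)
    moreover have "(- x) powi int k = (- 1) ^ k * x ^ k"
      by (simp add: power_minus[of x])
    ultimately show ?thesis by (simp add: g_def field_simps)
  qed
  ultimately have "(g has_sum (qpoch_inf q q * qpoch_inf x q)) {0..}"
    by (simp add: has_sum_reindex_bij_betw[OF b1])
  moreover have "g k = 0" if "k < 0" for k
  proof -
    have "q powi (k + 1) * q ^ nat (- k - 1) = 1"
      using that power_int_add[of q "k + 1" "- k - 1"] by (simp add: power_int_def)
    then have "qpoch_inf (q powi (k + 1)) q = 0" by (auto simp: qpoch_inf_eq_0_iff)
    then show ?thesis by (simp add: g_def)
  qed
  then have "(g has_sum v) {0..} \<longleftrightarrow> (g has_sum v) UNIV" for v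
    by (intro has_sum_cong_neutral) auto
  ultimately have "(g has_sum (qpoch_inf q q * qpoch_inf x q)) UNIV" by blast
  with g1 have "\<theta> * (1 / qpoch_inf (q / x) q) = qpoch_inf q q * qpoch_inf x q"
    by (rule has_sum_unique)
  moreover have "qpoch_inf (q / x) q \<noteq> 0"
  proof -
    have "q / x * q ^ j \<noteq> 1" for j
      using norm_mult_power_less[OF assms(2), of j] by (metis norm_one less_irrefl)
    then show ?thesis by (auto simp: qpoch_inf_eq_0_iff)
  qed
  ultimately have "\<theta> = jtheta x q" by (simp add: jtheta_def field_simps)
  with t1 show ?thesis by simp
qed

text \<open>The restriction on \<open>q / x\<close> stems from the disc of convergence of Euler's
  reciprocal expansion. Both sides obey the same rule under \<open>x \<mapsto> x q\<close>, so the
  identity is carried from \<open>x / q^N\<close>, where the restriction holds, back to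
  \<open>x\<close>.\<close>

lemma triple_product:
  assumes "x \<noteq> 0"
  shows "((\<lambda>n. qtri q n * (- x) powi n) has_sum jtheta x q) UNIV"
proof -
  have step: "((\<lambda>n. qtri q n * (- (y * q)) powi n) has_sum jtheta (y * q) q) UNIV"
    if "y \<noteq> 0" and y: "((\<lambda>n. qtri q n * (- y) powi n) has_sum jtheta y q) UNIV" for y
  proof -
    have b: "bij_betw (\<lambda>n::int. n + 1) UNIV UNIV"
      by (rule bij_betwI[of _ _ _ "\<lambda>n. n - 1"]) auto
    have "((\<lambda>n. qtri q (n + 1) * (- y) powi (n + 1)) has_sum jtheta y q) UNIV"
      by (rule iffD2[OF has_sum_reindex_bij_betw[OF b, of "\<lambda>n. qtri q n * (- y) powi n"] y])
    then have "((\<lambda>n. (- 1 / y) * (qtri q (n + 1) * (- y) powi (n + 1))) has_sum (- 1 / y) * jtheta y q) UNIV"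
      by (rule has_sum_cmult_right)
    moreover have "(- 1 / y) * (qtri q (n + 1) * (- y) powi (n + 1)) = qtri q n * (- (y * q)) powi n" for n
      using that power_int_mult_distrib[of "- y" q n] by (simp add: qtri_Suc power_int_add mult_ac)
    ultimately show ?thesis using that by (simp add: jtheta_shift)
  qed
  have "(\<lambda>n. norm (q / x * q ^ n)) \<longlonglongrightarrow> 0"
    by (rule tendsto_norm_zero[OF q_tendsto])
  then have "eventually (\<lambda>n. norm (q / x * q ^ n) < 1) sequentially"
    by (rule order_tendstoD) simp
  then obtain N where N: "norm (q / x * q ^ N) < 1" by (auto simp: eventually_sequentially)
  define y where "y = x / q ^ N"
  have y: "y \<noteq> 0" using assms by (simp add: y_def)
  have "((\<lambda>n. qtri q n * (- (y * q ^ m)) powi n) has_sum jtheta (y * q ^ m) q) UNIV" for m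
  proof (induction m)
    case 0
    show ?case using N y triple_product_aux[of y] by (simp add: y_def)
  next
    case (Suc m)
    show ?case using step[OF _ Suc] y by (simp add: mult_ac)
  qed
  from this[of N] show ?thesis by (simp add: y_def)
qed

text \<open>The complement of the zeros of the theta function. Integer exponents, rather than
  natural ones, make the condition stable under \<open>x \<mapsto> 1 / x\<close> and
  \<open>x \<mapsto> q / x\<close>.\<close>

definition off_lattice :: "complex \<Rightarrow> bool" where
  "off_lattice x \<longleftrightarrow> x \<noteq> 0 \<and> (\<forall>n::int. x * q powi n \<noteq> 1)"

lemma off_lattice_nz: "off_lattice x \<Longrightarrow> x \<noteq> 0"
  and off_lattice_powi: "off_lattice x \<Longrightarrow> x * q powi n \<noteq> 1"
  by (auto simp: off_lattice_def)

lemma off_lattice_pow: "off_lattice x \<Longrightarrow> x * q ^ n \<noteq> 1"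
  using off_lattice_powi[of x "int n"] by simp

lemma off_lattice_shift: "off_lattice x \<Longrightarrow> off_lattice (x * q powi n)"
  by (auto simp: off_lattice_def mult.assoc simp flip: power_int_add)

lemma off_lattice_inverse: "off_lattice x \<Longrightarrow> off_lattice (1 / x)"
proof -
  assume x: "off_lattice x"
  have "1 / x * q powi n \<noteq> 1" for n
    using off_lattice_powi[OF x, of "- n"] off_lattice_nz[OF x] by (auto simp: power_int_minus field_simps)
  then show ?thesis using off_lattice_nz[OF x] by (simp add: off_lattice_def)
qed

lemma qpoch_inf_nonzero: "off_lattice x \<Longrightarrow> qpoch_inf x q \<noteq> 0"
  using off_lattice_pow by (auto simp: qpoch_inf_eq_0_iff)

lemma qpoch_nonzero: "off_lattice x \<Longrightarrow> qpoch x q n \<noteq> 0"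
  using off_lattice_pow by (auto simp: qpoch_eq_0_iff)

lemma off_lattice_q_div: "off_lattice x \<Longrightarrow> off_lattice (q / x)"
  using off_lattice_shift[OF off_lattice_inverse, of x 1] by simp

lemma jtheta_nonzero: "off_lattice x \<Longrightarrow> jtheta x q \<noteq> 0"
  using qpoch_inf_nonzero qpoch_inf_nonzero[OF off_lattice_q_div] by (simp add: jtheta_def)

text \<open>Negative exponents are reduced to positive ones by
  \<open>1 / (1 - x q^(-m)) = - (q^m / x) / (1 - q^m / x)\<close>.\<close>

lemma bounded_inverse_one_minus_int:
  assumes "off_lattice x"
  shows "\<exists>C>0. \<forall>n::int. norm (1 / (1 - x * q powi n)) \<le> C"
proof -
  obtain C where C: "C > 0" "\<And>j. norm (1 / (1 - x * q ^ j)) \<le> C"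
    using bounded_inverse_one_minus[of x] off_lattice_pow[OF assms] by blast
  obtain D where D: "D > 0" "\<And>j. norm (1 / (1 - 1 / x * q ^ j)) \<le> D"
    using bounded_inverse_one_minus[of "1 / x"] off_lattice_pow[OF off_lattice_inverse[OF assms]] by blast
  have "norm (1 / (1 - x * q powi n)) \<le> C + norm (1 / x) * D" for n
  proof (cases "n \<ge> 0")
    case True
    then have "norm (1 / (1 - x * q powi n)) \<le> C"
      using C(2)[of "nat n"] by (simp add: power_int_def)
    moreover have "0 \<le> norm (1 / x) * D" using D(1) by simp
    ultimately show ?thesis by linarith
  next
    case False
    define m where "m = nat (- n)"
    have n: "n = - int m" using False by (simp add: m_def)
    have nz: "1 - 1 / x * q ^ m \<noteq> 0"
      using off_lattice_pow[OF off_lattice_inverse[OF assms], of m] by (metis eq_iff_diff_eq_0)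
    have "1 / (1 - x * q powi n) = - (1 / x) * q ^ m * (1 / (1 - 1 / x * q ^ m))"
      using nz off_lattice_nz[OF assms] off_lattice_powi[OF assms, of n]
      unfolding n by (simp add: power_int_minus divide_simps) (simp add: algebra_simps)
    also have "norm \<dots> \<le> norm (1 / x) * 1 * D"
      unfolding norm_mult norm_minus_cancel
      by (intro mult_mono D) (use q_lt D in \<open>auto simp: norm_power power_le_one\<close>)
    finally show ?thesis using C by simp
  qed
  then show ?thesis using C(1) D(1)
    by (intro exI[of _ "C + norm (1 / x) * D"]) (auto intro: add_pos_nonneg)
qed

section \<open>The bilateral series as an Appell sum\<close>

definition bilateral :: "complex \<Rightarrow> complex \<Rightarrow> complex" where
  "bilateral x y = (\<Sum>\<^sub>\<infinity>n::int. q powi n / (qpoch_inf (x * q powi n) q * qpoch_inf (y * q powi n) q))"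

text \<open>An Appell-Lerch sum with terms \<open>(-1)^n q^(n(n+1)/2) y^n / (1 - x q^n)\<close>: the
  factor \<open>q\<close> next to \<open>y\<close> raises the exponent of \<open>qtri\<close> from
  \<open>n(n-1)/2\<close>. With this normalisation the quotient by \<open>jtheta y q\<close> is the
  bilateral series without any prefactor.\<close>

definition appell :: "complex \<Rightarrow> complex \<Rightarrow> complex" where
  "appell x y = (\<Sum>\<^sub>\<infinity>n::int. qtri q n * (- (y * q)) powi n * (1 / (1 - x * q powi n)))"

lemma appell_summable:
  assumes "off_lattice x" "y \<noteq> 0"
  shows "(\<lambda>n. norm (qtri q n * (- (y * q)) powi n * (1 / (1 - x * q powi n)))) summable_on UNIV"
proof -
  obtain C where "\<And>n::int. norm (1 / (1 - x * q powi n)) \<le> C"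
    using bounded_inverse_one_minus_int[OF assms(1)] by blast
  then show ?thesis using assms(2) by (intro summable_qtri_weighted) auto
qed

lemma appell_has_sum:
  assumes "off_lattice x" "y \<noteq> 0"
  shows "((\<lambda>n. qtri q n * (- (y * q)) powi n * (1 / (1 - x * q powi n))) has_sum appell x y) UNIV"
  unfolding appell_def using abs_summable_summable[OF appell_summable[OF assms]] by simp

text \<open>To the right the ratio tends to \<open>q\<close>; to the left the products in the
  denominator grow faster than any geometric sequence and the ratio tends to 0.\<close>

lemma half_bilateral_summable:
  assumes y: "off_lattice y"
  shows "(\<lambda>n. norm (q powi n / qpoch_inf (y * q powi n) q)) summable_on UNIV"
proof (rule has_sum_int_of_sums(2))
  show "summable (\<lambda>n. norm (q powi int n / qpoch_inf (y * q powi int n) q))"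
  proof (rule summable_ratio_tendsto_0[where r = "\<lambda>n. q * (1 - y * q ^ n)" and l = "q * (1 - 0)"])
    fix n
    show "q powi int (Suc n) / qpoch_inf (y * q powi int (Suc n)) q
       = q * (1 - y * q ^ n) * (q powi int n / qpoch_inf (y * q powi int n) q)"
    proof -
      have e: "qpoch_inf (y * q powi int n) q = (1 - y * q ^ n) * qpoch_inf (y * q powi int (Suc n)) q"
        using qpoch_inf_int_Suc[of y "int n"] by (simp add: add.commute)
      have "1 - y * q ^ n \<noteq> 0" using off_lattice_pow[OF y, of n] by simp
      then show ?thesis unfolding e by (simp add: power_int_add)
    qed
    show "(\<lambda>n. q * (1 - y * q ^ n)) \<longlonglongrightarrow> q * (1 - 0)"
      by (intro tendsto_intros q_tendsto)
  qed (use q_lt in auto)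
  show "summable (\<lambda>n. norm (q powi (- int n - 1) / qpoch_inf (y * q powi (- int n - 1)) q))"
  proof (rule summable_ratio_tendsto_0[where r = "\<lambda>n. - (q / y * q ^ n) / (1 - q ^ 2 / y * q ^ n)"
        and l = "- 0 / (1 - 0)"])
    show "(\<lambda>n. - (q / y * q ^ n) / (1 - q\<^sup>2 / y * q ^ n)) \<longlonglongrightarrow> - 0 / (1 - 0)"
      by (intro tendsto_intros q_tendsto) auto
    fix n
    define m where "m = - int (Suc n) - 1"
    have m: "- int n - 1 = m + 1" by (simp add: m_def)
    define Q where "Q = q powi m"
    have Q: "Q \<noteq> 0" by (simp add: Q_def)
    have qn: "q ^ n = 1 / (q\<^sup>2 * Q)"
    proof -
      have "q ^ n * (q\<^sup>2 * Q) = q powi (int n + 2 + m)"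
        by (simp add: Q_def power_int_add power_add flip: power2_eq_square)
      also have "int n + 2 + m = 0" by (simp add: m_def)
      finally show ?thesis using Q by (simp add: field_simps)
    qed
    have "1 - y * Q \<noteq> 0" using off_lattice_powi[OF y, of m] by (simp add: Q_def)
    then have r: "- (q / y * q ^ n) / (1 - q\<^sup>2 / y * q ^ n) = 1 / (q * (1 - y * Q))"
      using off_lattice_nz[OF y] Q unfolding qn
      by (simp add: divide_simps power2_eq_square)
    show "q powi (- int (Suc n) - 1) / qpoch_inf (y * q powi (- int (Suc n) - 1)) q
        = - (q / y * q ^ n) / (1 - q\<^sup>2 / y * q ^ n) * (q powi (- int n - 1) / qpoch_inf (y * q powi (- int n - 1)) q)"
      unfolding r m m_def[symmetric] Q_def qpoch_inf_int_Suc[of y m]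
      by (simp add: power_int_add)
  qed auto
qed

text \<open>Expand the factor containing \<open>x\<close> into partial fractions and collect the terms with the same
  pole; their sum is a Durfee square series.\<close>
lemma bilateral_appell:
  assumes x: "off_lattice x" and y: "off_lattice y"
  shows "((\<lambda>n. q powi n / (qpoch_inf (x * q powi n) q * qpoch_inf (y * q powi n) q))
          has_sum (appell x y / jtheta y q)) UNIV"
proof -
  define c where "c = (\<lambda>k. (-1) ^ k * qtri q (int k) * q ^ k / qpoch q q k)"
  define g where "g = (\<lambda>n::int. q powi n / qpoch_inf (y * q powi n) q)"
  define G where "G = (\<lambda>(n, k). g n * c k * (1 / (1 - x * q powi (n + int k))) / qpoch_inf q q)"
  define H where "H = (\<lambda>(N, k). g (N - int k) * c k * (1 / (1 - x * q powi N)) / qpoch_inf q q)"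
  obtain C where C: "C > 0" "\<And>n::int. norm (1 / (1 - x * q powi n)) \<le> C"
    using bounded_inverse_one_minus_int[OF x] by blast
  have sg: "(\<lambda>n. norm (g n)) summable_on UNIV"
    unfolding g_def by (rule half_bilateral_summable[OF y])
  have sc: "(\<lambda>k. norm (c k)) summable_on UNIV"
    using norm_summable_imp_summable_on[of "\<lambda>k. norm (c k)"] summable_euler2[of q] by (simp add: c_def)
  \<comment> \<open>The poles are bounded uniformly by \<open>C\<close>, so the double family is
    dominated by a product of two absolutely summable families. This licenses both orders of
    summation.\<close>
  have sG: "(\<lambda>p. norm (G p)) summable_on UNIV \<times> UNIV"
  proof (rule Infinite_Sum.abs_summable_on_comparison_test')
    show "(\<lambda>p. norm (case p of (n, k) \<Rightarrow> g n * c k) * (C / norm (qpoch_inf q q))) summable_on UNIV \<times> UNIV"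
      by (rule summable_on_cmult_left[OF abs_summable_on_times[OF sg sc]])
    fix p :: "int \<times> nat"
    obtain n k where p: "p = (n, k)" by force
    have "norm (G p) = norm (g n * c k) * (norm (1 / (1 - x * q powi (n + int k))) / norm (qpoch_inf q q))"
      unfolding G_def p by (simp add: norm_mult norm_divide)
    also have "\<dots> \<le> norm (g n * c k) * (C / norm (qpoch_inf q q))"
      by (intro mult_left_mono divide_right_mono C) auto
    finally show "norm (G p) \<le> norm (case p of (n, k) \<Rightarrow> g n * c k) * (C / norm (qpoch_inf q q))"
      by (simp add: p)
  qed
  then have sG': "G summable_on UNIV \<times> UNIV" by (rule abs_summable_summable)
  then obtain S where S: "(G has_sum S) (UNIV \<times> UNIV)" by (auto simp: summable_on_def)
  have GH: "G = (\<lambda>(n, k). H (n + int k, k))"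
    by (auto simp: G_def H_def)
  have SH: "(H has_sum S) (UNIV \<times> UNIV)"
    using S unfolding GH has_sum_shear .
  have inner: "(\<lambda>k. G (n, k)) summable_on UNIV" "(\<lambda>k. H (n, k)) summable_on UNIV" for n
    using summable_on_SigmaD1[of "\<lambda>x y. G (x, y)" UNIV "\<lambda>_. UNIV" n] sG'
      summable_on_SigmaD1[of "\<lambda>x y. H (x, y)" UNIV "\<lambda>_. UNIV" n] has_sum_imp_summable[OF SH] by simp_all
  have *: "((\<lambda>n. q powi n / (qpoch_inf (x * q powi n) q * qpoch_inf (y * q powi n) q)) has_sum S) UNIV"
  proof (rule has_sum_SigmaD[OF S])
    fix n :: int
    have "(\<lambda>k. c k / (1 - x * q powi n * q ^ k)) sums (qpoch_inf q q / qpoch_inf (x * q powi n) q)"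
      unfolding c_def by (rule partial_fraction[OF off_lattice_pow[OF off_lattice_shift[OF x]]])
    then have "(\<lambda>k. g n / qpoch_inf q q * (c k / (1 - x * q powi n * q ^ k)))
        sums (g n / qpoch_inf q q * (qpoch_inf q q / qpoch_inf (x * q powi n) q))"
      by (rule sums_mult)
    moreover have "g n / qpoch_inf q q * (c k / (1 - x * q powi n * q ^ k)) = G (n, k)" for k
      by (simp add: G_def power_int_add mult_ac)
    moreover have "g n / qpoch_inf q q * (qpoch_inf q q / qpoch_inf (x * q powi n) q)
       = q powi n / (qpoch_inf (x * q powi n) q * qpoch_inf (y * q powi n) q)"
      by (simp add: g_def)
    ultimately show "((\<lambda>k. G (n, k)) has_sum q powi n / (qpoch_inf (x * q powi n) q * qpoch_inf (y * q powi n) q)) UNIV"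
      by (intro has_sum_of_summable_sums inner) simp
  qed
  have **: "((\<lambda>N. (qtri q N * (- (y * q)) powi N * (1 / (1 - x * q powi N))) * (1 / jtheta y q)) has_sum S) UNIV"
  proof (rule has_sum_SigmaD[OF SH])
    fix N :: int
    define z where "z = y * q powi N"
    have z: "off_lattice z" unfolding z_def by (rule off_lattice_shift[OF y])
    have z0: "z \<noteq> 0" by (rule off_lattice_nz[OF z])
    define K where "K = q powi N / qpoch_inf z q * (1 / (1 - x * q powi N)) / qpoch_inf q q"
    \<comment> \<open>Turning around the first \<open>k\<close> factors of the product at
      \<open>z q^(-k)\<close> gives the weight \<open>qtri q (int k + 1)\<close>. Together with the
      weight \<open>qtri q (int k)\<close> of the partial fractions it makes \<open>q^(k^2)\<close>,
      the weight of a Durfee square, here with parameter \<open>1 / z\<close>.\<close>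
    have "(\<lambda>k. q ^ (k * k) * (1 / z) ^ k / (qpoch q q k * qpoch (1 / z * q) q k)) sums (1 / qpoch_inf (1 / z * q) q)"
      by (rule durfee) (use off_lattice_pow[OF off_lattice_inverse[OF z], of "Suc _"] in auto)
    then have "(\<lambda>k. K * (q ^ (k * k) * (1 / z) ^ k / (qpoch q q k * qpoch (q / z) q k))) sums (K * (1 / qpoch_inf (q / z) q))"
      by (intro sums_mult) simp
    moreover have "K * (q ^ (k * k) * (1 / z) ^ k / (qpoch q q k * qpoch (q / z) q k)) = H (N, k)" for k
    proof -
      have "qpoch_inf (y * q powi (N - int k)) q = qpoch (z * q powi (- int k)) q k * qpoch_inf z q"
        using qpoch_inf_nat_neg_shift[of y N k] by (simp add: z_def power_int_diff power_int_minus field_simps)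
      moreover have "qpoch (z * q powi (- int k)) q k = (- z) ^ k * qpoch (q / z) q k / qtri q (int k + 1)"
        using qpoch_reverse[OF z0, of k] by (simp add: field_simps)
      ultimately have g: "g (N - int k) = q powi N / q ^ k * (qtri q (int k + 1) / ((- z) ^ k * qpoch (q / z) q k * qpoch_inf z q))"
        by (simp add: g_def power_int_diff)
      have "qtri q (int k + 1) * qtri q (int k) = q ^ (k * k)"
        using qtri_square[OF q_nz, of "int k"] qtri_Suc[OF q_nz, of "int k"]
        by (simp add: power_int_diff mult_ac flip: power_int_of_nat)
      then have t: "q ^ (k * k) = qtri q (int k + 1) * qtri q (int k)" by simp
      have "(1 / z) ^ k = (-1) ^ k / (- z) ^ k"
        by (simp add: power_minus[of z] power_one_over)
      then show ?thesis
        unfolding H_def c_def K_def t by (simp add: g mult_ac)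
    qed
    moreover have "K * (1 / qpoch_inf (q / z) q) = (qtri q N * (- (y * q)) powi N * (1 / (1 - x * q powi N))) * (1 / jtheta y q)"
    proof -
      have nzj: "jtheta z q \<noteq> 0" by (rule jtheta_nonzero[OF z])
      have "jtheta y q = jtheta z q * (qtri q N * (- y) powi N)"
        using jtheta_shift_int[OF off_lattice_nz[OF y], of N] by (simp add: z_def)
      moreover have "(- (y * q)) powi N = (- y) powi N * q powi N"
        using power_int_mult_distrib[of "- y" q N] by simp
      moreover have "K * (1 / qpoch_inf (q / z) q) = q powi N * (1 / (1 - x * q powi N)) / jtheta z q"
        by (simp add: K_def jtheta_def)
      ultimately show ?thesis using nzj off_lattice_nz[OF y] by simp
    qed
    ultimately show "((\<lambda>k. H (N, k)) has_sum (qtri q N * (- (y * q)) powi N * (1 / (1 - x * q powi N))) * (1 / jtheta y q)) UNIV"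
      by (intro has_sum_of_summable_sums inner) simp
  qed
  have "((\<lambda>N. (qtri q N * (- (y * q)) powi N * (1 / (1 - x * q powi N))) * (1 / jtheta y q)) has_sum (appell x y * (1 / jtheta y q))) UNIV"
    by (rule has_sum_cmult_left[OF appell_has_sum[OF x off_lattice_nz[OF y]]])
  from has_sum_unique[OF ** this] have "S = appell x y / jtheta y q" by simp
  with * show ?thesis by simp
qed

subsection \<open>Appell sums and theta quotients\<close>

lemma jtheta_1 [simp]: "jtheta 1 q = 0"
  using qpoch_inf_Suc[of 1] by (simp add: jtheta_def)

lemma jtheta_reflect: "jtheta (q / x) q = jtheta x q"
  by (simp add: jtheta_def mult_ac)

lemma jtheta_inverse: "x \<noteq> 0 \<Longrightarrow> jtheta (1 / x) q = - jtheta x q / x"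
  using jtheta_shift[of "1 / x"] jtheta_reflect[of x] by (simp add: field_simps)

text \<open>As Laurent series in \<open>y\<close>, the coefficients \<open>c\<close> of the left-hand side satisfy the same
  first-order recurrence as those of the theta function on the right, by the symmetry \<open>n \<mapsto> N - n\<close>.\<close>
lemma appell_theta_product:
  assumes x: "off_lattice x" and xs: "off_lattice (x * s)" and s: "s \<noteq> 0"
  shows "\<exists>C. \<forall>y. y \<noteq> 0 \<longrightarrow>
    jtheta (y * s) q * appell x y - s * (jtheta y q * appell (x * s) (y * s)) = C * jtheta (x * s * y) q"
proof -
  define a where "a = (\<lambda>N n. qtri q (N - n) * qtri q n * q powi n * s powi (N - n) * (1 / (1 - x * q powi n)))"
  define b where "b = (\<lambda>N n. qtri q (N - n) * qtri q n * q powi n * s powi (n + 1) * (1 / (1 - x * s * q powi n)))"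
  define L where "L = (\<lambda>y. jtheta (y * s) q * appell x y - s * (jtheta y q * appell (x * s) (y * s)))"
  have dbl: "((\<lambda>(N, n). (- y) powi N * (a N n - b N n)) has_sum L y) (UNIV \<times> UNIV)" if y: "y \<noteq> 0" for y
  proof -
    define f1 where "f1 = (\<lambda>(m, n). (qtri q m * (- (y * s)) powi m) * (qtri q n * (- (y * q)) powi n * (1 / (1 - x * q powi n))))"
    define f2 where "f2 = (\<lambda>(m, n). (qtri q m * (- y) powi m) * (qtri q n * (- (y * s * q)) powi n * (1 / (1 - x * s * q powi n))))"
    have "(f1 has_sum (jtheta (y * s) q * appell x y)) (UNIV \<times> UNIV)"
      unfolding f1_def using y s
      by (intro has_sum_times summable_qtri_int triple_product appell_summable appell_has_sum x) auto
    then have h1: "((\<lambda>(N, n). f1 (N - n, n)) has_sum (jtheta (y * s) q * appell x y)) (UNIV \<times> UNIV)"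
      unfolding has_sum_shear_int .
    have "(f2 has_sum (jtheta y q * appell (x * s) (y * s))) (UNIV \<times> UNIV)"
      unfolding f2_def using y s
      by (intro has_sum_times summable_qtri_int triple_product appell_summable appell_has_sum xs) auto
    then have h2: "((\<lambda>(N, n). f2 (N - n, n)) has_sum (jtheta y q * appell (x * s) (y * s))) (UNIV \<times> UNIV)"
      unfolding has_sum_shear_int .
    have "((\<lambda>p. (case p of (N, n) \<Rightarrow> f1 (N - n, n)) + (- s) * (case p of (N, n) \<Rightarrow> f2 (N - n, n)))
        has_sum (jtheta (y * s) q * appell x y + (- s) * (jtheta y q * appell (x * s) (y * s)))) (UNIV \<times> UNIV)"
      by (intro has_sum_add h1 has_sum_cmult_right h2)
    moreover have "(\<lambda>p. (case p of (N, n) \<Rightarrow> f1 (N - n, n)) + (- s) * (case p of (N, n) \<Rightarrow> f2 (N - n, n)))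
        = (\<lambda>(N, n). (- y) powi N * (a N n - b N n))"
    proof (intro ext, clarify)
      fix N n
      have "(- (y * s)) powi (N - n) * (- (y * q)) powi n = ((- y) powi (N - n) * (- y) powi n) * (s powi (N - n) * q powi n)"
        using power_int_mult_distrib[of "- y" s] power_int_mult_distrib[of "- y" q] by simp
      also have "(- y) powi (N - n) * (- y) powi n = (- y) powi N"
        using power_int_add[of "- y" "N - n" n] y by simp
      finally have "f1 (N - n, n) = (- y) powi N * a N n"
        by (simp add: f1_def a_def mult_ac)
      moreover have "s * f2 (N - n, n) = (- y) powi N * b N n"
      proof -
        have "(- y) powi (N - n) * (- (y * s * q)) powi n * s = ((- y) powi (N - n) * (- y) powi n) * (s powi (n + 1) * q powi n)"
          using power_int_mult_distrib[of "- y" "s * q"] power_int_mult_distrib[of s q] s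
          by (simp add: power_int_add mult_ac)
        also have "(- y) powi (N - n) * (- y) powi n = (- y) powi N"
          using power_int_add[of "- y" "N - n" n] y by simp
        finally show ?thesis
          by (simp add: f2_def b_def mult_ac)
      qed
      ultimately show "f1 (N - n, n) + (- s) * f2 (N - n, n) = (- y) powi N * (a N n - b N n)"
        by (simp add: algebra_simps)
    qed
    ultimately show ?thesis by (simp add: L_def)
  qed
  define c where "c = (\<lambda>N. \<Sum>\<^sub>\<infinity>n. a N n - b N n)"
  have csum: "((\<lambda>n. a N n - b N n) has_sum c N) UNIV" for N
  proof -
    \<comment> \<open>The rows do not depend on \<open>y\<close> apart from the factor
      \<open>(- y) powi N\<close>, so the double sum at the single value \<open>y = 1\<close>
      already yields their summability.\<close>
    have "(\<lambda>(N, n). (- 1) powi N * (a N n - b N n)) summable_on (UNIV \<times> UNIV)"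
      using dbl[of 1] by (auto intro: has_sum_imp_summable)
    then have "(\<lambda>n. (- 1) powi N * (a N n - b N n)) summable_on UNIV"
      by (rule summable_on_SigmaD1) simp
    then have "(\<lambda>n. (- 1) powi N * ((- 1) powi N * (a N n - b N n))) summable_on UNIV"
      by (rule summable_on_cmult_right)
    moreover have "(- 1 :: complex) powi N * (- 1) powi N = 1"
      by (simp flip: power_int_mult_distrib)
    ultimately have "(\<lambda>n. a N n - b N n) summable_on UNIV"
      by (simp flip: mult.assoc)
    then show ?thesis by (simp add: c_def)
  qed
  have rec: "c (N + 1) = x * s * q powi N * c N" for N
  proof -
    \<comment> \<open>Combining row \<open>N + 1\<close> with \<open>- x s q^N\<close> times row
      \<open>N\<close> clears the pole of \<open>a\<close> and that of \<open>b\<close>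
      simultaneously. What is left changes sign under the reflection, so its sum equals its own
      negative.\<close>
    define d where "d = (\<lambda>n. q powi N * (qtri q (N - n) * qtri q n) * (s powi (N + 1 - n) - s powi (n + 1)))"
    have "((\<lambda>n. (a (N + 1) n - b (N + 1) n) + - (x * s * q powi N) * (a N n - b N n))
        has_sum (c (N + 1) + - (x * s * q powi N) * c N)) UNIV"
      by (intro has_sum_add has_sum_cmult_right csum)
    moreover have "(a (N + 1) n - b (N + 1) n) + - (x * s * q powi N) * (a N n - b N n) = d n" for n
    proof -
      define T where "T = qtri q (N - n) * qtri q n"
      have t: "qtri q (N + 1 - n) * qtri q n * q powi n = T * q powi N"
        using qtri_Suc[OF q_nz, of "N - n"] by (simp add: T_def power_int_diff algebra_simps)
      have n1: "1 - x * q powi n \<noteq> 0" and n2: "1 - x * s * q powi n \<noteq> 0"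
        using off_lattice_powi[OF x, of n] off_lattice_powi[OF xs, of n] by auto
      have sN: "s powi (N + 1 - n) = s * s powi (N - n)"
        using power_int_add[of s "N - n" 1] s by (simp add: algebra_simps)
      have "a (N + 1) n - x * s * q powi N * a N n = T * q powi N * s powi (N + 1 - n) * ((1 - x * q powi n) * (1 / (1 - x * q powi n)))"
        unfolding a_def t T_def[symmetric] sN by (simp only: algebra_simps mult_1_left)
      moreover have "b (N + 1) n - x * s * q powi N * b N n = T * q powi N * s powi (n + 1) * ((1 - x * s * q powi n) * (1 / (1 - x * s * q powi n)))"
        unfolding b_def t T_def[symmetric] by (simp only: algebra_simps mult_1_left)
      ultimately show ?thesis using n1 n2 by (simp add: d_def T_def algebra_simps)
    qed
    ultimately have d: "(d has_sum (c (N + 1) + - (x * s * q powi N) * c N)) UNIV" by simp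
    have bij: "bij_betw (\<lambda>n. N - n) UNIV UNIV"
      by (rule bij_betwI[of _ _ _ "\<lambda>n. N - n"]) auto
    have "((\<lambda>n. d (N - n)) has_sum (c (N + 1) + - (x * s * q powi N) * c N)) UNIV"
      by (rule iffD2[OF has_sum_reindex_bij_betw[OF bij] d])
    moreover have "d (N - n) = - d n" for n
      by (simp add: d_def algebra_simps)
    ultimately have "((\<lambda>n. - d n) has_sum (c (N + 1) + - (x * s * q powi N) * c N)) UNIV"
      by simp
    from has_sum_unique[OF this has_sum_uminusI[OF d]] show ?thesis by simp
  qed
  have closed: "c N = qtri q N * (x * s) powi N * c 0" for N
  proof (induction N rule: int_induct[where k = 0])
    case (step1 N)
    then show ?case using off_lattice_nz[OF xs] by (simp add: rec qtri_Suc power_int_add)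
  next
    case (step2 N)
    have "x * s * q powi (N - 1) * c (N - 1) = qtri q N * (x * s) powi N * c 0"
      using rec[of "N - 1"] step2 by simp
    also have "\<dots> = x * s * q powi (N - 1) * (qtri q (N - 1) * (x * s) powi (N - 1) * c 0)"
      using qtri_Suc[OF q_nz, of "N - 1"] power_int_add[of "x * s" "N - 1" 1] off_lattice_nz[OF xs] by simp
    finally show ?case using off_lattice_nz[OF xs] by simp
  qed simp
  have "L y = c 0 * jtheta (x * s * y) q" if y: "y \<noteq> 0" for y
  proof -
    have "((\<lambda>N. (- y) powi N * c N) has_sum L y) UNIV"
      by (rule has_sum_SigmaD[OF dbl[OF y]]) (simp add: has_sum_cmult_right csum)
    moreover have "(- y) powi N * c N = c 0 * (qtri q N * (- (x * s * y)) powi N)" for N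
      using power_int_mult_distrib[of "x * s" "- y" N] by (simp add: closed[of N] mult_ac)
    moreover have "((\<lambda>N. c 0 * (qtri q N * (- (x * s * y)) powi N)) has_sum (c 0 * jtheta (x * s * y) q)) UNIV"
      using y off_lattice_nz[OF xs] by (intro has_sum_cmult_right triple_product) auto
    ultimately show ?thesis by (simp add: has_sum_unique)
  qed
  then show ?thesis unfolding L_def by blast
qed

text \<open>The two sides arise from \<open>appell_theta_product\<close> at \<open>y = 1\<close> and \<open>y = 1 / s\<close>, where one of its
  theta factors vanishes.\<close>
lemma appell_one_jtheta_const:
  assumes x: "off_lattice x" and xs: "off_lattice (x * s)" and s: "off_lattice s"
  shows "appell x 1 * jtheta x q = appell (x * s) 1 * jtheta (x * s) q"
proof -
  have s0: "s \<noteq> 0" by (rule off_lattice_nz[OF s])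
  obtain C where C: "\<And>y. y \<noteq> 0 \<Longrightarrow>
    jtheta (y * s) q * appell x y - s * (jtheta y q * appell (x * s) (y * s)) = C * jtheta (x * s * y) q"
    using appell_theta_product[OF x xs s0] by blast
  have "jtheta s q * appell x 1 = C * jtheta (x * s) q"
    using C[of 1] by simp
  moreover have "jtheta s q * appell (x * s) 1 = C * jtheta x q"
    using C[of "1 / s"] s0 by (simp add: jtheta_inverse)
  ultimately have "jtheta s q * (appell x 1 * jtheta x q) = jtheta s q * (appell (x * s) 1 * jtheta (x * s) q)"
    by (metis mult.assoc mult.commute)
  then show ?thesis using jtheta_nonzero[OF s] by simp
qed

text \<open>The hypotheses confine \<open>w\<close> to an annulus around the unit circle. Then every
  \<open>w q^n\<close> with nonzero \<open>n\<close> has modulus at most \<open>r\<close> or at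
  least \<open>1 / r\<close>, so only the pole at \<open>n = 0\<close> can come close.\<close>

lemma near_one_bound:
  assumes "r < 1" "norm w * norm q \<le> r" "norm q \<le> r * norm w" "n \<noteq> 0"
  shows "1 - r \<le> norm (1 - w * q powi n)"
proof (cases "n > 0")
  case True
  define m where "m = nat (n - 1)"
  have n: "n = int m + 1" using True by (simp add: m_def)
  have "norm (w * q powi n) = norm w * norm q * norm q ^ m"
    by (simp add: n power_int_add norm_mult norm_power)
  also have "\<dots> \<le> norm w * norm q * 1"
    using q_lt by (intro mult_left_mono) (auto simp: power_le_one)
  finally have "norm (w * q powi n) \<le> r" using assms(2) by simp
  then show ?thesis using norm_triangle_ineq2[of 1 "w * q powi n"] by simp
next
  case False
  define m where "m = nat (- n - 1)"
  have n: "n = - int m - 1" using False assms(4) by (simp add: m_def)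
  have q0: "norm q > 0" by simp
  have r0: "r > 0" using assms(2,3) q0
    by (metis linorder_not_less mult_nonneg_nonneg mult_nonpos_nonneg norm_ge_zero order_less_le_trans)
  have "1 \<le> norm (w * q powi n) * r"
  proof -
    have "norm (w * q powi n) = norm w / (norm q ^ m * norm q)"
      by (simp add: n power_int_diff power_int_minus norm_mult norm_divide norm_power norm_inverse field_simps)
    moreover have "norm q ^ m * norm q \<le> r * norm w"
      using q_lt assms(3) by (metis mult_left_le_one_le norm_ge_zero order_less_imp_le order_trans power_le_one zero_le_power)
    moreover have Q: "norm q ^ m * norm q > 0" using q0 by simp
    ultimately have "(norm q ^ m * norm q) * 1 \<le> (norm q ^ m * norm q) * (norm (w * q powi n) * r)"
      by (simp add: mult.commute)
    then show ?thesis by (rule mult_left_le_imp_le[OF _ Q])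
  qed
  moreover have "1 * (1 - r) \<le> 1 / r * (1 - r)"
    using assms(1) r0 by (intro mult_right_mono) (auto simp: field_simps)
  moreover have "1 / r * (1 - r) = 1 / r - 1" using r0 by (simp add: field_simps)
  moreover have "1 / r \<le> X" if "1 \<le> X * r" for X using that r0 by (simp add: pos_divide_le_eq)
  ultimately have "1 - r \<le> norm (w * q powi n) - 1" by fastforce
  then show ?thesis using norm_triangle_ineq2[of "w * q powi n" 1] by (simp add: norm_minus_commute)
qed

text \<open>The left-hand side is independent of \<open>x\<close>, so it may be evaluated in the
  limit at 1: there the simple pole of the term \<open>n = 0\<close> cancels the simple zero of the
  theta function, and the bounded rest \<open>R\<close> is multiplied by a factor tending to
  0.\<close>

lemma appell_one:
  assumes x: "off_lattice x"
  shows "appell x 1 * jtheta x q = (qpoch_inf q q) ^ 3"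
proof -
  obtain C where C: "C > 0" "\<And>n::int. norm (1 / (1 - x * q powi n)) \<le> C"
    using bounded_inverse_one_minus_int[OF x] by blast
  \<comment> \<open>The midpoint of \<open>norm q\<close> and 1: at \<open>w = 1\<close> both
    annulus conditions of \<open>near_one_bound\<close> become \<open>norm q < r\<close>, so they
    persist near 1.\<close>
  define r where "r = (1 + norm q) / 2"
  have r: "norm q < r" "r < 1" using q_lt by (auto simp: r_def)
  have "((\<lambda>w::complex. norm w * norm q) \<longlongrightarrow> norm (1::complex) * norm q) (at 1)"
    by (intro tendsto_mult tendsto_norm tendsto_ident_at tendsto_const)
  from order_tendstoD(2)[OF this, of r] have e1: "\<forall>\<^sub>F w in at (1::complex). norm w * norm q < r"
    using r by simp
  have "((\<lambda>w::complex. r * norm w) \<longlongrightarrow> r * norm (1::complex)) (at 1)"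
    by (intro tendsto_mult tendsto_norm tendsto_ident_at tendsto_const)
  from order_tendstoD(1)[OF this, of "norm q"] have e2: "\<forall>\<^sub>F w in at (1::complex). norm q < r * norm w"
    using r by simp
  have e3: "\<forall>\<^sub>F w in at (1::complex). w \<noteq> 1" by (simp add: eventually_at_filter)
  \<comment> \<open>Every \<open>x q^n\<close> has distance at least \<open>1 / C\<close> from 1.
    Closer points \<open>w\<close> are therefore never of this form, which makes
    \<open>s = w / x\<close> an admissible shift.\<close>
  have e4: "\<forall>\<^sub>F w in at (1::complex). dist w 1 < 1 / C"
    using C(1) by (auto simp: eventually_at intro!: exI[of _ "1 / C"])
  define h where "h = (\<lambda>n. qtri q n * (- (1 * q)) powi n)"
  have hs: "(\<lambda>n. norm (h n)) summable_on UNIV"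
    unfolding h_def by (rule summable_qtri_int) simp
  define K where "K = (\<Sum>\<^sub>\<infinity>n\<in>-{0}. norm (h n) * (1 / (1 - r)))"
  define R where "R = (\<lambda>w. \<Sum>\<^sub>\<infinity>n\<in>-{0}. h n * (1 / (1 - w * q powi n)))"
  have key: "\<forall>\<^sub>F w in at 1. off_lattice w \<and> appell x 1 * jtheta x q = appell w 1 * jtheta w q
      \<and> norm (R w) \<le> K \<and> appell w 1 * jtheta w q
        = (1 + (1 - w) * R w) * (qpoch_inf (w * q) q * qpoch_inf (q / w) q * qpoch_inf q q)"
    using e1 e2 e3 e4
  proof eventually_elim
    case (elim w)
    have bd: "1 - r \<le> norm (1 - w * q powi n)" if "n \<noteq> 0" for n
      using near_one_bound[OF r(2) _ _ that] elim by simp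
    have w: "off_lattice w"
      unfolding off_lattice_def
    proof (intro conjI allI)
      show "w \<noteq> 0"
      proof
        assume "w = 0"
        then have "norm q < 0" using elim(2) by simp
        then show False by simp
      qed
      show "w * q powi n \<noteq> 1" for n
        using bd[of n] r elim(3) by (cases "n = 0") auto
    qed
    have wx: "off_lattice (w / x)"
      unfolding off_lattice_def
    proof (intro conjI allI)
      show "w / x \<noteq> 0" using off_lattice_nz[OF w] off_lattice_nz[OF x] by simp
      show "w / x * q powi n \<noteq> 1" for n
      proof
        assume "w / x * q powi n = 1"
        then have "w = x * q powi (- n)"
          using off_lattice_nz[OF x] by (simp add: power_int_minus field_simps)
        moreover have "1 / C \<le> norm (1 - x * q powi (- n))"
          using C(1) C(2)[of "- n"] off_lattice_powi[OF x, of "- n"]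
          by (simp add: norm_divide field_simps)
        ultimately show False using elim(4) by (simp add: dist_norm norm_minus_commute)
      qed
    qed
    have "appell x 1 * jtheta x q = appell w 1 * jtheta w q"
      using appell_one_jtheta_const[OF x _ wx] w off_lattice_nz[OF x] by simp
    moreover have "norm (R w) \<le> K"
      unfolding R_def K_def
    proof (rule norm_infsum_le)
      show "((\<lambda>n. h n * (1 / (1 - w * q powi n))) has_sum (\<Sum>\<^sub>\<infinity>n\<in>-{0}. h n * (1 / (1 - w * q powi n)))) (- {0})"
        using summable_on_subset_banach[OF has_sum_imp_summable[OF appell_has_sum[OF w, of 1]], of "-{0}"]
        by (simp add: h_def)
      show "((\<lambda>n. norm (h n) * (1 / (1 - r))) has_sum (\<Sum>\<^sub>\<infinity>n\<in>-{0}. norm (h n) * (1 / (1 - r)))) (- {0})"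
        using summable_on_subset_banach[OF summable_on_cmult_left[OF hs, of "1 / (1 - r)"], of "-{0}"] by simp
      show "norm (h n * (1 / (1 - w * q powi n))) \<le> norm (h n) * (1 / (1 - r))" if "n \<in> -{0}" for n
        unfolding norm_mult using bd[of n] that r
        by (intro mult_left_mono) (auto simp: norm_divide intro!: divide_left_mono mult_pos_pos)
    qed
    moreover have "appell w 1 = 1 / (1 - w) + R w"
    proof -
      have sm: "(\<lambda>n. h n * (1 / (1 - w * q powi n))) summable_on -{0}"
        using summable_on_subset_banach[OF has_sum_imp_summable[OF appell_has_sum[OF w, of 1]], of "-{0}"]
        by (simp add: h_def)
      have "appell w 1 = (\<Sum>\<^sub>\<infinity>n\<in>insert 0 (-{0}). h n * (1 / (1 - w * q powi n)))"
      proof -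
        have "insert 0 (-{0}) = (UNIV :: int set)" by auto
        then show ?thesis by (simp add: appell_def h_def)
      qed
      also have "\<dots> = h 0 * (1 / (1 - w * q powi 0)) + R w"
        unfolding R_def by (rule infsum_insert[OF sm]) simp
      finally show ?thesis by (simp add: h_def)
    qed
    moreover have "jtheta w q = (1 - w) * (qpoch_inf (w * q) q * qpoch_inf (q / w) q * qpoch_inf q q)"
      using qpoch_inf_Suc[of w] by (simp add: jtheta_def mult_ac)
    moreover have "(1 / (1 - w) + R w) * ((1 - w) * P) = (1 + (1 - w) * R w) * P" for P
      using elim(3) by (simp add: field_simps)
    ultimately show ?case using w by metis
  qed
  have "((\<lambda>w. (1 - w) * R w) \<longlongrightarrow> 0) (at 1)"
  proof (rule Lim_null_comparison)
    show "\<forall>\<^sub>F w in at 1. norm ((1 - w) * R w) \<le> norm (1 - w) * K"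
      using key by eventually_elim (auto simp: norm_mult intro!: mult_left_mono)
    have "((\<lambda>w::complex. norm (1 - w) * K) \<longlongrightarrow> norm (1 - 1 :: complex) * K) (at 1)"
      by (intro tendsto_intros)
    then show "((\<lambda>w. norm (1 - w :: complex) * K) \<longlongrightarrow> 0) (at 1)" by simp
  qed
  moreover have "((\<lambda>w. qpoch_inf (w * q) q) \<longlongrightarrow> qpoch_inf (1 * q) q) (at 1)"
    by (rule isCont_tendsto_compose[OF isCont_qpoch_inf]) (intro tendsto_intros)
  moreover have "((\<lambda>w. qpoch_inf (q / w) q) \<longlongrightarrow> qpoch_inf (q / 1) q) (at 1)"
    by (rule isCont_tendsto_compose[OF isCont_qpoch_inf]) (intro tendsto_intros, simp)
  ultimately have "((\<lambda>w. (1 + (1 - w) * R w) * (qpoch_inf (w * q) q * qpoch_inf (q / w) q * qpoch_inf q q))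
      \<longlongrightarrow> (1 + 0) * (qpoch_inf (1 * q) q * qpoch_inf (q / 1) q * qpoch_inf q q)) (at 1)"
    by (intro tendsto_intros)
  moreover have "\<forall>\<^sub>F w in at 1. (1 + (1 - w) * R w) * (qpoch_inf (w * q) q * qpoch_inf (q / w) q * qpoch_inf q q) = appell x 1 * jtheta x q"
    using key by eventually_elim metis
  ultimately have "((\<lambda>w::complex. appell x 1 * jtheta x q) \<longlongrightarrow> (1 + 0) * (qpoch_inf (1 * q) q * qpoch_inf (q / 1) q * qpoch_inf q q)) (at 1)"
    by (rule Lim_transform_eventually)
  then show ?thesis
    by (simp add: tendsto_const_iff power3_eq_cube)
qed

lemma bilateral_eq: "off_lattice x \<Longrightarrow> off_lattice y \<Longrightarrow> bilateral x y = appell x y / jtheta y q"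
  unfolding bilateral_def by (rule infsumI) (rule bilateral_appell)

text \<open>The constant left open by \<open>appell_theta_product\<close> is read off at
  \<open>y = 1\<close>, where one theta factor vanishes and \<open>appell_one\<close> evaluates the
  remaining Appell sum.\<close>

lemma bilateral_shift:
  assumes x: "off_lattice x" and y: "off_lattice y" and xs: "off_lattice (x * s)" and ys: "off_lattice (y * s)"
  shows "bilateral x y - s * bilateral (x * s) (y * s) =
    (qpoch_inf q q) ^ 3 * jtheta (x * s * y) q * jtheta s q /
    (jtheta x q * jtheta y q * jtheta (x * s) q * jtheta (y * s) q)"
proof -
  have s0: "s \<noteq> 0" using off_lattice_nz[OF xs] by auto
  obtain C where C: "\<And>y. y \<noteq> 0 \<Longrightarrow>
    jtheta (y * s) q * appell x y - s * (jtheta y q * appell (x * s) (y * s)) = C * jtheta (x * s * y) q"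
    using appell_theta_product[OF x xs s0] by blast
  note nz = jtheta_nonzero[OF x] jtheta_nonzero[OF y] jtheta_nonzero[OF xs] jtheta_nonzero[OF ys]
  have "jtheta s q * appell x 1 = C * jtheta (x * s) q"
    using C[of 1] by simp
  then have "C = jtheta s q * (appell x 1 * jtheta x q) / (jtheta x q * jtheta (x * s) q)"
    using nz by (simp add: field_simps)
  then have C': "C = jtheta s q * (qpoch_inf q q) ^ 3 / (jtheta x q * jtheta (x * s) q)"
    by (simp only: appell_one[OF x])
  have "bilateral x y - s * bilateral (x * s) (y * s) =
     (jtheta (y * s) q * appell x y - s * (jtheta y q * appell (x * s) (y * s))) / (jtheta y q * jtheta (y * s) q)"
    unfolding bilateral_eq[OF x y] bilateral_eq[OF xs ys] using nz by (simp add: field_simps)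
  also have "\<dots> = C * jtheta (x * s * y) q / (jtheta y q * jtheta (y * s) q)"
    by (simp only: C[OF off_lattice_nz[OF y]])
  finally show ?thesis unfolding C' by (simp add: mult_ac)
qed

subsection \<open>The universal mock theta function\<close>

definition bterm :: "complex \<Rightarrow> complex \<Rightarrow> int \<Rightarrow> complex" where
  "bterm x y n = q powi n / (qpoch_inf (x * q powi n) q * qpoch_inf (y * q powi n) q)"

lemma bterm_has_sum: "off_lattice x \<Longrightarrow> off_lattice y \<Longrightarrow> (bterm x y has_sum bilateral x y) UNIV"
  using bilateral_appell[of x y] bilateral_eq[of x y] by (simp add: bterm_def[abs_def])

lemma qpoch_inf_neg:
  assumes "z \<noteq> 0"
  shows "qpoch_inf (z * q powi (- int k)) q * qtri q (int k + 1) = (- z) ^ k * qpoch (q / z) q k * qpoch_inf z q"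
proof -
  have "qpoch_inf (z * q powi (- int k)) q = qpoch (z * q powi (- int k)) q k * qpoch_inf z q"
    using qpoch_inf_nat_neg_shift[of z 0 k] by simp
  then show ?thesis
    by (simp only: qpoch_reverse[OF assms, symmetric]) (simp only: mult_ac)
qed

text \<open>Makes the decay of the left half visible: the powers of \<open>q\<close> in the
  numerator combine to \<open>q^(N^2)\<close>.\<close>

lemma bterm_neg:
  assumes x: "off_lattice x" and y: "off_lattice y"
  shows "bterm x y (- int N) = q powi (- int N) * (qtri q (int N + 1))\<^sup>2 /
    ((x * y) ^ N * qpoch (q / x) q N * qpoch (q / y) q N * qpoch_inf x q * qpoch_inf y q)"
proof -
  define T where "T = qtri q (int N + 1)"
  have T: "T \<noteq> 0" by (simp add: T_def)
  have "qpoch_inf (x * q powi (- int N)) q = (- x) ^ N * qpoch (q / x) q N * qpoch_inf x q / T"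
    "qpoch_inf (y * q powi (- int N)) q = (- y) ^ N * qpoch (q / y) q N * qpoch_inf y q / T"
    using qpoch_inf_neg[OF off_lattice_nz[OF x], of N] qpoch_inf_neg[OF off_lattice_nz[OF y], of N] T
    by (simp_all add: T_def field_simps)
  moreover have "(- x) ^ N * (- y) ^ N = (x * y) ^ N"
    by (simp flip: power_mult_distrib)
  ultimately show ?thesis
    unfolding bterm_def T_def[symmetric] by (simp add: power2_eq_square mult_ac)
qed

text \<open>With \<open>y = 1 / x\<close> the denominators at positive indices are tails of
  \<open>qpoch_inf x q\<close> and \<open>qpoch_inf (q / x) q\<close>; the prefactor cancels them
  and leaves finite products.\<close>

lemma bilateral_split:
  assumes x: "off_lattice x"
  defines "u \<equiv> \<lambda>m. q ^ (m * m) / (qpoch x q (Suc m) * qpoch (q / x) q m)"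
    and "v \<equiv> \<lambda>n. qpoch (q / x) q n * qpoch x q (Suc n) * q ^ Suc n"
  shows "summable u"
    and "qpoch_inf x q * qpoch_inf (q / x) q * bilateral x (1 / x) = (\<Sum>n. v n) - x * (\<Sum>m. u m)"
proof -
  note x0 = off_lattice_nz[OF x] and x' = off_lattice_inverse[OF x] and x'' = off_lattice_q_div[OF x]
  define P where "P = qpoch_inf x q * qpoch_inf (q / x) q"
  have P: "P \<noteq> 0" using qpoch_inf_nonzero[OF x] qpoch_inf_nonzero[OF x''] by (simp add: P_def)
  have b: "bij_betw (\<lambda>n::int. n + 1) UNIV UNIV"
    by (rule bij_betwI[of _ _ _ "\<lambda>n. n - 1"]) auto
  \<comment> \<open>The shift by one moves the splitting point, so that the term of index 0 joins
    the mock theta part.\<close>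
  have "((\<lambda>n. bterm x (1 / x) (n + 1)) has_sum bilateral x (1 / x)) UNIV"
    by (rule iffD2[OF has_sum_reindex_bij_betw[OF b] bterm_has_sum[OF x x']])
  then have *: "((\<lambda>n. P * bterm x (1 / x) (n + 1)) has_sum (P * bilateral x (1 / x))) UNIV"
    by (rule has_sum_cmult_right)
  have vn: "P * bterm x (1 / x) (int n + 1) = v n" for n
  proof -
    have e: "q powi (int n + 1) = q ^ Suc n" and e': "1 / x * q ^ Suc n = q / x * q ^ n"
      by (simp_all add: power_int_add)
    have nz: "qpoch_inf (x * q ^ Suc n) q \<noteq> 0" "qpoch_inf (q / x * q ^ n) q \<noteq> 0"
      using qpoch_inf_nonzero[OF off_lattice_shift[OF x], of "int (Suc n)"]
        qpoch_inf_nonzero[OF off_lattice_shift[OF x''], of "int n"] by (simp_all only: power_int_of_nat not_False_eq_True)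
    have P': "P = (qpoch x q (Suc n) * qpoch_inf (x * q ^ Suc n) q) * (qpoch (q / x) q n * qpoch_inf (q / x * q ^ n) q)"
      unfolding P_def using qpoch_inf_split[of x "Suc n"] qpoch_inf_split[of "q / x" n] by (simp only:)
    show ?thesis
      unfolding bterm_def v_def P' e e' using nz by (simp del: power_Suc)
  qed
  have un: "P * bterm x (1 / x) ((- int m - 1) + 1) = - x * u m" for m
  proof -
    have e: "(- int m - 1) + 1 = - int m" by simp
    have "q / (1 / x) = q * x" by simp
    have s: "qpoch (q * x) q m * (1 - x) = qpoch x q (Suc m)"
      by (simp add: qpoch_Suc_shift mult_ac)
    have i: "qpoch_inf (1 / x) q = (1 - 1 / x) * qpoch_inf (q / x) q"
      using qpoch_inf_Suc[of "1 / x"] by simp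
    have "qtri q (int m + 1) * qtri q (int m + 1) = q powi (int m) * q powi (int (m * m))"
      using qtri_square[OF q_nz, of "int m + 1"] by (simp add: algebra_simps power_int_add power_add)
    then have t: "q powi (- int m) * (qtri q (int m + 1))\<^sup>2 = q ^ (m * m)"
      using power_int_of_nat[of q "m * m"] by (simp add: power2_eq_square power_int_minus field_simps)
    have x1: "1 - x \<noteq> 0" using off_lattice_pow[OF x, of 0] by auto
    have nzm: "qpoch (q * x) q m \<noteq> 0"
      using s qpoch_nonzero[OF x, of "Suc m"] by auto
    have "P * bterm x (1 / x) (- int m) = P * (q ^ (m * m) / (qpoch (q / x) q m * qpoch (q * x) q m * qpoch_inf x q * ((1 - 1 / x) * qpoch_inf (q / x) q)))"
      unfolding bterm_neg[OF x x'] t i using x0 by simp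
    also have "\<dots> = q ^ (m * m) / (qpoch (q / x) q m * qpoch (q * x) q m * (1 - 1 / x))"
      using P by (simp add: P_def)
    also have "1 - 1 / x = - (1 - x) / x" using x0 by (simp add: field_simps)
    finally show ?thesis
      unfolding e u_def s[symmetric] using x0 x1 nzm qpoch_nonzero[OF x'', of m]
      by (simp add: field_simps)
  qed
  from has_sum_int_split[OF *] have s1: "summable v" and s2: "summable (\<lambda>m. - x * u m)"
    and s3: "P * bilateral x (1 / x) = (\<Sum>n. v n) + (\<Sum>m. - x * u m)"
    by (simp_all only: vn un)
  show su: "summable u" using summable_mult[OF s2, of "- 1 / x"] x0 by simp
  have "(\<Sum>m. - x * u m) = - x * (\<Sum>m. u m)" by (rule suminf_mult[OF su])
  then show "qpoch_inf x q * qpoch_inf (q / x) q * bilateral x (1 / x) = (\<Sum>n. v n) - x * (\<Sum>m. u m)"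
    using s3 by (simp add: P_def)
qed

text \<open>The termwise difference of the series on the right and of \<open>x g3\<close>
  telescopes: it is \<open>w n - w (Suc n)\<close>, where \<open>w\<close> starts at 1 and tends to
  0. The subtracted 1 is this initial value.\<close>

lemma g3_eq:
  assumes x: "off_lattice x"
  shows "x * g3 x q = (\<Sum>m. q ^ (m * m) / (qpoch x q (Suc m) * qpoch (q / x) q m)) - 1"
proof -
  note x0 = off_lattice_nz[OF x] and x'' = off_lattice_q_div[OF x]
  define u where "u = (\<lambda>m. q ^ (m * m) / (qpoch x q (Suc m) * qpoch (q / x) q m))"
  define g where "g = (\<lambda>n. q ^ (Suc n * (Suc n - 1)) / (qpoch x q (Suc n) * qpoch (q / x) q (Suc n)))"
  define w where "w = (\<lambda>n. q ^ (n * n) / (qpoch x q n * qpoch (q / x) q n))"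
  have su: "summable u" unfolding u_def by (rule bilateral_split(1)[OF x])
  have "w \<longlonglongrightarrow> 0 / (qpoch_inf x q * qpoch_inf (q / x) q)"
    unfolding w_def
  proof (intro tendsto_intros qpoch_LIMSEQ)
    show "(\<lambda>n. q ^ (n * n)) \<longlonglongrightarrow> 0"
      using summable_LIMSEQ_zero[OF summable_norm_cancel[OF summable_square_powers[of 1]]] by simp
  qed (use qpoch_inf_nonzero[OF x] qpoch_inf_nonzero[OF x''] in simp)
  then have "w \<longlonglongrightarrow> 0" by simp
  from telescope_sums'[OF this] have ws: "(\<lambda>n. w n - w (Suc n)) sums 1"
    by (simp add: w_def)
  have "u n - (w n - w (Suc n)) = x * g n" for n
  proof -
    define R where "R = qpoch x q n * qpoch (q / x) q n"
    define Q where "Q = q ^ n"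
    have R: "R \<noteq> 0" using qpoch_nonzero[OF x] qpoch_nonzero[OF x''] by (simp add: R_def)
    have a: "1 - x * Q \<noteq> 0" "1 - q / x * Q \<noteq> 0"
      using off_lattice_pow[OF x, of n] off_lattice_pow[OF x'', of n] by (auto simp: Q_def)
    have un: "u n = q ^ (n * n) / (R * (1 - x * Q))"
      by (simp add: u_def R_def Q_def qpoch_Suc mult_ac)
    have gn: "g n = q ^ (n * n) * Q / (R * (1 - x * Q) * (1 - q / x * Q))"
      by (simp add: g_def R_def Q_def qpoch_Suc power_add mult_ac)
    have wn: "w n = q ^ (n * n) / R" by (simp add: w_def R_def)
    have wn': "w (Suc n) = q ^ (n * n) * Q * Q * q / (R * (1 - x * Q) * (1 - q / x * Q))"
      by (simp add: w_def R_def Q_def qpoch_Suc power_add mult_ac)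
    have a': "x - q * Q \<noteq> 0" using a(2) x0 by (auto simp: field_simps)
    have d: "1 - q / x * Q = (x - q * Q) / x" using x0 by (simp add: field_simps)
    show ?thesis
      unfolding un gn wn wn' d using R a(1) a' x0
      by (simp add: divide_simps) (simp add: algebra_simps)
  qed
  then have "(\<lambda>n. x * g n) sums ((\<Sum>n. u n) - 1)"
    using sums_diff[OF summable_sums[OF su] ws] by simp
  then have "(\<lambda>n. (1 / x) * (x * g n)) sums ((1 / x) * ((\<Sum>n. u n) - 1))"
    by (rule sums_mult)
  then have "g sums ((1 / x) * ((\<Sum>n. u n) - 1))" using x0 by simp
  then show ?thesis
    using x0 by (simp add: sums_iff g3_def g_def u_def)
qed

text \<open>For \<open>y = 1 / x\<close> and \<open>s^2 = q\<close> one has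
  \<open>y s = q / (x s)\<close> and \<open>x s y = s\<close>. Reflection then identifies the two
  shifted theta factors, and the theta quotient of \<open>bilateral_shift\<close> acquires the
  squares of \<open>theta_part\<close>; the sign comes from \<open>jtheta_inverse\<close>.\<close>

lemma g3_minus_theta_part:
  assumes x: "off_lattice x" and xs: "off_lattice (x * s)" and s: "s\<^sup>2 = q"
  shows "g3 x q - theta_part x q s = - (1 / x)
    + (\<Sum>n. qpoch (q / x) q n * qpoch x q (Suc n) * q ^ Suc n) / x\<^sup>2
    - s * (qpoch_inf x q * qpoch_inf (q / x) q * bilateral (x * s) (s / x)) / x\<^sup>2"
proof -
  note x0 = off_lattice_nz[OF x] and x' = off_lattice_inverse[OF x]
  have s0: "s \<noteq> 0" using s by auto
  have sx: "s / x = q / (x * s)" using s0 by (simp add: s[symmetric] power2_eq_square)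
  have xs': "off_lattice (1 / x * s)" using off_lattice_q_div[OF xs] by (simp add: sx)
  define P where "P = qpoch_inf x q * qpoch_inf (q / x) q"
  define V where "V = (\<Sum>n. qpoch (q / x) q n * qpoch x q (Suc n) * q ^ Suc n)"
  define U where "U = (\<Sum>m. q ^ (m * m) / (qpoch x q (Suc m) * qpoch (q / x) q m))"
  define J where "J = jtheta x q"
  define B where "B = bilateral (x * s) (s / x)"
  have J: "J \<noteq> 0" unfolding J_def by (rule jtheta_nonzero[OF x])
  have PJ: "P = J / qpoch_inf q q" by (simp add: P_def J_def jtheta_def)
  have g: "g3 x q = (U - 1) / x"
    using g3_eq[OF x] x0 by (simp add: U_def field_simps)
  have 1: "P * bilateral x (1 / x) = V - x * U"
    unfolding P_def V_def U_def by (rule bilateral_split(2)[OF x])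
  have j1: "jtheta (1 / x) q = - J / x" by (simp add: J_def jtheta_inverse[OF x0])
  have j2: "jtheta (1 / x * s) q = jtheta (x * s) q" using jtheta_reflect[of "x * s"] by (simp add: sx)
  have "bilateral x (1 / x) - s * B = (qpoch_inf q q) ^ 3 * jtheta s q * jtheta s q /
      (J * (- J / x) * jtheta (x * s) q * jtheta (x * s) q)"
    using bilateral_shift[OF x x' xs xs'] x0 unfolding j1 j2 by (simp add: B_def J_def)
  note e = this
  have "P * (bilateral x (1 / x) - s * B) = - x\<^sup>2 * theta_part x q s"
    unfolding e PJ theta_part_def J_def[symmetric]
    using J x0 jtheta_nonzero[OF xs] by (simp add: power2_eq_square power3_eq_cube field_simps)
  then have "V - x * U - s * (P * B) = - x\<^sup>2 * theta_part x q s"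
    using 1 by (simp add: algebra_simps)
  then have "theta_part x q s = (x * U - V + s * (P * B)) / x\<^sup>2"
    using x0 by (simp add: field_simps)
  note th = this
  show ?thesis
    unfolding g V_def[symmetric] P_def[symmetric] B_def[symmetric] th
    using x0 by (simp add: field_simps power2_eq_square)
qed

text \<open>Each half is dominated by a geometric series in \<open>norm q\<close>. On the right the
  denominators are two infinite products, hence \<open>c^2\<close>; on the left they are two finite
  and two infinite ones, hence \<open>c^4\<close>. The relation \<open>x y = q\<close> turns
  \<open>q / x\<close> into \<open>y\<close>, so the finite products on the left are covered by the
  same bounds.\<close>

lemma bilateral_bound:
  assumes x: "off_lattice x" and y: "off_lattice y" and xy: "x * y = q" and c: "c > 0"
    and b: "\<And>n. c \<le> norm (qpoch x q n)" "\<And>n. c \<le> norm (qpoch y q n)"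
      "\<And>n. c \<le> norm (qpoch_inf (x * q ^ n) q)" "\<And>n. c \<le> norm (qpoch_inf (y * q ^ n) q)"
  shows "norm (bilateral x y) \<le> (1 / c\<^sup>2 + 1 / c ^ 4) / (1 - norm q)"
proof -
  note x0 = off_lattice_nz[OF x] and y0 = off_lattice_nz[OF y]
  note * = has_sum_int_split[OF bterm_has_sum[OF x y]]
  have geo: "(\<lambda>n. C * norm q ^ n) sums (C * (1 / (1 - norm q)))" for C
    using q_lt by (intro sums_mult geometric_sums) simp
  have bound: "norm (\<Sum>n. f n) \<le> C / (1 - norm q)" if "\<And>n. norm (f n) \<le> C * norm q ^ n" for f :: "nat \<Rightarrow> complex" and C
  proof -
    have sn: "summable (\<lambda>n. norm (f n))"
      by (rule summable_comparison_test'[OF sums_summable[OF geo[of C]]]) (use that in auto)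
    have "norm (\<Sum>n. f n) \<le> (\<Sum>n. norm (f n))" by (rule summable_norm[OF sn])
    also have "\<dots> \<le> (\<Sum>n. C * norm q ^ n)"
      by (rule suminf_le[OF that sn sums_summable[OF geo]])
    also have "\<dots> = C / (1 - norm q)" using sums_unique[OF geo[of C]] by simp
    finally show ?thesis .
  qed
  have "norm (\<Sum>n. bterm x y (int n)) \<le> (1 / c\<^sup>2) / (1 - norm q)"
  proof (rule bound)
    fix n
    have "norm (bterm x y (int n)) = norm q ^ n / (norm (qpoch_inf (x * q ^ n) q) * norm (qpoch_inf (y * q ^ n) q))"
      by (simp add: bterm_def norm_divide norm_mult norm_power)
    also have "\<dots> \<le> norm q ^ n / (c * c)"
      using c b(3,4)[of n] by (intro divide_left_mono mult_mono mult_pos_pos less_le_trans[OF c]) auto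
    finally show "norm (bterm x y (int n)) \<le> 1 / c\<^sup>2 * norm q ^ n"
      by (simp add: power2_eq_square)
  qed
  moreover have "norm (\<Sum>n. bterm x y (- int n - 1)) \<le> (1 / c ^ 4) / (1 - norm q)"
  proof (rule bound)
    fix n
    have e: "- int n - 1 = - int (Suc n)" by simp
    have qx: "q / x = y" "q / y = x" using xy x0 y0 by (auto simp: field_simps)
    have "(qtri q (int (Suc n) + 1))\<^sup>2 = q powi (int (Suc n) * int (Suc n) + int (Suc n))"
      using qtri_square[OF q_nz, of "int (Suc n) + 1"] by (simp add: power2_eq_square algebra_simps)
    then have "q powi (- int (Suc n)) * (qtri q (int (Suc n) + 1))\<^sup>2 = q powi (int (Suc n) * int (Suc n))"
      by (simp only: power_int_add[OF disjI1[OF q_nz], symmetric]) simp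
    also have "\<dots> = q ^ (n * Suc n) * q ^ Suc n"
      by (simp only: power_int_of_nat of_nat_mult[symmetric] power_add[symmetric]) (simp add: algebra_simps)
    finally have t: "q powi (- int (Suc n)) * (qtri q (int (Suc n) + 1))\<^sup>2 = q ^ (n * Suc n) * q ^ Suc n" .
    have "bterm x y (- int n - 1) = q ^ (n * Suc n) / (qpoch y q (Suc n) * qpoch x q (Suc n) * qpoch_inf x q * qpoch_inf y q)"
      unfolding e bterm_neg[OF x y] t xy qx by (simp del: power_Suc)
    then have "norm (bterm x y (- int n - 1)) = norm q ^ (n * Suc n) / (norm (qpoch y q (Suc n)) * norm (qpoch x q (Suc n)) * norm (qpoch_inf x q) * norm (qpoch_inf y q))"
      by (simp add: norm_divide norm_mult norm_power)
    also have "\<dots> \<le> norm q ^ (n * Suc n) / (c * c * c * c)"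
      using c b(1)[of "Suc n"] b(2)[of "Suc n"] b(3)[of 0] b(4)[of 0]
      by (intro divide_left_mono mult_mono mult_pos_pos less_le_trans[OF c]) auto
    also have "\<dots> \<le> norm q ^ n / (c * c * c * c)"
      using c q_lt by (intro divide_right_mono power_decreasing) auto
    finally show "norm (bterm x y (- int n - 1)) \<le> 1 / c ^ 4 * norm q ^ n"
      by (simp add: power4_eq_xxxx)
  qed
  ultimately show ?thesis
    unfolding *(3) using norm_triangle_ineq[of "\<Sum>n. bterm x y (int n)" "\<Sum>n. bterm x y (- int n - 1)"]
    by (simp add: add_divide_distrib)
qed

end

subsection \<open>q-products near a root of unity\<close>

text \<open>Factors are exchanged one at a time; each exchange costs \<open>d\<close> times a
  product of the other factors.\<close>

lemma norm_prod_diff_le: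
  fixes a b :: "nat \<Rightarrow> complex"
  assumes "\<And>i. i < m \<Longrightarrow> norm (a i) \<le> M" "\<And>i. i < m \<Longrightarrow> norm (b i) \<le> M"
    "\<And>i. i < m \<Longrightarrow> norm (a i - b i) \<le> d" "M \<ge> 1"
  shows "norm ((\<Prod>i<m. a i) - (\<Prod>i<m. b i)) \<le> of_nat m * M ^ m * d"
  using assms
proof (induction m)
  case (Suc m)
  define A where "A = (\<Prod>i<m. a i)"
  define B where "B = (\<Prod>i<m. b i)"
  have d: "d \<ge> 0" using Suc.prems(3)[of 0] norm_ge_zero order_trans by blast
  have IH: "norm (A - B) \<le> of_nat m * M ^ m * d"
    unfolding A_def B_def by (rule Suc.IH) (use Suc.prems in auto)
  have "norm A \<le> M ^ m"
    unfolding A_def prod_norm[symmetric]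
    using prod_le_power[of "{..<m}" "\<lambda>i. norm (a i)" M m] Suc.prems by simp
  moreover have "M ^ m \<le> M ^ Suc m" using Suc.prems(4) by (intro power_increasing) auto
  ultimately have A: "norm A \<le> M ^ Suc m" by linarith
  have "A * a m - B * b m = A * (a m - b m) + (A - B) * b m"
    by (simp add: algebra_simps)
  then have "norm (A * a m - B * b m) \<le> norm A * norm (a m - b m) + norm (A - B) * norm (b m)"
    using norm_triangle_ineq[of "A * (a m - b m)" "(A - B) * b m"] by (simp add: norm_mult)
  also have "\<dots> \<le> M ^ Suc m * d + (of_nat m * M ^ m * d) * M"
    by (intro add_mono mult_mono A IH) (use Suc.prems d in auto)
  finally show ?case by (simp add: A_def B_def algebra_simps)
qed simp

lemma norm_one_minus_power_le:
  fixes v :: real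
  assumes "0 \<le> v" "v \<le> 2"
  shows "\<bar>1 - v ^ m\<bar> \<le> of_nat m * 2 ^ m * \<bar>1 - v\<bar>"
proof -
  have "norm ((\<Prod>i<m. complex_of_real 1) - (\<Prod>i<m. complex_of_real v)) \<le> of_nat m * 2 ^ m * \<bar>1 - v\<bar>"
    by (rule norm_prod_diff_le) (use assms in \<open>auto simp del: of_real_1 simp flip: of_real_diff\<close>)
  moreover have "(\<Prod>i<m. complex_of_real 1) - (\<Prod>i<m. complex_of_real v) = complex_of_real (1 - v ^ m)"
    by simp
  ultimately show ?thesis by (simp only: norm_of_real)
qed

text \<open>Converts the halving over about \<open>\<eta> / \<epsilon>\<close> blocks into a factor
  of order \<open>\<epsilon>^2\<close>.\<close>

lemma square_le_two_power: "real n ^ 2 \<le> 4 * 2 ^ n"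
proof (induction n rule: less_induct)
  case (less n)
  show ?case
  proof (cases "n < 4")
    case True
    then have "n = 0 \<or> n = 1 \<or> n = 2 \<or> n = 3" by auto
    then show ?thesis by auto
  next
    case False
    define k where "k = n - 1"
    have n: "n = Suc k" "k \<ge> 3" using False by (auto simp: k_def)
    have "(real k + 1)\<^sup>2 \<le> 2 * (real k)\<^sup>2"
    proof -
      have "0 \<le> (real k - 1)\<^sup>2 - 2"
        using n(2) power_mono[of 2 "real k - 1" 2] by simp
      then show ?thesis by (simp add: power2_eq_square algebra_simps)
    qed
    moreover have "real n = real k + 1" "(2::real) ^ n = 2 * 2 ^ k" "(real k)\<^sup>2 \<le> 4 * 2 ^ k"
      using less.IH[of k] n by simp_all
    ultimately show ?thesis by simp
  qed
qed

lemma qpoch_blocks: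
  "qpoch y Q (m * J + r) = (\<Prod>j<J. qpoch (y * Q ^ (m * j)) Q m) * qpoch (y * Q ^ (m * J)) Q r"
proof -
  have "qpoch y Q (m * J) = (\<Prod>j<J. qpoch (y * Q ^ (m * j)) Q m)"
    by (induction J) (simp_all add: qpoch_add add.commute[of m])
  then show ?thesis by (simp add: qpoch_add)
qed

text \<open>Allows the radial parameter \<open>t\<close> to be bounded by a multiple of
  \<open>\<epsilon> = 1 - exp (- \<beta> * t)\<close>.\<close>

lemma exp_minus_le_half:
  fixes u :: real
  assumes "0 \<le> u" "u \<le> 1"
  shows "u / 2 \<le> 1 - exp (- u)"
proof -
  have "1 \<le> (1 + u) * (1 - u / 2)"
    using mult_left_mono[OF assms(2,1)] by (simp add: algebra_simps)
  also have "\<dots> \<le> exp u * (1 - u / 2)"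
    using exp_ge_add_one_self[of u] assms by (intro mult_right_mono) auto
  finally have "exp (- u) * 1 \<le> exp (- u) * (exp u * (1 - u / 2))"
    by (intro mult_left_mono) auto
  also have "exp (- u) * (exp u * (1 - u / 2)) = 1 - u / 2"
    by (simp add: exp_minus)
  finally show ?thesis by simp
qed

text \<open>The error \<open>\<epsilon>^2\<close> in the decay estimate does not shrink with
  \<open>n\<close>. Damped by the power of the nome it is bounded, uniformly in
  \<open>\<epsilon>\<close>, by a summable sequence; a first power would give only the harmonic
  series.\<close>

lemma square_mult_power_le:
  fixes \<epsilon> :: real
  assumes "0 < \<epsilon>" "\<epsilon> < 1" "0 < N"
  shows "\<epsilon>\<^sup>2 * (1 - \<epsilon>) ^ N \<le> 2 / (real N)\<^sup>2"
proof -
  have "(1 - \<epsilon>) ^ N \<le> exp (- \<epsilon>) ^ N"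
    using exp_ge_add_one_self[of "- \<epsilon>"] assms by (intro power_mono) auto
  also have "\<dots> = 1 / exp (real N * \<epsilon>)"
    by (simp add: exp_of_nat_mult[symmetric] exp_minus field_simps)
  also have "\<dots> \<le> 1 / ((real N * \<epsilon>)\<^sup>2 / 2)"
  proof (rule divide_left_mono)
    have "0 \<le> real N * \<epsilon>" using assms by simp
    then show "(real N * \<epsilon>)\<^sup>2 / 2 \<le> exp (real N * \<epsilon>)"
      using exp_lower_Taylor_quadratic[of "real N * \<epsilon>"] by linarith
  qed (use assms in simp_all)
  finally have "\<epsilon>\<^sup>2 * (1 - \<epsilon>) ^ N \<le> \<epsilon>\<^sup>2 * (1 / ((real N * \<epsilon>)\<^sup>2 / 2))"
    by (intro mult_left_mono) auto
  also have "\<dots> = 2 / (real N)\<^sup>2" using assms by (simp add: power_mult_distrib)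
  finally show ?thesis .
qed

section \<open>Blocks of factors at a primitive root of unity\<close>

locale unity_root =
  fixes m :: nat and w :: complex
  assumes m_pos: "0 < m" and w_root: "w ^ m = 1" and w_prim: "\<And>i. 0 < i \<Longrightarrow> i < m \<Longrightarrow> w ^ i \<noteq> 1"
begin

lemma norm_w [simp]: "norm w = 1"
proof -
  have "norm w ^ m = 1 ^ m" using arg_cong[OF w_root, of norm] by (simp add: norm_power)
  then show ?thesis using power_eq_iff_eq_base[of m "norm w" 1] m_pos by simp
qed

text \<open>Both sides are polynomials of degree at most \<open>m\<close> that agree at
  \<open>m + 1\<close> points: the \<open>m\<close> distinct powers of the inverse root, where both
  vanish, and 0, which fixes the scaling.\<close>

lemma qpoch_root: "qpoch u w m = 1 - u ^ m"
proof -
  define p where "p = (\<Prod>i<m. [:1, - (w ^ i):])"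
  define r where "r = 1 - Polynomial.monom (1::complex) m"
  define S where "S = insert 0 ((\<lambda>i. inverse w ^ i) ` {..<m})"
  have w0: "w \<noteq> 0" using norm_w by force
  have inj: "inj_on (\<lambda>i. inverse w ^ i) {..<m}"
  proof (rule linorder_inj_onI)
    fix i j assume ij: "i < j" "i \<in> {..<m}" "j \<in> {..<m}"
    show "inverse w ^ i \<noteq> inverse w ^ j"
    proof
      assume "inverse w ^ i = inverse w ^ j"
      then have "w ^ i = w ^ j" by (simp add: power_inverse)
      then have "w ^ (j - i) = 1" using ij w0 by (simp add: power_diff)
      moreover have "0 < j - i" "j - i < m" using ij by auto
      ultimately show False using w_prim by blast
    qed
  qed auto
  have "card S = Suc (card ((\<lambda>i. inverse w ^ i) ` {..<m}))"
    unfolding S_def using w0 by (intro card_insert_disjoint) auto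
  then have card: "card S = Suc m" by (simp add: card_image[OF inj])
  have dp: "degree p \<le> m"
  proof -
    have "degree p \<le> (\<Sum>i<m. degree [:1, - (w ^ i):])"
      unfolding p_def using degree_prod_sum_le[of "{..<m}" "\<lambda>i. [:1, - (w ^ i):]"] by (simp add: o_def)
    also have "\<dots> \<le> (\<Sum>i<m. 1)" by (intro sum_mono) (simp add: degree_pCons_le)
    finally show ?thesis by simp
  qed
  have dr: "degree r \<le> m"
    unfolding r_def by (intro degree_diff_le) (auto simp: degree_monom_le)
  have "p = r"
  proof (rule poly_eqI_degree[of S])
    fix z assume "z \<in> S"
    then consider "z = 0" | i where "i < m" "z = inverse w ^ i" by (auto simp: S_def)
    then show "poly p z = poly r z"
    proof cases
      case 1
      then show ?thesis using m_pos by (simp add: p_def r_def poly_prod poly_monom)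
    next
      case 2
      have "poly p z = 0"
        unfolding p_def poly_prod using 2 w0 by (auto simp: power_inverse intro!: prod_zero bexI[of _ i])
      moreover have "z ^ m = 1"
      proof -
        have "(w ^ i) ^ m = (w ^ m) ^ i" by (simp add: mult.commute flip: power_mult)
        then show ?thesis using 2 by (simp add: power_inverse w_root)
      qed
      ultimately show ?thesis by (simp add: r_def poly_monom)
    qed
  qed (use dp dr card in auto)
  then have "poly p u = poly r u" by simp
  then show ?thesis
    by (simp add: p_def r_def poly_prod poly_monom qpoch_def)
qed

lemma one_minus_power_le:
  fixes p :: real
  assumes "0 \<le> p" "p \<le> 1"
  shows "1 - p ^ n \<le> of_nat n * (1 - p)"
  using Bernoulli_inequality[of "p - 1" n] assms by (simp add: algebra_simps)

text \<open>The factor \<open>norm u\<close> is essential: the leading arguments of successive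
  blocks decay geometrically, so by \<open>sum_block_sizes\<close> the errors add up to a bound that
  does not depend on \<open>\<epsilon>\<close>.\<close>

lemma block_estimate:
  assumes "norm u \<le> 2" "0 < \<epsilon>" "\<epsilon> < 1"
  shows "norm (qpoch u (w * of_real (1 - \<epsilon>)) m - (1 - u ^ m)) \<le> real m ^ 2 * 3 ^ m * \<epsilon> * norm u"
proof -
  have "norm ((\<Prod>i<m. 1 - u * (w * of_real (1 - \<epsilon>)) ^ i) - (\<Prod>i<m. 1 - u * w ^ i))
      \<le> of_nat m * 3 ^ m * (norm u * (real m * \<epsilon>))"
  proof (rule norm_prod_diff_le)
    fix i assume i: "i < m"
    have p: "(1 - \<epsilon>) ^ i \<le> 1" "0 \<le> (1 - \<epsilon>) ^ i" using assms by (auto simp: power_le_one)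
    have "norm (complex_of_real (1 - \<epsilon>)) = 1 - \<epsilon>" using assms by (simp only: norm_of_real)
    then have "norm (u * (w * of_real (1 - \<epsilon>)) ^ i) = norm u * (1 - \<epsilon>) ^ i"
      by (simp only: norm_mult norm_power norm_w mult_1_left)
    also have "\<dots> \<le> 2 * 1" by (intro mult_mono) (use assms p in auto)
    finally show "norm (1 - u * (w * of_real (1 - \<epsilon>)) ^ i) \<le> 3"
      using norm_triangle_ineq4[of 1 "u * (w * of_real (1 - \<epsilon>)) ^ i"] by simp
    show "norm (1 - u * w ^ i) \<le> 3"
      using norm_triangle_ineq4[of 1 "u * w ^ i"] assms by (simp add: norm_mult norm_power)
    have "1 - u * (w * of_real (1 - \<epsilon>)) ^ i - (1 - u * w ^ i) = u * w ^ i * of_real (1 - (1 - \<epsilon>) ^ i)"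
    proof -
      have "1 - u * (w * c) ^ i - (1 - u * w ^ i) = u * w ^ i * (1 - c ^ i)" for c
        by (simp add: power_mult_distrib algebra_simps)
      then show ?thesis by (simp only: of_real_diff of_real_power of_real_1)
    qed
    then have "norm (1 - u * (w * of_real (1 - \<epsilon>)) ^ i - (1 - u * w ^ i)) = norm u * \<bar>1 - (1 - \<epsilon>) ^ i\<bar>"
      by (simp only: norm_mult norm_power norm_w norm_of_real power_one mult_1_right)
    also have "\<dots> \<le> norm u * (real m * \<epsilon>)"
    proof (intro mult_left_mono)
      have "1 - (1 - \<epsilon>) ^ i \<le> real i * \<epsilon>"
        using one_minus_power_le[of "1 - \<epsilon>" i] assms by simp
      also have "\<dots> \<le> real m * \<epsilon>" using i assms by simp
      finally show "\<bar>1 - (1 - \<epsilon>) ^ i\<bar> \<le> real m * \<epsilon>" using p by simp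
    qed simp
    finally show "norm (1 - u * (w * of_real (1 - \<epsilon>)) ^ i - (1 - u * w ^ i)) \<le> norm u * (real m * \<epsilon>)" .
  qed simp
  then show ?thesis
    unfolding qpoch_root[of u, symmetric] by (simp add: qpoch_def power2_eq_square mult_ac)
qed

lemma power_nome: "(w * of_real p) ^ (m * j) = of_real (p ^ (m * j))"
  using w_root by (simp add: power_mult_distrib power_mult[of w])

lemma sum_block_sizes:
  fixes \<epsilon> :: real
  assumes "0 < \<epsilon>" "\<epsilon> < 1"
  shows "(\<Sum>j<J. \<epsilon> * (1 - \<epsilon>) ^ (m * j)) \<le> 1"
proof -
  have "(\<Sum>j<J. \<epsilon> * (1 - \<epsilon>) ^ (m * j)) \<le> (\<Sum>j<J. \<epsilon> * (1 - \<epsilon>) ^ j)"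
    by (intro sum_mono mult_left_mono power_decreasing) (use assms m_pos in auto)
  also have "\<dots> = 1 - (1 - \<epsilon>) ^ J"
    using assms by (simp add: sum_gp_strict sum_distrib_left[symmetric])
  also have "\<dots> \<le> 1" using assms by simp
  finally show ?thesis .
qed

lemma norm_qpoch_le_power:
  assumes "norm y \<le> 2" "norm Q \<le> 1"
  shows "norm (qpoch y Q r) \<le> 3 ^ r"
proof -
  have "norm (1 - y * Q ^ j) \<le> 3" for j
  proof -
    have "norm (y * Q ^ j) \<le> 2 * 1"
      unfolding norm_mult by (intro mult_mono) (use assms in \<open>auto simp: norm_power power_le_one\<close>)
    then show ?thesis using norm_triangle_ineq4[of 1 "y * Q ^ j"] by simp
  qed
  then show ?thesis
    unfolding qpoch_def prod_norm[symmetric]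
    using prod_le_power[of "{..<r}" "\<lambda>j. norm (1 - y * Q ^ j)" 3 r] by simp
qed

text \<open>A block of \<open>m\<close> consecutive factors is \<open>1 - v\<^sup>m\<close> up to an error \<open>O(\<epsilon> v)\<close>, with \<open>v\<close> the
  modulus of its leading argument. These errors multiply to a bounded factor, and each of the first
  \<open>\<eta> / \<epsilon>\<close> blocks is at most \<open>1 / 2\<close>.\<close>
lemma qpoch_decay:
  assumes \<kappa>: "\<kappa> \<ge> 0"
  obtains C \<delta> \<epsilon>0 where "0 < C" "0 < \<delta>" "\<delta> < 1" "0 < \<epsilon>0" "\<epsilon>0 < 1"
    "\<And>\<epsilon> y n. 0 < \<epsilon> \<Longrightarrow> \<epsilon> < \<epsilon>0 \<Longrightarrow> y ^ m = of_real (norm y ^ m) \<Longrightarrow>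
      1 - \<kappa> * \<epsilon> \<le> norm y \<Longrightarrow> norm y \<le> 1 + \<kappa> * \<epsilon> \<Longrightarrow>
      norm (qpoch y (w * of_real (1 - \<epsilon>)) n) \<le> C * (\<delta> ^ n + \<epsilon>\<^sup>2)"
proof -
  \<comment> \<open>\<open>K\<close> and \<open>M\<close> are the constants of
    \<open>block_estimate\<close> and \<open>norm_one_minus_power_le\<close>. \<open>\<eta>\<close>
    is chosen to make \<open>2 m \<eta> M = 1/4\<close>, and \<open>\<epsilon>0\<close> to make
    \<open>M \<kappa> \<epsilon> + 2 K \<epsilon>\<close> at most \<open>1/4\<close>; together they
    bound an early block by \<open>1/2\<close>.\<close>
  define K where "K = real m ^ 2 * 3 ^ m"
  define M where "M = real m * 2 ^ m"
  define K2 where "K2 = K + M * \<kappa>"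
  define \<eta> where "\<eta> = 1 / (8 * M * real m)"
  define \<epsilon>0 where "\<epsilon>0 = 1 / (4 * (M * \<kappa> + 2 * K + \<kappa> + 1))"
  define \<delta> where "\<delta> = root m (1 / 2)"
  have K0: "K > 0" and M0: "M > 0" using m_pos by (auto simp: K_def M_def)
  have K2: "K2 > 0" using K0 M0 \<kappa> by (auto simp: K2_def intro!: add_pos_nonneg)
  have \<eta>: "\<eta> > 0" using M0 m_pos by (simp add: \<eta>_def)
  have pos: "M * \<kappa> + 2 * K + \<kappa> + 1 \<ge> 1" using K0 M0 \<kappa> by simp
  then have e0: "0 < \<epsilon>0" "\<epsilon>0 < 1" by (auto simp: \<epsilon>0_def field_simps)
  have \<delta>m: "\<delta> ^ m = 1 / 2" using m_pos by (simp add: \<delta>_def)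
  have \<delta>: "0 < \<delta>" "\<delta> < 1" using m_pos by (auto simp: \<delta>_def)
  define C where "C = 3 ^ m * exp (2 * K2) * (2 + 4 / \<eta>\<^sup>2)"
  have C: "C > 0" using \<eta> by (auto simp: C_def intro!: mult_pos_pos add_pos_nonneg)
  have main: "norm (qpoch y (w * of_real (1 - \<epsilon>)) n) \<le> C * (\<delta> ^ n + \<epsilon>\<^sup>2)"
    if e: "0 < \<epsilon>" "\<epsilon> < \<epsilon>0" and y: "y ^ m = of_real (norm y ^ m)" "1 - \<kappa> * \<epsilon> \<le> norm y" "norm y \<le> 1 + \<kappa> * \<epsilon>"
    for \<epsilon> y n
  proof -
    define p where "p = 1 - \<epsilon>"
    define Q where "Q = w * of_real p"
    have e1: "\<epsilon> < 1" using e e0 by linarith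
    have p: "0 < p" "p < 1" using e e1 by (auto simp: p_def)
    have e4: "4 * ((M * \<kappa> + 2 * K + \<kappa> + 1) * \<epsilon>) \<le> 1"
      using e pos by (simp add: \<epsilon>0_def field_simps)
    have ke: "M * \<kappa> * \<epsilon> + 2 * K * \<epsilon> \<le> 1 / 4" "\<kappa> * \<epsilon> \<le> 1 / 4"
    proof -
      have "0 \<le> M * \<kappa> * \<epsilon> + 2 * K * \<epsilon>" "0 \<le> \<kappa> * \<epsilon>" using \<kappa> e K0 M0 by auto
      then show "M * \<kappa> * \<epsilon> + 2 * K * \<epsilon> \<le> 1 / 4" "\<kappa> * \<epsilon> \<le> 1 / 4"
        using e4 e by (auto simp: algebra_simps)
    qed
    have ny: "norm y \<le> 2" using y(3) ke(2) by linarith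
    define v where "v = (\<lambda>j. norm y * p ^ (m * j))"
    define f where "f = (\<lambda>j. norm (qpoch (y * Q ^ (m * j)) Q m))"
    have yj: "y * Q ^ (m * j) = y * of_real (p ^ (m * j))" for j
      by (simp add: Q_def power_nome)
    have nyj: "norm (y * Q ^ (m * j)) = v j" for j
      unfolding yj v_def using p by (simp add: norm_mult norm_power)
    have vy: "v j \<le> norm y" for j
      using p unfolding v_def by (intro mult_left_le) (auto simp: power_le_one)
    have v0: "0 \<le> v j" and v2: "v j \<le> 2" for j
      using p vy[of j] ny by (auto simp: v_def)
    have f_le: "f j \<le> \<bar>1 - v j ^ m\<bar> + K * \<epsilon> * v j" for j
    proof -
      define u where "u = y * Q ^ (m * j)"
      have um: "u ^ m = of_real (v j ^ m)"
        unfolding u_def yj v_def power_mult_distrib y(1) by simp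
      have "norm (qpoch u Q m) \<le> norm (1 - u ^ m) + norm (qpoch u Q m - (1 - u ^ m))"
        using norm_triangle_ineq[of "1 - u ^ m" "qpoch u Q m - (1 - u ^ m)"] by simp
      moreover have "norm (qpoch u Q m - (1 - u ^ m)) \<le> K * \<epsilon> * v j"
        using block_estimate[of u \<epsilon>] nyj[of j] v2[of j] e e1 by (simp add: u_def Q_def p_def K_def)
      moreover have "norm (1 - u ^ m) = \<bar>1 - v j ^ m\<bar>"
        unfolding um by (metis norm_of_real of_real_1 of_real_diff)
      ultimately show ?thesis by (simp add: f_def u_def)
    qed
    have pw: "\<bar>1 - v j ^ m\<bar> \<le> M * \<bar>1 - v j\<bar>" for j
      using norm_one_minus_power_le[of "v j" m, OF v0 v2] by (simp add: M_def)
    \<comment> \<open>Valid for all blocks. Below modulus 1 the main term is at most 1; above it the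
      excess is at most \<open>\<kappa> \<epsilon>\<close>, which is absorbed into the
      exponential.\<close>
    have f1: "f j \<le> exp (K2 * \<epsilon> * v j)" for j
    proof -
      have "f j \<le> 1 + K2 * \<epsilon> * v j"
      proof (cases "v j \<le> 1")
        case True
        then have "\<bar>1 - v j ^ m\<bar> \<le> 1" using v0 by (simp add: power_le_one)
        moreover have "K * \<epsilon> * v j \<le> K2 * \<epsilon> * v j"
          using \<kappa> M0 e v0 by (intro mult_right_mono) (auto simp: K2_def)
        ultimately show ?thesis using f_le[of j] by linarith
      next
        case False
        have "\<bar>1 - v j\<bar> \<le> \<kappa> * \<epsilon>" using False vy[of j] y(3) by simp
        also have "\<dots> \<le> \<kappa> * \<epsilon> * v j" 
          using mult_left_mono[of 1 "v j" "\<kappa> * \<epsilon>"] False \<kappa> e by simp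
        finally have "M * \<bar>1 - v j\<bar> \<le> M * (\<kappa> * \<epsilon> * v j)" using M0 by simp
        then have "\<bar>1 - v j ^ m\<bar> \<le> M * (\<kappa> * \<epsilon> * v j)" using pw[of j] by linarith
        then show ?thesis using f_le[of j] by (simp add: K2_def algebra_simps)
      qed
      then show ?thesis using exp_ge_add_one_self[of "K2 * \<epsilon> * v j"] by linarith
    qed
    have f2: "f j \<le> 1 / 2 * exp (K2 * \<epsilon> * v j)" if "real j * \<epsilon> \<le> \<eta>" for j
    proof -
      have "\<bar>1 - v j\<bar> \<le> \<bar>1 - norm y\<bar> + norm y * (1 - p ^ (m * j))"
      proof -
        have "1 - v j = (1 - norm y) + norm y * (1 - p ^ (m * j))" by (simp add: v_def algebra_simps)
        moreover have "0 \<le> norm y * (1 - p ^ (m * j))" using p by (simp add: power_le_one)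
        ultimately show ?thesis by linarith
      qed
      moreover have "\<bar>1 - norm y\<bar> \<le> \<kappa> * \<epsilon>" using y by auto
      moreover have "norm y * (1 - p ^ (m * j)) \<le> 2 * (real (m * j) * \<epsilon>)"
        using one_minus_power_le[of p "m * j"] p ny
        by (intro mult_mono) (auto simp: p_def power_le_one)
      ultimately have "\<bar>1 - v j\<bar> \<le> \<kappa> * \<epsilon> + 2 * real m * (real j * \<epsilon>)"
        by (simp add: mult_ac)
      also have "\<dots> \<le> \<kappa> * \<epsilon> + 2 * real m * \<eta>"
        using that by (intro add_left_mono mult_left_mono) auto
      also have "2 * real m * \<eta> = 1 / (4 * M)" using m_pos by (simp add: \<eta>_def)
      finally have "M * \<bar>1 - v j\<bar> \<le> M * (\<kappa> * \<epsilon> + 1 / (4 * M))" using M0 by simp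
      also have "\<dots> = M * \<kappa> * \<epsilon> + 1 / 4" using M0 by (simp add: algebra_simps)
      finally have "\<bar>1 - v j ^ m\<bar> \<le> M * \<kappa> * \<epsilon> + 1 / 4" using pw[of j] by linarith
      moreover have "K * \<epsilon> * v j \<le> K * \<epsilon> * 2"
        using K0 e v2 by (intro mult_left_mono) auto
      ultimately have "f j \<le> 1 / 2" using f_le[of j] ke(1) by simp
      moreover have "1 \<le> exp (K2 * \<epsilon> * v j)" using K2 e v0 by simp
      ultimately show ?thesis by linarith
    qed
    have E: "(\<Prod>j<J. exp (K2 * \<epsilon> * v j)) \<le> exp (2 * K2)" for J
    proof -
      have "(\<Sum>j<J. K2 * \<epsilon> * v j) = K2 * norm y * (\<Sum>j<J. \<epsilon> * (1 - \<epsilon>) ^ (m * j))"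
        by (simp add: v_def p_def sum_distrib_left mult_ac)
      also have "\<dots> \<le> K2 * 2 * 1"
        using K2 ny sum_block_sizes[OF e(1) e1, of J] e1 e by (intro mult_mono) (auto intro!: sum_nonneg)
      finally show ?thesis by (simp add: exp_sum[symmetric] mult.commute)
    qed
    have f0: "0 \<le> f j" for j by (simp add: f_def)
    have small: "(\<Prod>j<J. f j) \<le> exp (2 * K2) * (1 / 2) ^ J" if "\<And>j. j < J \<Longrightarrow> real j * \<epsilon> \<le> \<eta>" for J
    proof -
      have "(\<Prod>j<J. f j) \<le> (\<Prod>j<J. 1 / 2 * exp (K2 * \<epsilon> * v j))"
        by (intro prod_mono) (use f2 f0 that in auto)
      also have "\<dots> = (1 / 2) ^ J * (\<Prod>j<J. exp (K2 * \<epsilon> * v j))"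
        by (simp add: prod.distrib power_one_over prod_dividef)
      also have "\<dots> \<le> (1 / 2) ^ J * exp (2 * K2)" by (intro mult_left_mono E) simp
      finally show ?thesis by (simp add: mult.commute)
    qed
    have blocks: "(\<Prod>j<J. f j) \<le> exp (2 * K2) * ((1 / 2) ^ J + 4 / \<eta>\<^sup>2 * \<epsilon>\<^sup>2)" for J
    proof (cases "real J * \<epsilon> \<le> \<eta>")
      case True
      have "real j * \<epsilon> \<le> \<eta>" if "j < J" for j
      proof -
        have "real j * \<epsilon> \<le> real J * \<epsilon>" using that e by simp
        then show ?thesis using True by linarith
      qed
      then have "(\<Prod>j<J. f j) \<le> exp (2 * K2) * (1 / 2) ^ J" by (rule small)
      also have "\<dots> \<le> exp (2 * K2) * ((1 / 2) ^ J + 4 / \<eta>\<^sup>2 * \<epsilon>\<^sup>2)"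
        by (intro mult_left_mono) auto
      finally show ?thesis .
    next
      case False
      \<comment> \<open>The number of blocks known to be at most \<open>1/2\<close>, up to their
        exponential correction. It exceeds \<open>\<eta> / \<epsilon>\<close>, so
        \<open>(1/2)^N \<le> 4 / N^2\<close> is of order \<open>\<epsilon>^2\<close>, however large
        \<open>J\<close> is.\<close>
      define N where "N = nat \<lfloor>\<eta> / \<epsilon>\<rfloor> + 1"
      have N1: "real N > \<eta> / \<epsilon>" unfolding N_def using \<eta> e by (simp add: of_nat_nat) linarith
      have N2: "real j * \<epsilon> \<le> \<eta>" if "j < N" for j
      proof -
        have "0 \<le> \<lfloor>\<eta> / \<epsilon>\<rfloor>" using \<eta> e by simp
        then have "int j \<le> \<lfloor>\<eta> / \<epsilon>\<rfloor>" using that unfolding N_def by linarith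
        then have "real j \<le> \<eta> / \<epsilon>" by (simp add: le_floor_iff)
        then show ?thesis using e by (simp add: field_simps)
      qed
      have NJ: "N \<le> J"
      proof (rule ccontr)
        assume "\<not> N \<le> J"
        then show False using N2[of J] False by simp
      qed
      have "(\<Prod>j<J. f j) \<le> (\<Prod>j<J. (if j < N then 1 / 2 else 1) * exp (K2 * \<epsilon> * v j))"
        by (intro prod_mono) (use f1 f2 f0 N2 in auto)
      also have "\<dots> = (\<Prod>j<J. if j < N then 1 / 2 else 1) * (\<Prod>j<J. exp (K2 * \<epsilon> * v j))"
        by (rule prod.distrib)
      also have "(\<Prod>j<J. if j < N then 1 / 2 else 1) = (1 / 2 :: real) ^ N"
      proof -
        have "(\<Prod>j<J. if j < N then 1 / 2 else (1 :: real)) = (\<Prod>j<N. 1 / 2)"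
          by (rule prod.mono_neutral_cong_right) (use NJ in auto)
        then show ?thesis by simp
      qed
      also have "(1 / 2) ^ N * (\<Prod>j<J. exp (K2 * \<epsilon> * v j)) \<le> (1 / 2) ^ N * exp (2 * K2)"
        by (intro mult_left_mono E) simp
      also have "(1 / 2) ^ N \<le> 4 / \<eta>\<^sup>2 * \<epsilon>\<^sup>2"
      proof -
        have "0 < \<eta> / \<epsilon>" using \<eta> e by simp
        then have "(\<eta> / \<epsilon>)\<^sup>2 \<le> (real N)\<^sup>2" using N1 by (intro power_mono) auto
        also have "\<dots> \<le> 4 * 2 ^ N" by (rule square_le_two_power)
        finally show ?thesis using \<eta> e by (simp add: field_simps power_one_over)
      qed
      then have "(1 / 2) ^ N * exp (2 * K2) \<le> exp (2 * K2) * ((1 / 2) ^ J + 4 / \<eta>\<^sup>2 * \<epsilon>\<^sup>2)"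
        by (simp add: mult.commute add_increasing)
      finally show ?thesis .
    qed
    define J where "J = n div m"
    define r where "r = n mod m"
    have n: "n = m * J + r" and r: "r < m" using m_pos by (auto simp: J_def r_def)
    have "norm (qpoch y Q n) = (\<Prod>j<J. f j) * norm (qpoch (y * Q ^ (m * J)) Q r)"
      unfolding n qpoch_blocks norm_mult f_def prod_norm by simp
    also have "\<dots> \<le> (exp (2 * K2) * ((1 / 2) ^ J + 4 / \<eta>\<^sup>2 * \<epsilon>\<^sup>2)) * 3 ^ m"
    proof (intro mult_mono blocks)
      have "norm (qpoch (y * Q ^ (m * J)) Q r) \<le> 3 ^ r"
        using nyj v2 p by (intro norm_qpoch_le_power) (auto simp: Q_def norm_mult)
      also have "(3::real) ^ r \<le> 3 ^ m" using r by (intro power_increasing) auto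
      finally show "norm (qpoch (y * Q ^ (m * J)) Q r) \<le> 3 ^ m" .
    qed auto
    also have "\<dots> \<le> (exp (2 * K2) * ((2 + 4 / \<eta>\<^sup>2) * (\<delta> ^ n + \<epsilon>\<^sup>2))) * 3 ^ m"
    proof (intro mult_right_mono mult_left_mono)
      \<comment> \<open>The incomplete last block costs at most a factor 2, because
        \<open>\<delta>^r \<ge> \<delta>^m = 1/2\<close>.\<close>
      have "\<delta> ^ m \<le> \<delta> ^ r" using \<delta> r by (intro power_decreasing) auto
      then have "(1 / 2) ^ J * (1 / 2) \<le> (1 / 2) ^ J * \<delta> ^ r"
        unfolding \<delta>m by (intro mult_left_mono) auto
      also have "(1 / 2) ^ J * \<delta> ^ r = \<delta> ^ n"
        unfolding n by (simp add: power_add power_mult \<delta>m)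
      finally have "(1 / 2) ^ J \<le> 2 * \<delta> ^ n" by simp
      moreover have "0 \<le> 4 / \<eta>\<^sup>2 * \<delta> ^ n" "0 \<le> 2 * \<epsilon>\<^sup>2" using \<delta> by auto
      moreover have "(2 + 4 / \<eta>\<^sup>2) * (\<delta> ^ n + \<epsilon>\<^sup>2) = 2 * \<delta> ^ n + 4 / \<eta>\<^sup>2 * \<delta> ^ n + 2 * \<epsilon>\<^sup>2 + 4 / \<eta>\<^sup>2 * \<epsilon>\<^sup>2"
        by (simp only: algebra_simps)
      ultimately show "(1 / 2) ^ J + 4 / \<eta>\<^sup>2 * \<epsilon>\<^sup>2 \<le> (2 + 4 / \<eta>\<^sup>2) * (\<delta> ^ n + \<epsilon>\<^sup>2)"
        by linarith
    qed auto
    finally show ?thesis by (simp add: C_def Q_def p_def mult_ac)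
  qed
  show ?thesis
    by (rule that[of C \<delta> \<epsilon>0, OF C \<delta> e0 main])
qed

text \<open>In \<open>1 - z^m = (1 - z) (1 + z + ... + z^(m-1))\<close> the left side has modulus
  \<open>1 + |z|^m\<close>, since \<open>z^m\<close> is real and not positive, while the sum is at
  most \<open>m max(1, |z|^m)\<close>.\<close>

lemma norm_one_minus_ge:
  fixes z :: complex
  assumes "z ^ m = - of_real (norm z ^ m)"
  shows "1 / real m \<le> norm (1 - z)"
proof -
  have "norm (\<Sum>i<m. z ^ i) \<le> real m * max 1 (norm z ^ m)"
  proof -
    have "norm (\<Sum>i<m. z ^ i) \<le> (\<Sum>i<m. norm (z ^ i))" by (rule norm_sum)
    also have "\<dots> \<le> (\<Sum>i<m. max 1 (norm z ^ m))"
    proof (rule sum_mono)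
      fix i assume "i \<in> {..<m}"
      then show "norm (z ^ i) \<le> max 1 (norm z ^ m)"
        using power_increasing[of i m "norm z"] power_le_one[of "norm z" i]
        by (cases "norm z \<le> 1") (auto simp: norm_power le_max_iff_disj)
    qed
    finally show ?thesis by simp
  qed
  have "max 1 (norm z ^ m) \<le> 1 + norm z ^ m" by simp
  also have "1 + norm z ^ m = norm (1 - z ^ m)"
  proof -
    have "1 - z ^ m = of_real (1 + norm z ^ m)" using assms by simp
    then have "norm (1 - z ^ m) = \<bar>1 + norm z ^ m\<bar>" by (simp only: norm_of_real)
    then show ?thesis by simp
  qed
  also have "1 - z ^ m = (1 - z) * (\<Sum>i<m. z ^ i)" by (rule one_diff_power_eq)
  also have "norm ((1 - z) * (\<Sum>i<m. z ^ i)) \<le> norm (1 - z) * (real m * max 1 (norm z ^ m))"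
    unfolding norm_mult by (intro mult_left_mono) (fact, simp)
  finally have "1 * max 1 (norm z ^ m) \<le> (norm (1 - z) * real m) * max 1 (norm z ^ m)"
    by (simp add: mult.assoc)
  then have "1 \<le> norm (1 - z) * real m"
    by (rule mult_right_le_imp_le) (simp add: less_max_iff_disj)
  then show ?thesis using m_pos by (simp add: field_simps)
qed

text \<open>With the opposite sign of the m-th power the main term of a block is
  \<open>1 + v^m \<ge> 1\<close>, so a block is at least \<open>1 - K \<epsilon> v\<close>. The
  losses multiply to at least \<open>exp (- 4 * K)\<close>, and the fewer than \<open>m\<close>
  leftover factors are bounded by \<open>norm_one_minus_ge\<close>.\<close>

lemma qpoch_lower:
  assumes \<kappa>: "\<kappa> \<ge> 0"
  obtains c \<epsilon>0 where "0 < c" "0 < \<epsilon>0" "\<epsilon>0 < 1"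
    "\<And>\<epsilon> z n. 0 < \<epsilon> \<Longrightarrow> \<epsilon> < \<epsilon>0 \<Longrightarrow> z ^ m = - of_real (norm z ^ m) \<Longrightarrow> norm z \<le> 1 + \<kappa> * \<epsilon> \<Longrightarrow>
      c \<le> norm (qpoch z (w * of_real (1 - \<epsilon>)) n)"
proof -
  define K where "K = real m ^ 2 * 3 ^ m"
  define \<epsilon>0 where "\<epsilon>0 = 1 / (4 * (K + \<kappa> + 1))"
  define c where "c = exp (- 4 * K) * (1 / real m) ^ m"
  have K0: "K > 0" using m_pos by (auto simp: K_def)
  have e0: "0 < \<epsilon>0" "\<epsilon>0 < 1" using K0 \<kappa> by (auto simp: \<epsilon>0_def field_simps)
  have c0: "c > 0" using m_pos by (simp add: c_def)
  have main: "c \<le> norm (qpoch z (w * of_real (1 - \<epsilon>)) n)"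
    if e: "0 < \<epsilon>" "\<epsilon> < \<epsilon>0" and z: "z ^ m = - of_real (norm z ^ m)" "norm z \<le> 1 + \<kappa> * \<epsilon>" for \<epsilon> z n
  proof -
    define p where "p = 1 - \<epsilon>"
    define Q where "Q = w * of_real p"
    have e1: "\<epsilon> < 1" using e e0 by linarith
    have p: "0 < p" "p < 1" using e e1 by (auto simp: p_def)
    have "4 * ((K + \<kappa> + 1) * \<epsilon>) \<le> 1"
      using e K0 \<kappa> by (simp add: \<epsilon>0_def field_simps)
    moreover have "0 \<le> K * \<epsilon>" "0 \<le> \<kappa> * \<epsilon>" using K0 \<kappa> e by auto
    ultimately have ke: "K * \<epsilon> \<le> 1 / 4" "\<kappa> * \<epsilon> \<le> 1 / 4"
      using e by (auto simp: algebra_simps)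
    have nz: "norm z \<le> 2" using z(2) ke(2) by linarith
    define v where "v = (\<lambda>j. norm z * p ^ (m * j))"
    have zj: "z * Q ^ (m * j) = z * of_real (p ^ (m * j))" for j
      by (simp add: Q_def power_nome)
    have nzj: "norm (z * Q ^ (m * j)) = v j" for j
      unfolding zj v_def using p by (simp add: norm_mult norm_power)
    have v0: "0 \<le> v j" for j using p by (simp add: v_def)
    have v2: "v j \<le> 2" for j
    proof -
      have "v j \<le> norm z" using p unfolding v_def by (intro mult_left_le) (auto simp: power_le_one)
      then show ?thesis using nz by linarith
    qed
    have f: "exp (- 2 * (K * \<epsilon> * v j)) \<le> norm (qpoch (z * Q ^ (m * j)) Q m)" for j
    proof -
      define u where "u = z * Q ^ (m * j)"
      have um: "1 - u ^ m = of_real (1 + v j ^ m)"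
        unfolding u_def zj v_def power_mult_distrib z(1) by simp
      have "norm (1 - u ^ m) = 1 + v j ^ m"
        unfolding um norm_of_real using v0[of j] by simp
      moreover have "norm (qpoch u Q m - (1 - u ^ m)) \<le> K * \<epsilon> * v j"
        using block_estimate[of u \<epsilon>] nzj[of j] v2[of j] e e1 by (simp add: u_def Q_def p_def K_def)
      moreover have "norm (1 - u ^ m) \<le> norm (qpoch u Q m) + norm (qpoch u Q m - (1 - u ^ m))"
        using norm_triangle_ineq4[of "qpoch u Q m" "qpoch u Q m - (1 - u ^ m)"] by simp
      moreover have "0 \<le> v j ^ m" using v0 by simp
      ultimately have 1: "1 - K * \<epsilon> * v j \<le> norm (qpoch u Q m)" by linarith
      \<comment> \<open>On \<open>[0, 1/2]\<close> one has \<open>1 - a \<ge> exp (- 2 * a)\<close>,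
        which turns the product of the block bounds into the exponential of a bounded sum.\<close>
      define a where "a = K * \<epsilon> * v j"
      have "K * \<epsilon> * v j \<le> 1 / 4 * 2" by (intro mult_mono ke v2 v0) simp
      then have a: "0 \<le> a" "a \<le> 1 / 2" using K0 e v0 by (auto simp: a_def)
      have "a\<^sup>2 \<le> a * (1 / 2)" unfolding power2_eq_square using a by (intro mult_left_mono) auto
      then have "- 2 * a \<le> ln (1 - a)"
        using ln_one_minus_pos_lower_bound[OF a] by linarith
      then have "exp (- 2 * a) \<le> 1 - a"
        using a by (subst (asm) ln_ge_iff) auto
      then show ?thesis using 1 by (simp add: a_def u_def)
    qed
    have E: "exp (- 4 * K) \<le> (\<Prod>j<J. norm (qpoch (z * Q ^ (m * j)) Q m))" for J
    proof -
      have "(\<Sum>j<J. K * \<epsilon> * v j) = K * norm z * (\<Sum>j<J. \<epsilon> * (1 - \<epsilon>) ^ (m * j))"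
        by (simp add: v_def p_def sum_distrib_left mult_ac)
      also have "\<dots> \<le> K * 2 * 1"
        using K0 nz sum_block_sizes[OF e(1) e1, of J] e1 e by (intro mult_mono) (auto intro!: sum_nonneg)
      finally have "exp (- 4 * K) \<le> exp (\<Sum>j<J. - 2 * (K * \<epsilon> * v j))"
        by (simp add: sum_distrib_left[symmetric] sum_negf)
      also have "\<dots> = (\<Prod>j<J. exp (- 2 * (K * \<epsilon> * v j)))" by (simp add: exp_sum)
      also have "\<dots> \<le> (\<Prod>j<J. norm (qpoch (z * Q ^ (m * j)) Q m))"
        by (intro prod_mono) (use f in auto)
      finally show ?thesis .
    qed
    define J where "J = n div m"
    define r where "r = n mod m"
    have n: "n = m * J + r" and r: "r < m" using m_pos by (auto simp: J_def r_def)
    have "(1 / real m) ^ m \<le> norm (qpoch (z * Q ^ (m * J)) Q r)"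
    proof -
      have "(1 / real m) ^ m \<le> (1 / real m) ^ r"
        using r m_pos by (intro power_decreasing) auto
      also have "\<dots> = (\<Prod>i<r. 1 / real m)" by simp
      also have "\<dots> \<le> (\<Prod>i<r. norm (1 - z * Q ^ (m * J) * Q ^ i))"
      proof (intro prod_mono conjI)
        fix i
        define u where "u = z * Q ^ (m * J) * Q ^ i"
        have Qm: "Q ^ m = of_real (p ^ m)" using power_nome[of p 1] by (simp add: Q_def)
        have nQ: "norm Q = p" using p by (simp add: Q_def norm_mult)
        have "u ^ m = z ^ m * (Q ^ m) ^ (m * J + i)"
          by (simp add: u_def power_mult_distrib power_add mult_ac flip: power_mult)
        also have "\<dots> = - of_real (norm u ^ m)"
          unfolding z(1) Qm u_def norm_mult norm_power nQ
          by (simp add: power_mult_distrib power_add mult_ac flip: power_mult)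
        finally show "1 / real m \<le> norm (1 - z * Q ^ (m * J) * Q ^ i)"
          using norm_one_minus_ge[of u] by (simp add: u_def)
      qed simp
      finally show ?thesis by (simp add: qpoch_def prod_norm)
    qed
    then have "c \<le> (\<Prod>j<J. norm (qpoch (z * Q ^ (m * j)) Q m)) * norm (qpoch (z * Q ^ (m * J)) Q r)"
      unfolding c_def by (intro mult_mono E) (auto intro!: prod_nonneg)
    also have "\<dots> = norm (qpoch z Q n)"
      unfolding n qpoch_blocks norm_mult prod_norm by simp
    finally show ?thesis by (simp add: Q_def p_def)
  qed
  show ?thesis
    by (rule that[of c \<epsilon>0, OF c0 e0 main])
qed

text \<open>The m-th power of \<open>z Q^n\<close> is a negative real number, hence not 1.\<close>

lemma off_lattice_of_neg_power:
  assumes "nome Q" "Q ^ m = of_real r" "r > 0" "z ^ m = - of_real (norm z ^ m)" "z \<noteq> 0"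
  shows "nome.off_lattice Q z"
  unfolding nome.off_lattice_def[OF assms(1)]
proof (intro conjI allI notI)
  fix n :: int
  assume "z * Q powi n = 1"
  then have "(z * Q powi n) ^ m = 1" by simp
  then have "z ^ m * (Q ^ m) powi n = 1"
  proof -
    have "(Q powi n) ^ m = (Q ^ m) powi n"
      by (metis power_int_mult power_int_of_nat mult.commute)
    then show ?thesis using \<open>(z * Q powi n) ^ m = 1\<close> by (simp add: power_mult_distrib)
  qed
  then have "- of_real (norm z ^ m * r powi n) = (1 :: complex)"
    unfolding assms(2,4) by simp
  then have "complex_of_real (- (norm z ^ m * r powi n)) = of_real 1" by simp
  then have "- (norm z ^ m * r powi n) = 1" by (simp only: of_real_eq_iff)
  moreover have "norm z ^ m * r powi n > 0" using assms(3,5) by simp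
  ultimately show False by linarith
qed (use assms in auto)

text \<open>The analytic core, free of arithmetic: argument and nome run along rays that end at
  \<open>x0\<close> and \<open>w\<close>, and the choice of square root is reduced to the sign of
  its m-th power.\<close>

lemma radial_limit_g3:
  fixes \<alpha> \<beta> :: real and x0 :: complex and S :: "real \<Rightarrow> complex"
  assumes x0: "norm x0 = 1" "x0 ^ m = 1" and \<alpha>: "0 \<le> \<alpha>" and \<beta>: "0 < \<beta>"
  defines "Q \<equiv> \<lambda>t. w * of_real (exp (- \<beta> * t))" and "x \<equiv> \<lambda>t. x0 * of_real (exp (- \<alpha> * t))"
  assumes off: "\<And>t. t > 0 \<Longrightarrow> nome.off_lattice (Q t) (x t)"
    and S2: "\<And>t. t > 0 \<Longrightarrow> (S t)\<^sup>2 = Q t"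
    and Sm: "\<And>t. t > 0 \<Longrightarrow> S t ^ m = - of_real (norm (S t) ^ m)"
  shows "((\<lambda>t. g3 (x t) (Q t) - theta_part (x t) (Q t) (S t)) \<longlongrightarrow>
    - (1 / x0) + 1 / x0\<^sup>2 * (\<Sum>n<m. qpoch (w / x0) w n * qpoch x0 w (Suc n) * w ^ Suc n)) (at_right 0)"
proof -
  \<comment> \<open>From \<open>exp (\<alpha> * t) \<le> 1 + 2 \<alpha> t\<close> for
    \<open>\<alpha> t < 1\<close> and \<open>t \<le> 2 \<epsilon> / \<beta>\<close> comes the part
    \<open>4 \<alpha> / \<beta>\<close>; the additional 1 accounts for the factor
    \<open>1 - \<epsilon>\<close> in the modulus of \<open>Q t / x t\<close>.\<close>
  define \<kappa> where "\<kappa> = 4 * \<alpha> / \<beta> + 1"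
  define \<epsilon> where "\<epsilon> = (\<lambda>t. 1 - exp (- \<beta> * t))"
  have \<kappa>: "\<kappa> \<ge> 1" using \<alpha> \<beta> by (simp add: \<kappa>_def)
  obtain C \<delta> e1 where C: "0 < C" and \<delta>: "0 < \<delta>" "\<delta> < 1" and e1: "0 < e1" "e1 < 1"
    and dec: "\<And>\<epsilon> y n. 0 < \<epsilon> \<Longrightarrow> \<epsilon> < e1 \<Longrightarrow> y ^ m = of_real (norm y ^ m) \<Longrightarrow> 1 - \<kappa> * \<epsilon> \<le> norm y \<Longrightarrow>
      norm y \<le> 1 + \<kappa> * \<epsilon> \<Longrightarrow> norm (qpoch y (w * of_real (1 - \<epsilon>)) n) \<le> C * (\<delta> ^ n + \<epsilon>\<^sup>2)"
    by (rule qpoch_decay[of \<kappa>]) (use \<kappa> in auto)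
  obtain c e2 where c: "0 < c" and e2: "0 < e2" "e2 < 1"
    and low: "\<And>\<epsilon> z n. 0 < \<epsilon> \<Longrightarrow> \<epsilon> < e2 \<Longrightarrow> z ^ m = - of_real (norm z ^ m) \<Longrightarrow> norm z \<le> 1 + \<kappa> * \<epsilon> \<Longrightarrow>
      c \<le> norm (qpoch z (w * of_real (1 - \<epsilon>)) n)"
    by (rule qpoch_lower[of \<kappa>]) (use \<kappa> in auto)
  define V where "V = (\<lambda>t. \<Sum>n. qpoch (Q t / x t) (Q t) n * qpoch (x t) (Q t) (Suc n) * Q t ^ Suc n)"
  define E where "E = (\<lambda>t. S t * (qpoch_inf (x t) (Q t) * qpoch_inf (Q t / x t) (Q t) *
     nome.bilateral (Q t) (x t * S t) (S t / x t)) / (x t)\<^sup>2)"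
  define D where "D = 1 / c\<^sup>2 + 1 / c ^ 4"
  have D: "D > 0" using c by (simp add: D_def add_pos_pos)
  have x00: "x0 \<noteq> 0" using x0(1) by auto
  have lim0: "((\<lambda>t. u * t) \<longlongrightarrow> 0) (at_right 0)" for u :: real
    using tendsto_mult[OF tendsto_const[of u] tendsto_ident_at[of 0 "{0<..}"]] by simp
  have e\<epsilon>: "(\<epsilon> \<longlongrightarrow> 0) (at_right 0)"
    unfolding \<epsilon>_def using tendsto_diff[OF tendsto_const[of 1] tendsto_exp[OF lim0[of "- \<beta>"]]] by simp
  have good: "\<forall>\<^sub>F t in at_right 0. 0 < t \<and> \<alpha> * t < 1 \<and> \<beta> * t < 1 \<and> \<epsilon> t < e1 \<and> \<epsilon> t < e2"
    using eventually_at_right_less[of "0::real"] order_tendstoD(2)[OF lim0[of \<alpha>], of 1]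
      order_tendstoD(2)[OF lim0[of \<beta>], of 1] order_tendstoD(2)[OF e\<epsilon> e1(1)] order_tendstoD(2)[OF e\<epsilon> e2(1)]
    by (simp add: eventually_conj)
  have limx: "(x \<longlongrightarrow> x0) (at_right 0)"
    unfolding x_def using tendsto_mult[OF tendsto_const[of x0] tendsto_of_real[OF tendsto_exp[OF lim0[of "- \<alpha>"]]]] by simp
  have limQ: "(Q \<longlongrightarrow> w) (at_right 0)"
    unfolding Q_def using tendsto_mult[OF tendsto_const[of w] tendsto_of_real[OF tendsto_exp[OF lim0[of "- \<beta>"]]]] by simp
  have key: "(\<forall>n. norm (qpoch (x t) (Q t) n) \<le> C * (\<delta> ^ n + (\<epsilon> t)\<^sup>2)) \<and>
      (\<forall>n. norm (qpoch (Q t / x t) (Q t) n) \<le> C * (\<delta> ^ n + (\<epsilon> t)\<^sup>2)) \<and>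
      norm (E t) \<le> 9 * C * C * D * \<epsilon> t \<and> 0 < \<epsilon> t \<and> \<epsilon> t < 1 \<and> norm (Q t) = 1 - \<epsilon> t \<and>
      g3 (x t) (Q t) - theta_part (x t) (Q t) (S t) = - (1 / x t) + V t / (x t)\<^sup>2 - E t"
    if t: "0 < t" "\<alpha> * t < 1" "\<beta> * t < 1" "\<epsilon> t < e1" "\<epsilon> t < e2" for t
  proof -
    have \<epsilon>t: "0 < \<epsilon> t" "\<epsilon> t < 1" using t \<beta> by (auto simp: \<epsilon>_def)
    have Qt: "Q t = w * of_real (1 - \<epsilon> t)" by (simp add: Q_def \<epsilon>_def)
    have p: "exp (- \<beta> * t) = 1 - \<epsilon> t" by (simp add: \<epsilon>_def)
    have nQ: "norm (Q t) = 1 - \<epsilon> t" unfolding Q_def norm_mult norm_of_real p using \<epsilon>t by simp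
    have nx: "norm (x t) = exp (- \<alpha> * t)" by (simp add: x_def norm_mult x0)
    interpret nome "Q t"
      by standard (use nQ \<epsilon>t in auto)
    have xo: "off_lattice (x t)" by (rule off[OF t(1)])
    have xt0: "x t \<noteq> 0" by (rule off_lattice_nz[OF xo])
    have Qm: "Q t ^ m = of_real ((1 - \<epsilon> t) ^ m)" using power_nome[of "1 - \<epsilon> t" 1] by (simp add: Qt)
    have xm: "x t ^ m = of_real (norm (x t) ^ m)"
      unfolding nx by (simp add: x_def power_mult_distrib x0)
    have Qxm: "(Q t / x t) ^ m = of_real (norm (Q t / x t) ^ m)"
      unfolding norm_divide nQ power_divide Qm xm by simp
    have t2: "t \<le> 2 * \<epsilon> t / \<beta>"
      using exp_minus_le_half[of "\<beta> * t"] t \<beta> by (simp add: \<epsilon>_def field_simps)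
    have at: "\<alpha> * t \<le> 2 * \<alpha> / \<beta> * \<epsilon> t"
      using mult_left_mono[OF t2 \<alpha>] by (simp add: mult_ac)
    have \<kappa>e: "\<kappa> * \<epsilon> t = 2 * (2 * \<alpha> / \<beta> * \<epsilon> t) + \<epsilon> t" by (simp add: \<kappa>_def algebra_simps)
    have at0: "0 \<le> \<alpha> * t" using \<alpha> t by simp
    have up: "exp (\<alpha> * t) \<le> 1 + \<kappa> * \<epsilon> t"
    proof -
      have "exp (\<alpha> * t) \<le> 1 + \<alpha> * t + (\<alpha> * t)\<^sup>2"
        using exp_bound[of "\<alpha> * t"] at0 t by simp
      also have "(\<alpha> * t)\<^sup>2 \<le> \<alpha> * t"
        unfolding power2_eq_square using at0 t by (intro mult_left_le) auto
      finally show ?thesis using at \<kappa>e \<epsilon>t by linarith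
    qed
    have nx1: "1 - \<kappa> * \<epsilon> t \<le> norm (x t)"
      unfolding nx using exp_ge_add_one_self[of "- \<alpha> * t"] at \<kappa>e \<epsilon>t at0 by simp
    have nx2: "norm (x t) \<le> 1" unfolding nx using at0 by simp
    have \<kappa>p: "\<epsilon> t \<le> \<kappa> * \<epsilon> t" using mult_right_mono[OF \<kappa>, of "\<epsilon> t"] \<epsilon>t by simp
    have ix: "1 / norm (x t) = exp (\<alpha> * t)" unfolding nx by (simp add: exp_minus field_simps)
    have ix1: "1 \<le> exp (\<alpha> * t)" using at0 by simp
    have bx: "norm (qpoch (x t) (Q t) n) \<le> C * (\<delta> ^ n + (\<epsilon> t)\<^sup>2)" for n
      unfolding Qt by (rule dec) (use \<epsilon>t t xm nx1 nx2 \<kappa>p in auto)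
    have bQx: "norm (qpoch (Q t / x t) (Q t) n) \<le> C * (\<delta> ^ n + (\<epsilon> t)\<^sup>2)" for n
    proof -
      have n: "norm (Q t / x t) = (1 - \<epsilon> t) * exp (\<alpha> * t)"
        unfolding norm_divide nQ ix[symmetric] by simp
      have "1 - \<epsilon> t \<le> (1 - \<epsilon> t) * exp (\<alpha> * t)" using ix1 \<epsilon>t mult_left_mono[of 1 "exp (\<alpha> * t)" "1 - \<epsilon> t"] by simp
      moreover have "(1 - \<epsilon> t) * exp (\<alpha> * t) \<le> exp (\<alpha> * t)" using \<epsilon>t by (simp add: mult_le_cancel_right1)
      ultimately have "1 - \<kappa> * \<epsilon> t \<le> norm (Q t / x t)" "norm (Q t / x t) \<le> 1 + \<kappa> * \<epsilon> t"
        unfolding n using up \<kappa>p by linarith+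
      then have "norm (qpoch (Q t / x t) (w * of_real (1 - \<epsilon> t)) n) \<le> C * (\<delta> ^ n + (\<epsilon> t)\<^sup>2)"
        by (intro dec \<epsilon>t t Qxm)
      then show ?thesis by (simp add: Qt)
    qed
    have binf: "norm (qpoch_inf y (Q t)) \<le> C * (\<epsilon> t)\<^sup>2"
      if "\<And>n. norm (qpoch y (Q t) n) \<le> C * (\<delta> ^ n + (\<epsilon> t)\<^sup>2)" for y
    proof (rule LIMSEQ_le)
      show "(\<lambda>n. norm (qpoch y (Q t) n)) \<longlonglongrightarrow> norm (qpoch_inf y (Q t))"
        by (intro tendsto_intros qpoch_LIMSEQ)
      have "(\<lambda>n. C * (\<delta> ^ n + (\<epsilon> t)\<^sup>2)) \<longlonglongrightarrow> C * (0 + (\<epsilon> t)\<^sup>2)"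
        using \<delta> by (intro tendsto_intros LIMSEQ_power_zero) auto
      then show "(\<lambda>n. C * (\<delta> ^ n + (\<epsilon> t)\<^sup>2)) \<longlonglongrightarrow> C * (\<epsilon> t)\<^sup>2" by simp
    qed (use that in blast)
    have S0: "S t \<noteq> 0" using S2[OF t(1)] q_nz by auto
    have nS: "norm (S t) \<le> 1"
    proof -
      have "norm (S t) ^ 2 = 1 - \<epsilon> t" using arg_cong[OF S2[OF t(1)], of norm] nQ by (simp add: norm_power)
      then have "norm (S t) ^ 2 \<le> 1 ^ 2" using \<epsilon>t by simp
      then show ?thesis by (rule power2_le_imp_le) simp
    qed
    have lowz: "c \<le> norm (qpoch z (Q t) n)"
      if "z ^ m = - of_real (norm z ^ m)" "norm z \<le> 1 + \<kappa> * \<epsilon> t" for z n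
      unfolding Qt by (rule low[OF \<epsilon>t(1) t(5) that])
    have lowzinf: "c \<le> norm (qpoch_inf (z * Q t ^ n) (Q t))"
      if z: "z ^ m = - of_real (norm z ^ m)" "norm z \<le> 1 + \<kappa> * \<epsilon> t" for z n
    proof (rule LIMSEQ_le_const)
      show "(\<lambda>k. norm (qpoch (z * Q t ^ n) (Q t) k)) \<longlonglongrightarrow> norm (qpoch_inf (z * Q t ^ n) (Q t))"
        by (intro tendsto_intros qpoch_LIMSEQ)
      have "(z * Q t ^ n) ^ m = z ^ m * (Q t ^ m) ^ n"
        by (simp add: power_mult_distrib mult.commute flip: power_mult)
      also have "\<dots> = - of_real (norm (z * Q t ^ n) ^ m)"
        unfolding z(1) Qm norm_mult norm_power nQ
        by (simp add: power_mult_distrib mult.commute flip: power_mult)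
      finally have 1: "(z * Q t ^ n) ^ m = - of_real (norm (z * Q t ^ n) ^ m)" .
      have "norm (z * Q t ^ n) \<le> norm z"
        unfolding norm_mult norm_power nQ using \<epsilon>t by (intro mult_left_le) (auto simp: power_le_one)
      then have "norm (z * Q t ^ n) \<le> 1 + \<kappa> * \<epsilon> t" using z(2) by linarith
      from lowz[OF 1 this] show "\<exists>N. \<forall>k\<ge>N. c \<le> norm (qpoch (z * Q t ^ n) (Q t) k)" by blast
    qed
    have m1: "(x t * S t) ^ m = - of_real (norm (x t * S t) ^ m)"
      unfolding power_mult_distrib norm_mult xm Sm[OF t(1)] by simp
    have m2: "(S t / x t) ^ m = - of_real (norm (S t / x t) ^ m)"
      unfolding power_divide norm_divide xm Sm[OF t(1)] by simp
    have n1: "norm (x t * S t) \<le> 1 + \<kappa> * \<epsilon> t"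
    proof -
      have "norm (x t * S t) \<le> 1" using mult_mono[OF nx2 nS] by (simp add: norm_mult)
      then show ?thesis using \<kappa>p \<epsilon>t by linarith
    qed
    have n2: "norm (S t / x t) \<le> 1 + \<kappa> * \<epsilon> t"
    proof -
      have "norm (S t / x t) = norm (S t) * exp (\<alpha> * t)" unfolding norm_divide ix[symmetric] by simp
      also have "\<dots> \<le> 1 * exp (\<alpha> * t)" by (intro mult_right_mono nS) simp
      finally show ?thesis using up by linarith
    qed
    have pm: "(1 - \<epsilon> t) ^ m > 0" using \<epsilon>t by simp
    have o1: "off_lattice (x t * S t)"
      by (rule off_lattice_of_neg_power[OF nome_axioms Qm pm m1]) (use xt0 S0 in simp)
    have o2: "off_lattice (S t / x t)"
      by (rule off_lattice_of_neg_power[OF nome_axioms Qm pm m2]) (use xt0 S0 in simp)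
    have "norm (bilateral (x t * S t) (S t / x t)) \<le> (1 / c\<^sup>2 + 1 / c ^ 4) / (1 - norm (Q t))"
      by (rule bilateral_bound[OF o1 o2 _ c])
        (use xt0 S2[OF t(1)] lowz[OF m1 n1] lowz[OF m2 n2] lowzinf[OF m1 n1] lowzinf[OF m2 n2]
          in \<open>auto simp: power2_eq_square\<close>)
    then have bb: "norm (bilateral (x t * S t) (S t / x t)) \<le> D / \<epsilon> t"
      by (simp add: D_def nQ)
    have ix2: "1 / norm (x t) ^ 2 \<le> 9"
    proof -
      have "exp (\<alpha> * t) \<le> 1 + \<alpha> * t + (\<alpha> * t)\<^sup>2"
        using exp_bound[of "\<alpha> * t"] at0 t by simp
      also have "(\<alpha> * t)\<^sup>2 \<le> 1" using at0 t by (simp add: power_le_one)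
      finally have "exp (\<alpha> * t) \<le> 3" using t by linarith
      then have "exp (\<alpha> * t) ^ 2 \<le> 3 ^ 2" by (intro power_mono) auto
      then show ?thesis unfolding ix[symmetric] by (simp add: power_divide)
    qed
    have "norm (E t) = norm (S t) * (norm (qpoch_inf (x t) (Q t)) * norm (qpoch_inf (Q t / x t) (Q t)) *
        norm (bilateral (x t * S t) (S t / x t))) * (1 / norm (x t) ^ 2)"
      by (simp add: E_def norm_mult norm_divide norm_power)
    \<comment> \<open>Each infinite product contributes \<open>\<epsilon>^2\<close> and the
      bilateral series \<open>1 / \<epsilon>\<close>. The 9 bounds the inverse square of
      \<open>norm (x t)\<close>, since \<open>exp (\<alpha> * t) \<le> 3\<close>.\<close>
    also have "\<dots> \<le> 1 * ((C * (\<epsilon> t)\<^sup>2) * (C * (\<epsilon> t)\<^sup>2) * (D / \<epsilon> t)) * 9"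
      using C D \<epsilon>t by (intro mult_mono nS binf bx bQx bb ix2) auto
    also have "\<dots> = 9 * C * C * D * ((\<epsilon> t) ^ 3)"
      using \<epsilon>t by (simp add: power2_eq_square power3_eq_cube)
    also have "\<dots> \<le> 9 * C * C * D * \<epsilon> t"
      using C D \<epsilon>t power_decreasing[of 1 3 "\<epsilon> t"] by (intro mult_left_mono) auto
    finally have bE: "norm (E t) \<le> 9 * C * C * D * \<epsilon> t" .
    have "g3 (x t) (Q t) - theta_part (x t) (Q t) (S t) = - (1 / x t) + V t / (x t)\<^sup>2 - E t"
      unfolding V_def E_def by (rule g3_minus_theta_part[OF xo o1 S2[OF t(1)]])
    then show ?thesis using bx bQx bE \<epsilon>t nQ by blast
  qed
  have "((\<lambda>t. 9 * C * C * D * \<epsilon> t) \<longlongrightarrow> 9 * C * C * D * 0) (at_right 0)"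
    by (intro tendsto_intros e\<epsilon>)
  then have lim9: "((\<lambda>t. 9 * C * C * D * \<epsilon> t) \<longlongrightarrow> 0) (at_right 0)" by simp
  have limE: "(E \<longlongrightarrow> 0) (at_right 0)"
  proof (rule Lim_null_comparison[OF _ lim9])
    show "\<forall>\<^sub>F t in at_right 0. norm (E t) \<le> 9 * C * C * D * \<epsilon> t"
      using good by (rule eventually_mono) (use key in blast)
  qed
  define V0 where "V0 = (\<Sum>n<m. qpoch (w / x0) w n * qpoch x0 w (Suc n) * w ^ Suc n)"
  have limV: "(V \<longlongrightarrow> V0) (at_right 0)"
  proof -
    define a where "a = (\<lambda>n t. qpoch (Q t / x t) (Q t) n * qpoch (x t) (Q t) (Suc n) * Q t ^ Suc n)"
    define b where "b = (\<lambda>n. qpoch (w / x0) w n * qpoch x0 w (Suc n) * w ^ Suc n)"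
    \<comment> \<open>One of the two products is merely bounded, by \<open>2 C\<close>. The other
      supplies \<open>\<delta>^(n+1) + \<epsilon>^2\<close>, whose second part is controlled through
      \<open>square_mult_power_le\<close>.\<close>
    define M where "M = (\<lambda>n. 2 * C * C * (\<delta> ^ Suc n + 2 / (real (Suc n))\<^sup>2))"
    have lima: "((\<lambda>t. a n t) \<longlongrightarrow> b n) (at_right 0)" for n
      unfolding a_def b_def qpoch_def by (intro tendsto_intros limx limQ x00)
    have "\<forall>\<^sub>F t in at_right 0. \<forall>n. norm (a n t) \<le> M n"
      using good
    proof eventually_elim
      case (elim t)
      then have k: "norm (qpoch (x t) (Q t) n) \<le> C * (\<delta> ^ n + (\<epsilon> t)\<^sup>2)"
        "norm (qpoch (Q t / x t) (Q t) n) \<le> C * (\<delta> ^ n + (\<epsilon> t)\<^sup>2)"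
        "0 < \<epsilon> t" "\<epsilon> t < 1" "norm (Q t) = 1 - \<epsilon> t" for n
        using key[of t] by auto
      show ?case
      proof
        fix n
        have "norm (a n t) = norm (qpoch (Q t / x t) (Q t) n) * norm (qpoch (x t) (Q t) (Suc n)) * (1 - \<epsilon> t) ^ Suc n"
          by (simp only: a_def norm_mult norm_power k(5))
        also have "\<dots> \<le> (C * 2) * (C * (\<delta> ^ Suc n + (\<epsilon> t)\<^sup>2)) * (1 - \<epsilon> t) ^ Suc n"
        proof (intro mult_right_mono mult_mono k)
          have "\<delta> ^ n \<le> 1" "(\<epsilon> t)\<^sup>2 \<le> 1" using \<delta> k(3,4) by (auto simp: power_le_one)
          then have "C * (\<delta> ^ n + (\<epsilon> t)\<^sup>2) \<le> C * 2" using C by (intro mult_left_mono) auto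
          then show "norm (qpoch (Q t / x t) (Q t) n) \<le> C * 2" using k(2)[of n] by linarith
        qed (use C k in auto)
        also have "\<dots> = 2 * C * C * (\<delta> ^ Suc n * (1 - \<epsilon> t) ^ Suc n + (\<epsilon> t)\<^sup>2 * (1 - \<epsilon> t) ^ Suc n)"
          by (simp only: algebra_simps)
        also have "\<dots> \<le> 2 * C * C * (\<delta> ^ Suc n + 2 / (real (Suc n))\<^sup>2)"
        proof (intro mult_left_mono add_mono square_mult_power_le k)
          have "(1 - \<epsilon> t) ^ Suc n \<le> 1" by (rule power_le_one) (use k(3,4) in auto)
          then show "\<delta> ^ Suc n * (1 - \<epsilon> t) ^ Suc n \<le> \<delta> ^ Suc n"
            by (rule mult_left_le) (use \<delta> in simp)
        qed (use C in auto)
        finally show "norm (a n t) \<le> M n" by (simp only: M_def)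
      qed
    qed
    \<comment> \<open>The majorant holds for all \<open>n\<close> simultaneously once
      \<open>t\<close> is small, so it holds eventually along the product filter on which the
      theorem of Tannery is stated.\<close>
    then have "\<forall>\<^sub>F (j :: nat, t) in at_top \<times>\<^sub>F at_right 0. \<forall>n. norm (a n t) \<le> M n"
      by (subst eventually_prod2) auto
    then have bnd: "\<forall>\<^sub>F (n, t) in at_top \<times>\<^sub>F at_right 0. norm (a n t) \<le> M n"
      by (rule eventually_mono) auto
    have "summable (\<lambda>n. inverse (real n ^ 2))"
      by (rule inverse_power_summable) simp
    then have "summable (\<lambda>n. inverse (real (Suc n) ^ 2))"
      by (subst summable_Suc_iff)
    then have "summable (\<lambda>n. 2 * C * C * (\<delta> ^ Suc n + 2 * inverse (real (Suc n) ^ 2)))"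
      using \<delta> by (intro summable_mult summable_add) (auto simp: summable_Suc_iff intro!: summable_mult)
    then have sM: "summable M" by (simp add: M_def[abs_def] divide_inverse)
    from tannerys_theorem[OF lima bnd sM]
    have "((\<lambda>t. \<Sum>n. a n t) \<longlongrightarrow> (\<Sum>n. b n)) (at_right 0)" by simp
    \<comment> \<open>Beyond index \<open>m\<close> the product at \<open>x0\<close> contains a full
      block, which equals \<open>1 - x0^m = 0\<close>.\<close>
    moreover have "(\<Sum>n. b n) = (\<Sum>n<m. b n)"
    proof (rule suminf_finite)
      fix n assume "n \<notin> {..<m}"
      then obtain j where "Suc n = m + j" by (metis lessThan_iff less_Suc_eq_le linorder_not_less less_imp_Suc_add add_Suc_right)
      then have "qpoch x0 w (Suc n) = 0"
        using x0(2) by (simp only: qpoch_add qpoch_root) simp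
      then show "b n = 0" by (simp add: b_def)
    qed simp
    ultimately show ?thesis by (simp add: V_def[abs_def] a_def b_def V0_def)
  qed
  have "((\<lambda>t. - (1 / x t) + V t / (x t)\<^sup>2 - E t) \<longlongrightarrow> - (1 / x0) + V0 / x0\<^sup>2 - 0) (at_right 0)"
    using x00 by (intro tendsto_intros limx limV limE) auto
  moreover have "\<forall>\<^sub>F t in at_right 0. - (1 / x t) + V t / (x t)\<^sup>2 - E t
      = g3 (x t) (Q t) - theta_part (x t) (Q t) (S t)"
    using good by (rule eventually_mono) (use key in metis)
  ultimately have "((\<lambda>t. g3 (x t) (Q t) - theta_part (x t) (Q t) (S t)) \<longlongrightarrow> - (1 / x0) + V0 / x0\<^sup>2 - 0) (at_right 0)"
    by (rule Lim_transform_eventually)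
  then show ?thesis by (simp add: V0_def)
qed

end

subsection \<open>The radial limit\<close>

lemma zeta_add: "zeta (g + h) k = zeta g k * zeta h k"
  by (simp add: zeta_def ring_distribs add_divide_distrib exp_add)

lemma zeta_power: "zeta h k ^ n = zeta (h * int n) k"
  by (simp add: zeta_def mult_ac flip: exp_of_nat_mult)

lemma zeta_minus: "zeta (- h) k = 1 / zeta h k"
  by (simp add: zeta_def exp_minus field_simps)

lemma zeta_nonzero [simp]: "zeta h k \<noteq> 0"
  by (simp add: zeta_def)

lemma norm_zeta [simp]: "norm (zeta h k) = 1"
  by (simp add: zeta_def norm_exp_eq_Re)

lemma zeta_mult_cancel: "0 < d \<Longrightarrow> zeta (h * int d) (k * d) = zeta h k"
  by (simp add: zeta_def mult.assoc)

lemma zeta_eq_1_iff: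
  assumes "0 < k"
  shows "zeta h k = 1 \<longleftrightarrow> int k dvd h"
proof -
  have "zeta h k = 1 \<longleftrightarrow> (\<exists>n::int. 2 * pi * of_int h / of_nat k = of_int (2 * n) * pi)"
    unfolding zeta_def exp_eq_1 by simp
  also have "\<dots> \<longleftrightarrow> (\<exists>n::int. real_of_int h = of_int (n * int k))"
    using assms by (intro ex_cong1) (simp add: field_simps)
  also have "\<dots> \<longleftrightarrow> int k dvd h"
    by (simp only: of_int_eq_iff) (auto simp: dvd_def mult.commute)
  finally show ?thesis .
qed

text \<open>As \<open>h\<close> is invertible modulo \<open>k\<close>, the i-th power is trivial iff
  \<open>k\<close> divides \<open>B i\<close>, that is, iff \<open>k / gcd(k, B)\<close> divides
  \<open>i\<close>.\<close>

lemma unity_root_zeta: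
  assumes "0 < k" "coprime h (int k)" "0 < B"
  shows "unity_root (k div gcd k B) (zeta (h * int B) k)"
proof
  define g where "g = gcd k B"
  define m where "m = k div g"
  define B' where "B' = B div g"
  have k: "k = m * g" and B: "B = B' * g" by (simp_all add: m_def B'_def g_def)
  have g: "0 < g" using assms by (simp add: g_def)
  have "0 < m" using k assms by (cases m) auto
  then show "0 < k div gcd k B" by (simp add: m_def g_def)
  have cop: "coprime m B'" unfolding m_def B'_def g_def by (rule div_gcd_coprime) (use assms in simp)
  have iff: "zeta (h * int B) k ^ i = 1 \<longleftrightarrow> m dvd i" for i
  proof -
    have "zeta (h * int B) k ^ i = 1 \<longleftrightarrow> int k dvd h * int (B * i)"
      by (simp add: zeta_power zeta_eq_1_iff assms mult_ac)
    also have "\<dots> \<longleftrightarrow> int k dvd int (B * i)"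
      using assms(2) by (simp add: coprime_commute coprime_dvd_mult_right_iff)
    also have "\<dots> \<longleftrightarrow> m * g dvd (B' * i) * g"
      by (simp only: int_dvd_int_iff k[symmetric]) (simp add: B mult_ac)
    also have "\<dots> \<longleftrightarrow> m dvd B' * i" using g by simp
    also have "\<dots> \<longleftrightarrow> m dvd i" using cop by (simp add: coprime_dvd_mult_right_iff)
    finally show ?thesis .
  qed
  show "zeta (h * int B) k ^ (k div gcd k B) = 1"
    using iff by (simp flip: m_def g_def)
  show "zeta (h * int B) k ^ i \<noteq> 1" if "0 < i" "i < k div gcd k B" for i
    using iff[of i] that by (auto simp flip: m_def g_def dest: dvd_imp_le)
qed

text \<open>Membership provides only some representation in lowest terms; uniqueness of lowest terms
  identifies it with the given one.\<close>

lemma cusps_D: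
  assumes "of_int h / of_nat k \<in> cusps a b A B" "0 < k" "coprime h (int k)"
  shows "b dvd k" "int (gcd k B) dvd int (a * k div b) + int A * h"
proof -
  obtain h1 k1 where eq: "(of_int h :: rat) / of_nat k = of_int h1 / of_nat k1"
    and k1: "0 < k1" "coprime h1 (int k1)" "b dvd k1" "int (gcd k1 B) dvd int (a * k1 div b) + int A * h1"
    using assms(1) by (auto simp: cusps_def)
  have "(of_int h :: rat) * of_nat k1 = of_int h1 * of_nat k"
    using eq assms(2) k1(1) by (simp add: field_simps)
  then have "(of_int (h * int k1) :: rat) = of_int (h1 * int k)" by simp
  then have e: "h * int k1 = h1 * int k" by (simp only: of_int_eq_iff)
  have "int k dvd h * int k1" "int k1 dvd h1 * int k" by (simp add: e, simp flip: e)
  then have "int k dvd int k1" "int k1 dvd int k"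
    using assms(3) k1(2) by (simp_all add: coprime_commute coprime_dvd_mult_right_iff)
  then have "k = k1" by (simp add: dvd_antisym)
  moreover from this have "h = h1" using e assms(2) by simp
  ultimately show "b dvd k" "int (gcd k B) dvd int (a * k div b) + int A * h"
    using k1 by auto
qed

text \<open>Over the common denominator \<open>k\<close> the product is a root of unity with
  exponent \<open>a k / b + A h\<close>. The cusp condition makes this a multiple of
  \<open>gcd k B\<close>, so the power \<open>k div gcd k B\<close> lifts it to a multiple of
  \<open>k\<close>.\<close>

lemma zeta_product_root:
  assumes "0 < k" "0 < b" "b dvd k" "int (gcd k B) dvd int (a * k div b) + int A * h"
  shows "(zeta (int a) b * zeta (h * int A) k) ^ (k div gcd k B) = 1"
proof -
  obtain d where d: "k = b * d" using assms(3) by blast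
  have d0: "0 < d" using d assms(1) by (cases d) auto
  have "a * k div b = a * d" using assms(2) by (simp add: d)
  then have e: "zeta (int a) b * zeta (h * int A) k = zeta (int (a * k div b) + int A * h) k"
    using zeta_mult_cancel[OF d0, of "int a" b] by (simp add: d zeta_add mult_ac)
  obtain c where c: "int (a * k div b) + int A * h = int (gcd k B) * c" using assms(4) by blast
  have "int (gcd k B) * int (k div gcd k B) = int k" by (simp flip: of_nat_mult)
  then have "int (gcd k B) * c * int (k div gcd k B) = int k * c" by (metis mult.assoc mult.commute)
  then have "int k dvd int (gcd k B) * c * int (k div gcd k B)" by (metis dvd_triv_left)
  then show ?thesis
    unfolding e zeta_power c using assms(1) by (simp only: zeta_eq_1_iff)
qed

text \<open>The square root is a function \<open>s\<close> constrained along the ray, which is all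
  that a radial limit sees. For odd \<open>k'\<close> its power \<open>s^k'\<close> is real there,
  so the sign of the real part singles out one root.\<close>

theorem theorem2p2:
  fixes a b A B k k' :: nat and h :: int and s :: "complex \<Rightarrow> complex"
  assumes "1 \<le> b" and "1 \<le> B" and "coprime a b" and "b = 1 \<Longrightarrow> \<not> B dvd A"
    and "1 \<le> k" and "coprime h (int k)"
    and "k' = k div gcd k B"
    and "of_int h / of_nat k \<in> cusps a b A B"
    and sqrt: "\<And>t. t > 0 \<Longrightarrow> (s (radial (zeta h k) t))\<^sup>2 = radial (zeta h k) t ^ B"
    and branch: "\<And>t. odd k' \<Longrightarrow> t > 0 \<Longrightarrow> Re (s (radial (zeta h k) t) ^ k') < 0"
  shows "has_radial_limit
      (\<lambda>q. g3 (zeta (int a) b * q ^ A) (q ^ B)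
             - theta_part (zeta (int a) b * q ^ A) (q ^ B) (s q))
      (zeta h k)
      (- (zeta (- int a) b * zeta (- h * int A) k)
        + zeta (- 2 * int a) b * zeta (- 2 * h * int A) k *
          (\<Sum>n = 1..k'.
             qpoch (zeta (- int a) b * zeta (h * (int B - int A)) k) (zeta (h * int B) k) (n - 1)
             * qpoch (zeta (int a) b * zeta (h * int A) k) (zeta (h * int B) k) n
             * zeta (h * int B * int n) k))"
proof -
  define w where "w = zeta (h * int B) k"
  define x0 where "x0 = zeta (int a) b * zeta (h * int A) k"
  have pos: "0 < k" "0 < b" "0 < B" using assms by auto
  interpret unity_root k' w
    unfolding w_def assms(7) by (rule unity_root_zeta[OF pos(1) assms(6) pos(3)])
  have x0: "norm x0 = 1" "x0 ^ k' = 1"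
    unfolding x0_def assms(7)
    using zeta_product_root[OF pos(1,2) cusps_D[OF assms(8) pos(1) assms(6)]]
    by (simp_all add: norm_mult)
  define Q where "Q = (\<lambda>t. w * complex_of_real (exp (- real B * t)))"
  define x where "x = (\<lambda>t. x0 * complex_of_real (exp (- real A * t)))"
  define S where "S = (\<lambda>t. s (radial (zeta h k) t))"
  have rp: "radial (zeta h k) t ^ n = zeta (h * int n) k * of_real (exp (- real n * t))" for t n
    by (simp add: radial_def power_mult_distrib zeta_power flip: of_real_power exp_of_nat_mult)
  have Q_eq: "radial (zeta h k) t ^ B = Q t" for t
    by (simp add: rp Q_def w_def)
  have x_eq: "zeta (int a) b * radial (zeta h k) t ^ A = x t" for t
    by (simp add: rp x_def x0_def)
  have nQ: "norm (Q t) = exp (- real B * t)" for t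
    by (simp add: Q_def norm_mult)
  have nome: "nome (Q t)" if "t > 0" for t
  proof
    show "Q t \<noteq> 0" using nQ[of t] by auto
    show "norm (Q t) < 1" unfolding nQ using that pos by simp
  qed
  have off: "nome.off_lattice (Q t) (x t)" if t: "t > 0" for t
    unfolding nome.off_lattice_def[OF nome[OF t]]
  proof (intro conjI allI notI)
    have nx: "norm (x t) = exp (- real A * t)" by (simp add: x_def norm_mult x0)
    then show "x t = 0 \<Longrightarrow> False" by auto
    fix n :: int
    assume eq: "x t * Q t powi n = 1"
    \<comment> \<open>Comparing moduli at \<open>t > 0\<close> forces
      \<open>A + B n = 0\<close>.\<close>
    have "exp (- (real A + real B * of_int n) * t) = norm (x t * Q t powi n)"
      unfolding norm_mult norm_power_int nx nQ
      by (simp add: exp_power_int algebra_simps flip: exp_add)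
    then have "exp (- (real A + real B * of_int n) * t) = 1" using eq by (simp only: norm_one)
    then have "- (real A + real B * of_int n) * t = 0" by (simp only: exp_eq_one_iff)
    then have "(real A + real B * of_int n) * t = 0" by (simp only: mult_minus_left neg_equal_0_iff_equal)
    then have "real_of_int (int A + int B * n) = 0" using t by simp
    then have "int A + int B * n = 0" by (simp only: of_int_eq_0_iff)
    then have An: "int A = int B * (- n)" by simp
    have "n \<le> 0"
    proof (rule ccontr)
      assume "\<not> n \<le> 0"
      then have "int B * n > 0" using pos by simp
      then show False using An by simp
    qed
    then obtain N where n: "n = - int N" by (metis add.inverse_inverse neg_0_le_iff_le nonneg_int_cases)
    have A: "A = B * N" using An unfolding n by (simp flip: of_nat_mult)
    \<comment> \<open>The powers of the nome now cancel and leave \<open>zeta (int a) b = 1\<close>.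
      By coprimality this means \<open>b = 1\<close>, and then \<open>B dvd A\<close> contradicts
      the hypothesis.\<close>
    have "x t = zeta (int a) b * Q t ^ N"
      by (simp add: A power_mult flip: x_eq Q_eq)
    then have "zeta (int a) b = 1"
      using eq nome.q_nz[OF nome[OF t]] by (simp add: n power_int_minus mult.assoc)
    then have "int b dvd int a" using pos by (simp add: zeta_eq_1_iff)
    then have "b = 1" using assms(3) by (simp add: coprime_absorb_right)
    then show False using assms(4) A by simp
  qed
  have S2: "(S t)\<^sup>2 = Q t" if "t > 0" for t
    using sqrt[OF that] by (simp add: S_def Q_eq)
  have Qm: "Q t ^ k' = of_real (exp (- real B * t) ^ k')" for t
    using power_nome[of "exp (- real B * t)" 1] by (simp add: Q_def)
  have Sm: "S t ^ k' = - of_real (norm (S t) ^ k')" if t: "t > 0" for t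
  proof (cases "even k'")
    case True
    then obtain j where j: "k' = 2 * j" by blast
    \<comment> \<open>For even order the middle power of a primitive root is -1, so
      \<open>S^k' = (S^2)^j = Q^j\<close> is negative for either square root.\<close>
    have "w ^ j \<noteq> 1" using w_prim[of j] m_pos j by simp
    moreover have "(w ^ j)\<^sup>2 = 1" using w_root by (simp add: j mult.commute flip: power_mult)
    ultimately have wj: "w ^ j = - 1" by (simp add: power2_eq_1_iff)
    have "S t ^ k' = - of_real (exp (- real B * t) ^ j)"
      by (simp add: j power_mult S2[OF t] Q_def power_mult_distrib wj)
    moreover from arg_cong[OF this, of norm] have "norm (S t) ^ k' = exp (- real B * t) ^ j"
      by (simp add: norm_power)
    ultimately show ?thesis by simp
  next
    case False
    \<comment> \<open>A number with positive square is real; the branch hypothesis then selects the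
      negative value.\<close>
    have "(S t ^ k')\<^sup>2 = of_real (exp (- real B * t) ^ k')"
      unfolding Qm[symmetric] S2[OF t, symmetric] by (simp add: mult.commute flip: power_mult)
    moreover from arg_cong[OF this, of norm] have "(norm (S t) ^ k')\<^sup>2 = exp (- real B * t) ^ k'"
      by (simp add: norm_power)
    ultimately have "(S t ^ k')\<^sup>2 = (of_real (norm (S t) ^ k'))\<^sup>2"
      by (metis of_real_power)
    then have "S t ^ k' = of_real (norm (S t) ^ k') \<or> S t ^ k' = - of_real (norm (S t) ^ k')"
      by (simp only: power2_eq_iff)
    moreover have "Re (S t ^ k') < 0" using branch[OF False t] by (simp add: S_def)
    moreover have "0 \<le> norm (S t) ^ k'" by simp
    ultimately show ?thesis by (metis Re_complex_of_real linorder_not_less)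
  qed
  have "((\<lambda>t. g3 (x t) (Q t) - theta_part (x t) (Q t) (S t)) \<longlongrightarrow>
    - (1 / x0) + 1 / x0\<^sup>2 * (\<Sum>n<k'. qpoch (w / x0) w n * qpoch x0 w (Suc n) * w ^ Suc n)) (at_right 0)"
    unfolding Q_def x_def
    by (rule radial_limit_g3[OF x0 _ _ off[unfolded Q_def x_def] S2[unfolded Q_def] Sm]) (use pos in auto)
  note lim = this
  have e1: "zeta (- int a) b * zeta (- h * int A) k = 1 / x0"
    using zeta_minus[of "h * int A" k] by (simp add: x0_def zeta_minus)
  have e2: "zeta (- 2 * int a) b * zeta (- 2 * h * int A) k = 1 / x0\<^sup>2"
  proof -
    have "x0\<^sup>2 = zeta (2 * int a) b * zeta (2 * h * int A) k"
      by (simp add: x0_def power_mult_distrib zeta_power mult_ac)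
    then show ?thesis
      using zeta_minus[of "2 * int a" b] zeta_minus[of "2 * h * int A" k] by simp
  qed
  have e3: "zeta (- int a) b * zeta (h * (int B - int A)) k = w / x0"
    using zeta_add[of "h * int B" "- (h * int A)" k]
    by (simp add: w_def x0_def zeta_minus right_diff_distrib)
  have e4: "zeta (h * int B * int n) k = w ^ n" for n
    by (simp add: w_def zeta_power)
  have S_eq: "s (radial (zeta h k) t) = S t" for t
    by (simp add: S_def)
  show ?thesis
    using lim unfolding has_radial_limit_def x_eq Q_eq S_eq e1 e2 e3 e4 w_def[symmetric] x0_def[symmetric]
    by (simp only: One_nat_def sum.atLeast1_atMost_eq diff_Suc_Suc diff_zero)
qed

end
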